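(* Let $\mu$ be the probability measure $\mu(\mathrm{d}x)=Z_\mu^{-1}\mathrm{e}^{-U(x)}\,\mathrm{d}x$ on $\mathbb{R}^n$ described in the context, with $V$ $\rho$-convex, $\rho>0$. Then for all $f\in H^1(\mu)$, $$\mathrm{var}_\mu(f)\leq \frac{1}{\rho}\int_{\mathbb{R}^n}|\nabla f|^2\,\mathrm{d}\mu .$$ This holds in particular with $\rho=n$ when $\mu$ is the beta Hermite ensemble, for all $\beta>0$.
   Context: Let $n\geq 1$ be an integer and $|\cdot|$ the Euclidean norm on $\mathbb{R}^n$. For $\rho\in\mathbb{R}$, a function $\phi:\mathbb{R}^n\to\mathbb{R}\cup\{+\infty\}$ is called $\rho$-convex when $x\mapsto \phi(x)-\rho|x|^2/2$ is convex. Setting: $V:\mathbb{R}^n\to\mathbb{R}$ is $\rho$-convex for some $\rho>0$; $W:\mathbb{R}\to\mathbb{R}\cup\{+\infty\}$ is convex with domain $(0,+\infty)$, i.e. $W$ is finite on $(0,+\infty)$ and $W\equiv+\infty$ on $(-\infty,0]$. Set $U(x)=V(x)+\sum_{i<j}W(x_i-x_j)\in\mathbb{R}\cup\{+\infty\}$, which is finite exactly on $D=\{x\in\mathbb{R}^n: x_1>\cdots>x_n\}$. Assume $Z_\mu=\int_{\mathbb{R}^n}\mathrm{e}^{-U(x)}\,\mathrm{d}x<\infty$ and let $\mu$ be the probability measure with density $\mathrm{e}^{-U}/Z_\mu$ with respect to Lebesgue measure. Beta Hermite ensemble ($\beta>0$): the case $V(x)=\frac n2|x|^2$, $W(u)=-\beta\log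 u$ for $u>0$ and $W(u)=+\infty$ for $u\le 0$, i.e. $\mathrm{d}\mu(x)=Z_\mu^{-1}\mathrm{e}^{-\frac n2|x|^2}\prod_{i<j}(x_i-x_j)^\beta\,\mathbf{1}_{\{x_1\geq\cdots\geq x_n\}}\,\mathrm{d}x$. $L^2(\mu)$ is the space of measurable functions $\mathbb{R}^n\to\mathbb{R}$ square integrable with respect to $\mu$; $H^1(\mu)$ is the Sobolev space of functions in $L^2(\mu)$ with weak derivative in $L^2(\mu)$ in the sense of Schwartz distributions. The variance is $\mathrm{var}_\mu(f)=\int f^2\,\mathrm{d}\mu-\left(\int f\,\mathrm{d}\mu\right)^2$. *)

theory Defs
  imports "HOL-Analysis.Analysis"
begin

text \<open>
  The space \<open>\<real>\<^sup>n\<close> is \<^typ>\<open>real ^ 'n\<close> with \<open>n = CARD('n)\<close>; the class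
  \<^class>\<open>linorder\<close> on the index type provides the ordering of the coordinates.
\<close>

subsection \<open>Convexity of functions with values in \<open>\<real> \<union> {+\<infinity>}\<close>\<close>

text \<open>At \<open>t = 0\<close> and \<open>t = 1\<close> the convention \<open>0 * \<infinity> = 0\<close> of \<^typ>\<open>ereal\<close> makes the
  inequality trivial.\<close>

definition convex_ext :: "('a::real_vector \<Rightarrow> ereal) \<Rightarrow> bool" where
  "convex_ext \<phi> \<longleftrightarrow> (\<forall>x. \<phi> x \<noteq> -\<infinity>) \<and>
     (\<forall>x y. \<forall>t\<in>{0..1::real}.
        \<phi> ((1 - t) *\<^sub>R x + t *\<^sub>R y) \<le> ereal (1 - t) * \<phi> x + ereal t * \<phi> y)"

definition rho_convex :: "real \<Rightarrow> ('a::real_normed_vector \<Rightarrow> ereal) \<Rightarrow> bool" where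
  "rho_convex \<rho> \<phi> \<longleftrightarrow> convex_ext (\<lambda>x. \<phi> x - ereal (\<rho> * (norm x)\<^sup>2 / 2))"

lemma convex_ext_real_iff: "convex_ext (\<lambda>x. ereal (f x)) \<longleftrightarrow> convex_on UNIV f"
proof
  assume "convex_ext (\<lambda>x. ereal (f x))"
  then show "convex_on UNIV f"
    by (intro convex_onI) (auto simp: convex_ext_def)
next
  assume "convex_on UNIV f"
  then show "convex_ext (\<lambda>x. ereal (f x))"
    by (auto simp: convex_ext_def dest: convex_onD)
qed

subsection \<open>Gibbs measures\<close>

definition chamber :: "(real ^ 'n::{finite,linorder}) set" where
  "chamber = {x. \<forall>i j. i < j \<longrightarrow> x $ i > x $ j}"

definition energy ::
    "(real ^ 'n::{finite,linorder} \<Rightarrow> real) \<Rightarrow> (real \<Rightarrow> ereal) \<Rightarrow> real ^ 'n::{finite,linorder} \<Rightarrow> ereal" where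
  "energy V W x = ereal (V x) + (\<Sum>(i, j)\<in>{(i, j). i < j}. W (x $ i - x $ j))"

definition exp_neg :: "ereal \<Rightarrow> real" where
  "exp_neg u = (if u = \<infinity> then 0 else exp (- real_of_ereal u))"

definition partition_fun :: "('a::euclidean_space \<Rightarrow> ereal) \<Rightarrow> ennreal" where
  "partition_fun U = (\<integral>\<^sup>+ x. ennreal (exp_neg (U x)) \<partial>lborel)"

definition gibbs :: "('a::euclidean_space \<Rightarrow> ereal) \<Rightarrow> 'a measure" where
  "gibbs U = density lborel (\<lambda>x. ennreal (exp_neg (U x)) / partition_fun U)"

lemma energy_finite_iff:
  fixes V :: "real ^ 'n::{finite,linorder} \<Rightarrow> real"
  assumes "\<And>u. u > 0 \<Longrightarrow> \<bar>W u\<bar> \<noteq> \<infinity>" and "\<And>u. u \<le> 0 \<Longrightarrow> W u = \<infinity>"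
  shows "\<bar>energy V W x\<bar> \<noteq> \<infinity> \<longleftrightarrow> x \<in> chamber"
proof -
  have W: "\<bar>W u\<bar> = \<infinity> \<longleftrightarrow> u \<le> 0" for u
    using assms[of u] by force
  have "\<bar>energy V W x\<bar> = \<infinity> \<longleftrightarrow> \<bar>\<Sum>(i, j)\<in>{(i, j). i < j}. W (x $ i - x $ j)\<bar> = \<infinity>"
    by (cases "\<Sum>(i, j)\<in>{(i, j). i < j}. W (x $ i - x $ j)") (auto simp: energy_def)
  also have "\<dots> \<longleftrightarrow> (\<exists>p\<in>{(i, j). i < j}. \<bar>case p of (i, j) \<Rightarrow> W (x $ i - x $ j)\<bar> = \<infinity>)"
    by (subst sum_Inf) simp
  finally show ?thesis
    by (auto simp: W chamber_def not_le)
qed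

subsection \<open>The beta Hermite ensemble\<close>

definition hermite_V :: "real ^ 'n \<Rightarrow> real" where
  "hermite_V x = real CARD('n) / 2 * (norm x)\<^sup>2"

definition hermite_W :: "real \<Rightarrow> real \<Rightarrow> ereal" where
  "hermite_W \<beta> u = (if u > 0 then ereal (- \<beta> * ln u) else \<infinity>)"

definition beta_hermite :: "real \<Rightarrow> (real ^ 'n::{finite,linorder}) measure" where
  "beta_hermite \<beta> = gibbs (energy hermite_V (hermite_W \<beta>))"

lemma exp_neg_energy_hermite:
  fixes x :: "real ^ 'n::{finite,linorder}"
  shows "exp_neg (energy hermite_V (hermite_W \<beta>) x) =
    exp (- (real CARD('n) / 2 * (norm x)\<^sup>2)) *
    (\<Prod>(i, j)\<in>{(i, j). i < j}. (x $ i - x $ j) powr \<beta>) * indicator chamber x"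
proof (cases "x \<in> chamber")
  case True
  have "(\<Sum>(i, j)\<in>{(i, j). i < j}. hermite_W \<beta> (x $ i - x $ j))
      = (\<Sum>p\<in>{(i, j). i < j}. ereal (case p of (i, j) \<Rightarrow> - \<beta> * ln (x $ i - x $ j)))"
    using True by (intro sum.cong) (auto simp: hermite_W_def chamber_def)
  also have "\<dots> = ereal (\<Sum>(i, j)\<in>{(i, j). i < j}. - \<beta> * ln (x $ i - x $ j))"
    by (rule sum_ereal)
  finally have *: "energy hermite_V (hermite_W \<beta>) x =
      ereal (hermite_V x + (\<Sum>(i, j)\<in>{(i, j). i < j}. - \<beta> * ln (x $ i - x $ j)))"
    by (simp add: energy_def)
  have "(\<Prod>(i, j)\<in>{(i, j). i < j}. (x $ i - x $ j) powr \<beta>)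
      = (\<Prod>p\<in>{(i, j). i < j}. exp (- (case p of (i, j) \<Rightarrow> - \<beta> * ln (x $ i - x $ j))))"
    using True by (intro prod.cong) (force simp: powr_def chamber_def)+
  also have "\<dots> = exp (- (\<Sum>(i, j)\<in>{(i, j). i < j}. - \<beta> * ln (x $ i - x $ j)))"
    by (simp add: exp_sum sum_negf[symmetric])
  finally show ?thesis
    using True by (simp add: * exp_neg_def hermite_V_def mult_exp_exp)
next
  case False
  then obtain p where "p \<in> {(i, j). i < j}" "(case p of (i, j) \<Rightarrow> hermite_W \<beta> (x $ i - x $ j)) = \<infinity>"
    by (force simp: chamber_def hermite_W_def)
  then have "(\<Sum>(i, j)\<in>{(i, j). i < j}. hermite_W \<beta> (x $ i - x $ j)) = \<infinity>"
    by (subst sum_Pinfty) (auto intro!: bexI[of _ p])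
  then show ?thesis
    using False by (simp add: energy_def exp_neg_def)
qed

subsection \<open>Weak derivatives and Sobolev spaces\<close>

primrec C_k :: "nat \<Rightarrow> ('a::euclidean_space \<Rightarrow> real) \<Rightarrow> bool" where
  "C_k 0 \<phi> \<longleftrightarrow> continuous_on UNIV \<phi>"
| "C_k (Suc k) \<phi> \<longleftrightarrow> (\<forall>x. \<phi> differentiable (at x)) \<and>
     (\<forall>b\<in>Basis. C_k k (\<lambda>x. frechet_derivative \<phi> (at x) b))"

definition test_function :: "'a::euclidean_space set \<Rightarrow> ('a \<Rightarrow> real) \<Rightarrow> bool" where
  "test_function \<Omega> \<phi> \<longleftrightarrow> (\<forall>k. C_k k \<phi>) \<and>
     compact (closure {x. \<phi> x \<noteq> 0}) \<and> closure {x. \<phi> x \<noteq> 0} \<subseteq> \<Omega>"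

definition locally_integrable ::
    "'a::euclidean_space set \<Rightarrow> ('a \<Rightarrow> 'b::euclidean_space) \<Rightarrow> bool" where
  "locally_integrable \<Omega> f \<longleftrightarrow> (\<forall>K. compact K \<and> K \<subseteq> \<Omega> \<longrightarrow> set_integrable lborel K f)"

definition has_weak_gradient ::
    "'a::euclidean_space set \<Rightarrow> ('a \<Rightarrow> real) \<Rightarrow> ('a \<Rightarrow> 'a) \<Rightarrow> bool" where
  "has_weak_gradient \<Omega> f g \<longleftrightarrow> locally_integrable \<Omega> f \<and> locally_integrable \<Omega> g \<and>
     (\<forall>\<phi>. test_function \<Omega> \<phi> \<longrightarrow> (\<forall>b\<in>Basis.
        (LINT x|lborel. f x * frechet_derivative \<phi> (at x) b) =
        - (LINT x|lborel. (g x \<bullet> b) * \<phi> x)))"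

definition L2 :: "'a measure \<Rightarrow> ('a \<Rightarrow> 'b::euclidean_space) set" where
  "L2 M = {f \<in> borel_measurable M. integrable M (\<lambda>x. (norm (f x))\<^sup>2)}"

text \<open>
  The measures considered here are carried by an open set \<open>\<Omega>\<close>, on compact subsets of which
  their density is bounded below. Elements of \<open>L\<^sup>2(\<mu>)\<close> are thus locally integrable on \<open>\<Omega>\<close>, but
  not necessarily on the whole space (and their values off \<open>\<Omega>\<close> are irrelevant), so the
  derivatives are taken in the sense of distributions on \<open>\<Omega>\<close>.
\<close>

definition H1 :: "'a::euclidean_space measure \<Rightarrow> 'a set \<Rightarrow> ('a \<Rightarrow> real) set" where
  "H1 \<mu> \<Omega> = {f \<in> L2 \<mu>. \<exists>g\<in>L2 \<mu>. has_weak_gradient \<Omega> f g}"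

definition var :: "'a measure \<Rightarrow> ('a \<Rightarrow> real) \<Rightarrow> real" where
  "var \<mu> f = (LINT x|\<mu>. (f x)\<^sup>2) - (LINT x|\<mu>. f x)\<^sup>2"

end

theory Submission
  imports Defs "HOL-Probability.Distributions" "HOL-Real_Asymp.Real_Asymp"
begin

text \<open>
  Write the law as \<open>p / Z\<close> with \<open>p = exp (- U)\<close> on an open convex set \<open>\<Omega>\<close> (the chamber), where
  \<open>U - \<rho> / 2 * |x|\<^sup>2\<close> is convex. This strong convexity is the source of the gap: the pair
  interaction \<open>W\<close> is convex, so it preserves the constant \<open>\<rho>\<close> coming from \<open>V\<close>, and its domain makes the chamber
  convex.

  The spectral gap comes from the Prekopa-Leindler inequality (\<open>prekopa_leindler\<close>) through the
  infimum-convolution argument of Maurey and of Bobkov and Ledoux. Let \<open>F\<close> be regular and \<open>e > 0\<close>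
  small. The excess \<open>\<rho> / 4 * |x - y|\<^sup>2\<close> in the midpoint convexity of \<open>U\<close> allows one to compare
  \<open>p * exp (Q (e * F))\<close> at \<open>x\<close> and \<open>p * exp (- e * F)\<close> at \<open>y\<close> with \<open>p\<^sup>2\<close> at the midpoint, where
  \<open>Q f x\<close> is the infimum over \<open>y\<close> of \<open>f y + \<rho> / 4 * |x - y|\<^sup>2\<close>. Hence
  \<open>(\<integral> p * exp (Q (e * F))) * (\<integral> p * exp (- e * F)) \<le> Z\<^sup>2\<close>. As
  \<open>Q (e * F) = e * F - e\<^sup>2 * |\<nabla>F|\<^sup>2 / \<rho> + o (e\<^sup>2)\<close>, the terms of order \<open>e\<^sup>2\<close> give
  \<open>Z * \<integral> p * F\<^sup>2 - (\<integral> p * F)\<^sup>2 \<le> Z / \<rho> * \<integral> p * |\<nabla>F|\<^sup>2\<close>, which is the Poincare inequality multiplied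
  by \<open>Z\<^sup>2\<close> (\<open>poincare_quadratic_minorant\<close>).

  A weakly differentiable \<open>f\<close> is reached in two limits. The restriction of \<open>p\<close> to a compact convex \<open>K \<subseteq> \<Omega>\<close> is still strongly log-concave,
  and a mollification \<open>f * \<eta>\<^sub>r\<close> with small \<open>r\<close> is smooth near \<open>K\<close> with gradient \<open>g * \<eta>\<^sub>r\<close>. The
  first step applies to it on \<open>K\<close>, whatever happens at the boundary of \<open>K\<close>, because it compares values
  of \<open>F\<close> at pairs of points of \<open>K\<close> and involves no integration by parts. As \<open>r \<rightarrow> 0\<close>, Jensen's inequality
  \<open>|g * \<eta>\<^sub>r|\<^sup>2 \<le> |g|\<^sup>2 * \<eta>\<^sub>r\<close> and Fatou's lemma for \<open>\<integral> p * (f * \<eta>\<^sub>r)\<^sup>2\<close> reduce everything to the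
  convergence of mollifications in \<open>L\<^sup>1\<close> (\<open>poincare_compact\<close>). Letting \<open>K\<close> increase to \<open>\<Omega>\<close> gives the
  inequality on \<open>\<Omega>\<close> (\<open>poincare_log_concave\<close>). For the beta Hermite ensemble it remains to see that
  the partition function is finite.
\<close>

section \<open>The Prekopa-Leindler inequality\<close>

lemma emeasure_lborel_preimage_double:
  fixes A :: "real set"
  assumes [measurable]: "A \<in> sets borel"
  shows "emeasure lborel A = 2 * emeasure lborel {z. 2 * z - c \<in> A}"
proof -
  have "emeasure lborel A = (\<integral>\<^sup>+x. indicator A x \<partial>lborel)" by simp
  also have "\<dots> = 2 * (\<integral>\<^sup>+x. indicator A (- c + 2 * x) \<partial>lborel)"
    by (subst nn_integral_real_affine[where c=2 and t="-c"]) auto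
  also have "(\<integral>\<^sup>+x. indicator A (- c + 2 * x) \<partial>lborel) = (\<integral>\<^sup>+x. indicator {z. 2 * z - c \<in> A} x \<partial>lborel)"
    by (intro nn_integral_cong) (auto simp: indicator_def)
  finally show ?thesis by simp
qed

text \<open>
  Choose \<open>a0 \<in> A\<close> close to the supremum of \<open>A\<close> and \<open>b0 \<in> B\<close> close to the infimum of \<open>B\<close>. Up to a small
  error \<open>A\<close> lies below \<open>a0\<close> and \<open>B\<close> above \<open>b0\<close>, so the translates \<open>A + b0\<close> and \<open>a0 + B\<close> are separated by
  the point \<open>a0 + b0\<close>. Both are contained in \<open>2 C\<close>, which thus has at least the sum of their measures.
\<close>

lemma brunn_minkowski_midpoint_bounded:
  fixes A B C :: "real set"
  assumes [measurable]: "A \<in> sets borel" "B \<in> sets borel" "C \<in> sets borel"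
    and ne: "A \<noteq> {}" "B \<noteq> {}" and bd: "bounded A" "bounded B"
    and mid: "\<And>a b. a \<in> A \<Longrightarrow> b \<in> B \<Longrightarrow> (a + b) / 2 \<in> C"
  shows "emeasure lborel A + emeasure lborel B \<le> 2 * emeasure lborel C"
proof (rule ennreal_le_epsilon)
  fix e :: real assume e: "e > 0"
  have bA: "bdd_above A" and bB: "bdd_below B"
    using bd bounded_imp_bdd_above bounded_imp_bdd_below by auto
  obtain a0 where a0: "a0 \<in> A" "a0 > Sup A - e / 2"
    using less_cSup_iff[OF ne(1) bA, of "Sup A - e/2"] e by auto
  obtain b0 where b0: "b0 \<in> B" "b0 < Inf B + e / 2"
    using cInf_less_iff[OF ne(2) bB, of "Inf B + e/2"] e by auto
  define A' where "A' = A \<inter> {..a0}"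
  define B' where "B' = B \<inter> {b0<..}"
  have [measurable]: "A' \<in> sets borel" "B' \<in> sets borel" by (auto simp: A'_def B'_def)
  have "emeasure lborel A \<le> emeasure lborel (A' \<union> {a0..a0 + e/2})"
    using cSup_upper[OF _ bA] a0 by (intro emeasure_mono) (force simp: A'_def)+
  also have "\<dots> \<le> emeasure lborel A' + emeasure lborel {a0..a0 + e/2}"
    by (intro emeasure_subadditive) auto
  also have "emeasure lborel {a0..a0 + e/2} = ennreal (e/2)" using e by simp
  finally have A: "emeasure lborel A \<le> emeasure lborel A' + ennreal (e/2)" .
  have "emeasure lborel B \<le> emeasure lborel (B' \<union> {b0 - e/2..b0})"
    using cInf_lower[OF _ bB] b0 by (intro emeasure_mono) (force simp: B'_def)+
  also have "\<dots> \<le> emeasure lborel B' + emeasure lborel {b0 - e/2..b0}"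
    by (intro emeasure_subadditive) auto
  also have "emeasure lborel {b0 - e/2..b0} = ennreal (e/2)" using e by simp
  finally have B: "emeasure lborel B \<le> emeasure lborel B' + ennreal (e/2)" .
  define A2 where "A2 = {z. 2 * z - b0 \<in> A'}"
  define B2 where "B2 = {z. 2 * z - a0 \<in> B'}"
  have "{z. 2 * z - b0 \<in> A'} \<in> sets lborel" "{z. 2 * z - a0 \<in> B'} \<in> sets lborel"
    by measurable
  then have [measurable]: "A2 \<in> sets borel" "B2 \<in> sets borel"
    by (simp_all add: A2_def B2_def)
  have "A2 \<inter> B2 = {}" by (auto simp: A2_def B2_def A'_def B'_def)
  moreover have "A2 \<union> B2 \<subseteq> C"
    using mid[OF _ b0(1)] mid[OF a0(1)]
    by (fastforce simp: A2_def B2_def A'_def B'_def)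
  ultimately have C: "emeasure lborel A2 + emeasure lborel B2 \<le> emeasure lborel C"
    by (subst plus_emeasure) (auto intro!: emeasure_mono)
  have "emeasure lborel A + emeasure lborel B
      \<le> (emeasure lborel A' + ennreal (e/2)) + (emeasure lborel B' + ennreal (e/2))"
    using A B by (rule add_mono)
  also have "\<dots> = (emeasure lborel A' + emeasure lborel B') + (ennreal (e/2) + ennreal (e/2))"
    by (simp add: ac_simps)
  also have "ennreal (e/2) + ennreal (e/2) = ennreal e"
    using e by (subst ennreal_plus[symmetric]) auto
  also have "emeasure lborel A' + emeasure lborel B' = 2 * (emeasure lborel A2 + emeasure lborel B2)"
    unfolding A2_def B2_def distrib_left
    by (subst (1 2) emeasure_lborel_preimage_double[symmetric]) auto
  also have "2 * (emeasure lborel A2 + emeasure lborel B2) \<le> 2 * emeasure lborel C"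
    using C by (rule mult_left_mono) simp
  finally show "emeasure lborel A + emeasure lborel B \<le> 2 * emeasure lborel C + ennreal e"
    by simp
qed

lemma brunn_minkowski_midpoint:
  fixes A B C :: "real set"
  assumes [measurable]: "A \<in> sets borel" "B \<in> sets borel" "C \<in> sets borel"
    and ne: "A \<noteq> {}" "B \<noteq> {}"
    and mid: "\<And>a b. a \<in> A \<Longrightarrow> b \<in> B \<Longrightarrow> (a + b) / 2 \<in> C"
  shows "emeasure lborel A + emeasure lborel B \<le> 2 * emeasure lborel C"
proof -
  obtain a b where ab: "a \<in> A" "b \<in> B" using ne by auto
  have lim: "(\<lambda>n::nat. emeasure lborel (S \<inter> {-real n..real n})) \<longlonglongrightarrow> emeasure lborel S"
    if [measurable]: "S \<in> sets borel" for S :: "real set"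
  proof -
    have "(\<Union>n. S \<inter> {-real n..real n}) = S"
    proof safe
      fix x assume "x \<in> S"
      obtain n where "\<bar>x\<bar> \<le> real n" using real_arch_simple by blast
      then show "x \<in> (\<Union>n. S \<inter> {-real n..real n})"
        using \<open>x \<in> S\<close> by (intro UN_I[of n]) auto
    qed
    moreover have inc: "incseq (\<lambda>n. S \<inter> {-real n..real n})"
      by (auto simp: incseq_def)
    have "range (\<lambda>n. S \<inter> {-real n..real n}) \<subseteq> sets lborel" by auto
    note Lim_emeasure_incseq[OF this inc]
    ultimately show ?thesis by (simp only:)
  qed
  show ?thesis
  proof (rule LIMSEQ_le_const2[OF tendsto_add[OF lim[of A] lim[of B]]])
    obtain N where N: "max \<bar>a\<bar> \<bar>b\<bar> \<le> real N" using real_arch_simple by blast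
    show "\<exists>N. \<forall>n\<ge>N. emeasure lborel (A \<inter> {-real n..real n}) + emeasure lborel (B \<inter> {-real n..real n})
        \<le> 2 * emeasure lborel C"
    proof (intro exI[of _ N] allI impI brunn_minkowski_midpoint_bounded)
      fix n assume n: "n \<ge> N"
      have "a \<in> A \<inter> {-real n..real n}" "b \<in> B \<inter> {-real n..real n}" using ab N n by auto
      then show "A \<inter> {-real n..real n} \<noteq> {}" "B \<inter> {-real n..real n} \<noteq> {}" by blast+
    qed (auto intro: mid)
  qed auto
qed

text \<open>
  Fubini's theorem for the region under the graph.
\<close>

lemma nn_integral_layer_cake:
  fixes u :: "real \<Rightarrow> ennreal"
  assumes [measurable]: "u \<in> borel_measurable borel"
  shows "(\<integral>\<^sup>+x. u x \<partial>lborel) = (\<integral>\<^sup>+t. indicator {0..} t * emeasure lborel {x. ennreal t < u x} \<partial>lborel)"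
proof -
  have u: "u x = (\<integral>\<^sup>+t. indicator {0..} t * indicator {x. ennreal t < u x} x \<partial>lborel)" for x
  proof (cases "u x")
    case (real r)
    have "(\<integral>\<^sup>+t. indicator {0..} t * indicator {x. ennreal t < u x} x \<partial>lborel)
        = (\<integral>\<^sup>+t. indicator {0..<r} t \<partial>lborel)"
      using real by (intro nn_integral_cong) (auto simp: indicator_def ennreal_less_iff)
    also have "\<dots> = ennreal r" using real by simp
    finally show ?thesis using real by simp
  next
    case top
    have "\<infinity> = emeasure lborel {0::real..}"
    proof -
      have "ennreal (real n) \<le> emeasure lborel {0::real..}" for n
      proof -
        have "emeasure lborel {0..real n} \<le> emeasure lborel {0::real..}"
          by (intro emeasure_mono) auto
        then show ?thesis by simp
      qed
      then show ?thesis
        using SUP_least[of UNIV "\<lambda>n::nat. of_nat n" "emeasure lborel {0::real..}"]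
        by (simp add: ennreal_SUP_of_nat_eq_top top_unique flip: ennreal_of_nat_eq_real_of_nat)
    qed
    also have "emeasure lborel {0::real..} = (\<integral>\<^sup>+t. indicator {0::real..} t \<partial>lborel)"
      by (rule nn_integral_indicator[symmetric]) simp
    also have "\<dots> = (\<integral>\<^sup>+t. indicator {0..} t * indicator {x. ennreal t < u x} x \<partial>lborel)"
      using top by (intro nn_integral_cong) (auto simp: indicator_def)
    finally show ?thesis using top by simp
  qed
  have "(\<integral>\<^sup>+x. u x \<partial>lborel)
      = (\<integral>\<^sup>+x. \<integral>\<^sup>+t. indicator {0..} t * indicator {x. ennreal t < u x} x \<partial>lborel \<partial>lborel)"
    by (rule nn_integral_cong) (rule u)
  also have "\<dots> = (\<integral>\<^sup>+t. \<integral>\<^sup>+x. indicator {0..} t * indicator {x. ennreal t < u x} x \<partial>lborel \<partial>lborel)"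
    by (rule lborel_pair.Fubini') (simp add: indicator_def)
  also have "\<dots> = (\<integral>\<^sup>+t. indicator {0..} t * emeasure lborel {x. ennreal t < u x} \<partial>lborel)"
    by (intro nn_integral_cong) (simp add: nn_integral_cmult)
  finally show ?thesis .
qed

lemma ennreal_arith_geo_mean:
  fixes X Y :: ennreal
  shows "4 * (X * Y) \<le> (X + Y)\<^sup>2"
proof (cases X; cases Y)
  fix x y assume "X = ennreal x" "Y = ennreal y" "0 \<le> x" "0 \<le> y"
  moreover have "4 * (x * y) \<le> (x + y)\<^sup>2"
    using sum_squares_ge_zero[of "x - y" 0] by (simp add: power2_eq_square algebra_simps)
  ultimately show ?thesis
    by (simp add: ennreal_mult[symmetric] ennreal_plus[symmetric] ennreal_power
        flip: ennreal_numeral del: ennreal_plus)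
qed (auto simp: ennreal_top_mult ennreal_mult_top power2_eq_square)

text \<open>
  Since both suprema are \<open>1\<close>, the superlevel sets of \<open>u\<close> and \<open>v\<close> at a height \<open>t\<close> are nonempty for the
  same \<open>t\<close>, namely \<open>t < 1\<close>, and the Brunn-Minkowski inequality applies at every such height. Integrating
  over \<open>t\<close> gives the inequality with the arithmetic mean of the two integrals.
\<close>

lemma prekopa_leindler_normalised:
  fixes u v w :: "real \<Rightarrow> ennreal"
  assumes [measurable]: "u \<in> borel_measurable borel" "v \<in> borel_measurable borel"
      "w \<in> borel_measurable borel"
    and sup: "(SUP x. u x) = 1" "(SUP x. v x) = 1"
    and mid: "\<And>x y. u x * v y \<le> (w ((x + y) / 2))\<^sup>2"
  shows "(\<integral>\<^sup>+x. u x \<partial>lborel) + (\<integral>\<^sup>+x. v x \<partial>lborel) \<le> 2 * (\<integral>\<^sup>+x. w x \<partial>lborel)"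
proof -
  have le: "u x \<le> 1" "v x \<le> 1" for x using sup by (metis SUP_upper UNIV_I)+
  have "(\<integral>\<^sup>+x. u x \<partial>lborel) + (\<integral>\<^sup>+x. v x \<partial>lborel)
      = (\<integral>\<^sup>+t. indicator {0..} t * emeasure lborel {x. ennreal t < u x}
            + indicator {0..} t * emeasure lborel {x. ennreal t < v x} \<partial>lborel)"
    unfolding nn_integral_layer_cake[of u, simplified] nn_integral_layer_cake[of v, simplified]
    by (rule nn_integral_add[symmetric]) measurable
  also have "\<dots> \<le> (\<integral>\<^sup>+t. 2 * (indicator {0..} t * emeasure lborel {x. ennreal t < w x}) \<partial>lborel)"
  proof (rule nn_integral_mono)
    fix t :: real
    show "indicator {0..} t * emeasure lborel {x. ennreal t < u x}
            + indicator {0..} t * emeasure lborel {x. ennreal t < v x}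
        \<le> 2 * (indicator {0..} t * emeasure lborel {x. ennreal t < w x})"
    proof (cases "0 \<le> t \<and> t < 1")
      case True
      then have t: "ennreal t < 1" by (simp add: ennreal_less_iff flip: ennreal_1)
      have "emeasure lborel {x. ennreal t < u x} + emeasure lborel {x. ennreal t < v x}
        \<le> 2 * emeasure lborel {x. ennreal t < w x}"
      proof (rule brunn_minkowski_midpoint)
        show "{x. ennreal t < u x} \<noteq> {}" "{x. ennreal t < v x} \<noteq> {}"
          using t less_SUP_iff[of "ennreal t" u UNIV] less_SUP_iff[of "ennreal t" v UNIV] sup by auto
        fix x y assume xy: "x \<in> {x. ennreal t < u x}" "y \<in> {x. ennreal t < v x}"
        obtain a b where ab: "u x = ennreal a" "v y = ennreal b" "0 \<le> a" "0 \<le> b"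
          using le[of x] le[of y] by (cases "u x"; cases "v y") (auto simp: top_unique)
        then have "t < a" "t < b" using xy True by (auto simp: ennreal_less_iff)
        then have "t * t < a * b" using True by (intro mult_strict_mono') auto
        then have "ennreal (t * t) < u x * v y"
          using ab True by (simp add: ennreal_mult[symmetric] ennreal_less_iff)
        also have "\<dots> \<le> (w ((x + y) / 2))\<^sup>2" by (rule mid)
        finally have "(ennreal t)\<^sup>2 < (w ((x + y) / 2))\<^sup>2"
          using True by (simp add: ennreal_mult power2_eq_square)
        then have "ennreal t < w ((x + y) / 2)"
          using power_mono[of "w ((x + y) / 2)" "ennreal t" 2] by (meson not_le zero_le)
        then show "(x + y) / 2 \<in> {x. ennreal t < w x}" by simp
      qed measurable
      then show ?thesis using True by simp
    next
      case False
      then have "{x. ennreal t < u x} = {}" "{x. ennreal t < v x} = {}" if "0 \<le> t"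
        using that le by (auto simp: not_less intro!: order_trans[OF le(1)] order_trans[OF le(2)])
      then show ?thesis by (cases "0 \<le> t") auto
    qed
  qed
  also have "\<dots> = 2 * (\<integral>\<^sup>+t. indicator {0..} t * emeasure lborel {x. ennreal t < w x} \<partial>lborel)"
    by (rule nn_integral_cmult) measurable
  also have "(\<integral>\<^sup>+t. indicator {0..} t * emeasure lborel {x. ennreal t < w x} \<partial>lborel) = (\<integral>\<^sup>+x. w x \<partial>lborel)"
    by (rule nn_integral_layer_cake[symmetric]) simp
  finally show ?thesis .
qed


text \<open>
  Rescale both suprema to \<open>1\<close>. The inequality between the arithmetic and the geometric mean then yields
  a bound that is homogeneous in \<open>u\<close> and \<open>v\<close>, so that the scaling factors cancel.
\<close>

lemma prekopa_leindler_bounded: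
  fixes u v w :: "real \<Rightarrow> ennreal"
  assumes [measurable]: "u \<in> borel_measurable borel" "v \<in> borel_measurable borel"
      "w \<in> borel_measurable borel"
    and bd: "\<And>x. u x \<le> ennreal k" "\<And>x. v x \<le> ennreal k"
    and mid: "\<And>x y. u x * v y \<le> (w ((x + y) / 2))\<^sup>2"
  shows "(\<integral>\<^sup>+x. u x \<partial>lborel) * (\<integral>\<^sup>+x. v x \<partial>lborel) \<le> (\<integral>\<^sup>+x. w x \<partial>lborel)\<^sup>2"
proof (cases "(SUP x. u x) = 0 \<or> (SUP x. v x) = 0")
  case True
  then have "(\<forall>x. u x = 0) \<or> (\<forall>x. v x = 0)"
    by (metis SUP_upper UNIV_I le_zero_eq)
  then show ?thesis by auto
next
  case False
  have "(SUP x. u x) \<le> ennreal k" "(SUP x. v x) \<le> ennreal k"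
    using bd by (auto intro: SUP_least)
  then obtain a b where ab: "(SUP x. u x) = ennreal a" "(SUP x. v x) = ennreal b" "a > 0" "b > 0"
    using False
    by (cases "SUP x. u x"; cases "SUP x. v x") (auto simp: top_unique less_le)
  define W where "W = (\<integral>\<^sup>+x. w x \<partial>lborel)"
  define X where "X = (\<integral>\<^sup>+x. u x \<partial>lborel)"
  define Y where "Y = (\<integral>\<^sup>+x. v x \<partial>lborel)"
  define c where "c = ennreal (1 / (a * b))"
  have c: "c = ennreal (1/a) * ennreal (1/b)" "c = (ennreal (1 / sqrt (a * b)))\<^sup>2"
    using ab by (auto simp: c_def ennreal_mult[symmetric] ennreal_power power_divide)
  have "(\<integral>\<^sup>+x. ennreal (1/a) * u x \<partial>lborel) + (\<integral>\<^sup>+x. ennreal (1/b) * v x \<partial>lborel)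
      \<le> 2 * (\<integral>\<^sup>+x. ennreal (1 / sqrt (a * b)) * w x \<partial>lborel)"
  proof (rule prekopa_leindler_normalised)
    show "(SUP x. ennreal (1/a) * u x) = 1" "(SUP x. ennreal (1/b) * v x) = 1"
      using ab by (simp_all add: SUP_mult_left_ennreal[symmetric] ennreal_mult[symmetric])
    fix x y
    have "ennreal (1/a) * u x * (ennreal (1/b) * v y) = c * (u x * v y)"
      by (simp add: c(1) ac_simps)
    also have "\<dots> \<le> c * (w ((x + y) / 2))\<^sup>2" using mid by (rule mult_left_mono) simp
    also have "\<dots> = (ennreal (1 / sqrt (a * b)) * w ((x + y) / 2))\<^sup>2"
      by (simp add: c(2) power_mult_distrib)
    finally show "ennreal (1/a) * u x * (ennreal (1/b) * v y)
        \<le> (ennreal (1 / sqrt (a * b)) * w ((x + y) / 2))\<^sup>2" .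
  qed auto
  then have le: "ennreal (1/a) * X + ennreal (1/b) * Y \<le> 2 * (ennreal (1 / sqrt (a * b)) * W)"
    by (simp add: nn_integral_cmult X_def Y_def W_def)
  have "(4 * c) * (X * Y) = 4 * ((ennreal (1/a) * X) * (ennreal (1/b) * Y))"
    by (simp add: c(1) ac_simps)
  also have "\<dots> \<le> (ennreal (1/a) * X + ennreal (1/b) * Y)\<^sup>2"
    by (rule ennreal_arith_geo_mean)
  also have "\<dots> \<le> (2 * (ennreal (1 / sqrt (a * b)) * W))\<^sup>2"
    using le by (rule power_mono) simp
  also have "\<dots> = (4 * c) * W\<^sup>2"
    by (simp add: power_mult_distrib c(2) mult.assoc)
  finally have "(4 * c) * (X * Y) \<le> (4 * c) * W\<^sup>2" .
  then have "X * Y \<le> W\<^sup>2"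
    using ab by (subst (asm) ennreal_mult_le_mult_iff) (auto simp: c_def ennreal_mult_eq_top_iff)
  then show ?thesis by (simp add: X_def Y_def W_def)
qed

lemma prekopa_leindler_real:
  fixes u v w :: "real \<Rightarrow> ennreal"
  assumes [measurable]: "u \<in> borel_measurable borel" "v \<in> borel_measurable borel"
      "w \<in> borel_measurable borel"
    and mid: "\<And>x y. u x * v y \<le> (w ((x + y) / 2))\<^sup>2"
  shows "(\<integral>\<^sup>+x. u x \<partial>lborel) * (\<integral>\<^sup>+x. v x \<partial>lborel) \<le> (\<integral>\<^sup>+x. w x \<partial>lborel)\<^sup>2"
proof -
  have trunc: "(\<integral>\<^sup>+x. f x \<partial>lborel) = (SUP k::nat. \<integral>\<^sup>+x. min (f x) (of_nat k) \<partial>lborel)"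
    if [measurable]: "f \<in> borel_measurable borel" for f :: "real \<Rightarrow> ennreal"
  proof -
    have "f x = (SUP k::nat. min (f x) (of_nat k))" for x
      using inf_SUP[of "f x" "\<lambda>k::nat. of_nat k" UNIV]
      by (simp add: inf_min ennreal_SUP_of_nat_eq_top)
    then have "(\<integral>\<^sup>+x. f x \<partial>lborel) = (\<integral>\<^sup>+x. (SUP k::nat. min (f x) (of_nat k)) \<partial>lborel)"
      by simp
    also have "\<dots> = (SUP k::nat. \<integral>\<^sup>+x. min (f x) (of_nat k) \<partial>lborel)"
    proof (rule nn_integral_monotone_convergence_SUP)
      show "incseq (\<lambda>k::nat. \<lambda>x. min (f x) (of_nat k))"
        unfolding incseq_def le_fun_def
        by (intro allI impI min.mono order_refl of_nat_mono)
    qed measurable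
    finally show ?thesis .
  qed
  have "(\<integral>\<^sup>+x. min (u x) (of_nat j) \<partial>lborel) * (\<integral>\<^sup>+x. min (v x) (of_nat k) \<partial>lborel)
      \<le> (\<integral>\<^sup>+x. w x \<partial>lborel)\<^sup>2" for j k :: nat
  proof (rule prekopa_leindler_bounded[where k="real (max j k)"])
    show "min (u x) (of_nat j) \<le> ennreal (real (max j k))" for x
      by (rule min.coboundedI2) (simp add: ennreal_of_nat_eq_real_of_nat ennreal_leI)
    show "min (v x) (of_nat k) \<le> ennreal (real (max j k))" for x
      by (rule min.coboundedI2) (simp add: ennreal_of_nat_eq_real_of_nat ennreal_leI)
    show "min (u x) (of_nat j) * min (v y) (of_nat k) \<le> (w ((x + y) / 2))\<^sup>2" for x y
      using mid by (rule order_trans[rotated]) (intro mult_mono, auto)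
  qed auto
  then show ?thesis
    unfolding trunc[OF assms(1)] trunc[OF assms(2)]
    by (auto simp: SUP_mult_left_ennreal SUP_mult_right_ennreal intro!: SUP_least)
qed

text \<open>
  The marginals of \<open>u\<close>, \<open>v\<close> and \<open>w\<close> satisfy the hypothesis again, by the inequality in dimension one, so
  that one coordinate can be integrated out at a time. The functions take values in \<open>[0, \<infinity>]\<close> because a
  marginal may be infinite at some points.
\<close>

lemma prekopa_leindler_PiM:
  fixes u v w :: "('i \<Rightarrow> real) \<Rightarrow> ennreal"
  assumes "finite I"
    and "u \<in> borel_measurable (Pi\<^sub>M I (\<lambda>_. lborel))"
        "v \<in> borel_measurable (Pi\<^sub>M I (\<lambda>_. lborel))"
        "w \<in> borel_measurable (Pi\<^sub>M I (\<lambda>_. lborel))"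
    and "\<And>x y. x \<in> space (Pi\<^sub>M I (\<lambda>_. lborel)) \<Longrightarrow> y \<in> space (Pi\<^sub>M I (\<lambda>_. lborel)) \<Longrightarrow>
        u x * v y \<le> (w (\<lambda>i\<in>I. (x i + y i) / 2))\<^sup>2"
  shows "(\<integral>\<^sup>+x. u x \<partial>Pi\<^sub>M I (\<lambda>_. lborel)) * (\<integral>\<^sup>+x. v x \<partial>Pi\<^sub>M I (\<lambda>_. lborel))
      \<le> (\<integral>\<^sup>+x. w x \<partial>Pi\<^sub>M I (\<lambda>_. lborel))\<^sup>2"
  using assms
proof (induction I arbitrary: u v w rule: finite_induct)
  case empty
  interpret product_sigma_finite "\<lambda>_::'i. lborel :: real measure" ..
  show ?case
    using empty(4)[of "\<lambda>_. undefined" "\<lambda>_. undefined"]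
    by (simp add: nn_integral_empty restrict_def)
next
  case (insert i I)
  interpret product_sigma_finite "\<lambda>_::'i. lborel :: real measure" ..
  note [measurable] = insert.prems(1-3)
  note [simp] = insert.hyps
  have slice: "(\<lambda>t. f (x(i := t))) \<in> borel_measurable borel"
    if "x \<in> space (Pi\<^sub>M I (\<lambda>_. lborel))"
      and [measurable]: "f \<in> borel_measurable (Pi\<^sub>M (insert i I) (\<lambda>_. lborel :: real measure))"
    for f :: "('i \<Rightarrow> real) \<Rightarrow> ennreal" and x
    using measurable_comp[OF measurable_component_update[OF that(1)] that(2)]
    by (simp add: comp_def)
  have marg: "(\<lambda>x. \<integral>\<^sup>+t. f (x(i := t)) \<partial>lborel) \<in> borel_measurable (Pi\<^sub>M I (\<lambda>_. lborel :: real measure))"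
    if [measurable]: "f \<in> borel_measurable (Pi\<^sub>M (insert i I) (\<lambda>_. lborel :: real measure))"
    for f :: "('i \<Rightarrow> real) \<Rightarrow> ennreal"
    by measurable
  have "(\<integral>\<^sup>+x. (\<integral>\<^sup>+t. u (x(i := t)) \<partial>lborel) \<partial>Pi\<^sub>M I (\<lambda>_. lborel)) *
      (\<integral>\<^sup>+x. (\<integral>\<^sup>+t. v (x(i := t)) \<partial>lborel) \<partial>Pi\<^sub>M I (\<lambda>_. lborel))
      \<le> (\<integral>\<^sup>+x. (\<integral>\<^sup>+t. w (x(i := t)) \<partial>lborel) \<partial>Pi\<^sub>M I (\<lambda>_. lborel))\<^sup>2"
  proof (rule insert.IH[OF marg marg marg])
    fix x y assume xy: "x \<in> space (Pi\<^sub>M I (\<lambda>_. lborel :: real measure))"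
      "y \<in> space (Pi\<^sub>M I (\<lambda>_. lborel :: real measure))"
    let ?m = "\<lambda>j\<in>I. (x j + y j) / 2"
    have m: "?m \<in> space (Pi\<^sub>M I (\<lambda>_. lborel))" by (simp add: space_PiM)
    show "(\<integral>\<^sup>+t. u (x(i := t)) \<partial>lborel) * (\<integral>\<^sup>+t. v (y(i := t)) \<partial>lborel)
        \<le> (\<integral>\<^sup>+t. w (?m(i := t)) \<partial>lborel)\<^sup>2"
    proof (rule prekopa_leindler_real[OF slice slice slice])
      fix s t
      have "x(i := s) \<in> space (Pi\<^sub>M (insert i I) (\<lambda>_. lborel))"
           "y(i := t) \<in> space (Pi\<^sub>M (insert i I) (\<lambda>_. lborel))"
        using xy by (auto simp: space_PiM PiE_def extensional_def)
      from insert.prems(4)[OF this]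
      have "u (x(i := s)) * v (y(i := t))
          \<le> (w (\<lambda>j\<in>insert i I. ((x(i := s)) j + (y(i := t)) j) / 2))\<^sup>2" .
      also have "(\<lambda>j\<in>insert i I. ((x(i := s)) j + (y(i := t)) j) / 2) = ?m(i := (s + t) / 2)"
        by (auto simp: fun_eq_iff restrict_def)
      finally show "u (x(i := s)) * v (y(i := t)) \<le> (w (?m(i := (s + t) / 2)))\<^sup>2" .
    qed (fact xy m insert.prems)+
  qed (fact insert.prems)+
  then show ?case
    using insert.prems(1-3) by (simp add: product_nn_integral_insert)
qed

theorem prekopa_leindler:
  fixes u v w :: "'a::euclidean_space \<Rightarrow> ennreal"
  assumes [measurable]: "u \<in> borel_measurable borel" "v \<in> borel_measurable borel"
      "w \<in> borel_measurable borel"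
    and mid: "\<And>x y. u x * v y \<le> (w (midpoint x y))\<^sup>2"
  shows "(\<integral>\<^sup>+x. u x \<partial>lborel) * (\<integral>\<^sup>+x. v x \<partial>lborel) \<le> (\<integral>\<^sup>+x. w x \<partial>lborel)\<^sup>2"
proof -
  let ?T = "\<lambda>f. \<Sum>b\<in>Basis. f b *\<^sub>R b :: 'a"
  let ?P = "Pi\<^sub>M Basis (\<lambda>_::'a. lborel :: real measure)"
  have T[measurable]: "?T \<in> ?P \<rightarrow>\<^sub>M borel" by measurable
  have eq: "(\<integral>\<^sup>+x. f x \<partial>lborel) = (\<integral>\<^sup>+x. f (?T x) \<partial>?P)"
    if [measurable]: "f \<in> borel_measurable borel" for f :: "'a \<Rightarrow> ennreal"
    by (subst lborel_eq) (rule nn_integral_distr[OF T], simp add: that)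
  show ?thesis
    unfolding eq[OF assms(1)] eq[OF assms(2)] eq[OF assms(3)]
  proof (rule prekopa_leindler_PiM)
    fix x y :: "'a \<Rightarrow> real"
    have "?T (\<lambda>i\<in>Basis. (x i + y i) / 2) = midpoint (?T x) (?T y)"
      by (simp add: midpoint_def scaleR_sum_right scaleR_add_left add_divide_distrib
          sum.distrib scaleR_add_right)
    then show "u (?T x) * v (?T y) \<le> (w (?T (\<lambda>i\<in>Basis. (x i + y i) / 2)))\<^sup>2"
      using mid by simp
  qed auto
qed

section \<open>The Poincare inequality for functions with a quadratic minorant\<close>

text \<open>
  For \<open>p = exp (- U)\<close> the inequality says
  \<open>2 * U (midpoint x y) \<le> U x + U y - \<rho> / 4 * |x - y|\<^sup>2\<close>. The multiplicative form allows \<open>p\<close> to vanish,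
  so that a restriction to a convex set is covered.
\<close>

definition strongly_log_concave :: "real \<Rightarrow> ('a::real_normed_vector \<Rightarrow> real) \<Rightarrow> bool" where
  "strongly_log_concave \<rho> p \<longleftrightarrow> (\<forall>x. 0 \<le> p x) \<and>
     (\<forall>x y. p x * p y * exp (\<rho> / 4 * (norm (x - y))\<^sup>2) \<le> (p (midpoint x y))\<^sup>2)"

lemma exp_quadratic_bound:
  fixes t :: real
  assumes "\<bar>t\<bar> \<le> 1"
  shows "\<bar>exp t - 1 - t\<bar> \<le> t\<^sup>2"
proof (cases "t \<ge> 0")
  case True
  then show ?thesis
    using exp_bound[of t] exp_ge_add_one_self[of t] zero_le_power2[of t] assms
    unfolding abs_le_iff by linarith
next
  case False
  define s where "s = - t"
  have s: "s > 0" using False by (simp add: s_def)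
  have "1 \<le> (1 + s) * (1 - s + s\<^sup>2)"
    using s by (simp add: power2_eq_square algebra_simps)
  then have "1 / (1 + s) \<le> 1 - s + s\<^sup>2"
    using s by (simp add: divide_le_eq mult.commute)
  moreover have "exp t \<le> 1 / (1 + s)"
    using exp_ge_add_one_self[of s] s
    by (simp add: s_def exp_minus field_simps)
  ultimately have "exp t \<le> 1 + t + t\<^sup>2"
    by (simp add: s_def)
  then show ?thesis
    using exp_ge_add_one_self[of t] zero_le_power2[of t] unfolding abs_le_iff by linarith
qed

text \<open>
  The exponent is the lower bound for the infimum-convolution of \<open>e * F\<close> when \<open>H = |G|\<^sup>2\<close>; the limit is
  the coefficient of \<open>e\<^sup>2\<close> of its exponential. The case \<open>H = M = 0\<close> with \<open>- F\<close> for \<open>F\<close> serves for the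
  second factor.
\<close>

lemma second_order_exp_limit:
  fixes F H M \<rho> :: real
  assumes "\<rho> > 0"
  shows "((\<lambda>e. (exp (e * F - e\<^sup>2 * H / (\<rho> - 4 * e * M)) - 1 - e * F) / e\<^sup>2) \<longlongrightarrow> F\<^sup>2 / 2 - H / \<rho>)
    (at_right 0)"
proof -
  have "((\<lambda>e. (exp (e * F - e\<^sup>2 * H / (\<rho> - 4 * e * M)) - 1 - e * F) / e\<^sup>2) \<longlongrightarrow>
      F * F / 2 - H * inverse \<rho>) (at_right 0)"
    using assms by real_asymp
  moreover have "F * F / 2 - H * inverse \<rho> = F\<^sup>2 / 2 - H / \<rho>"
    by (simp only: power2_eq_square divide_inverse)
  ultimately show ?thesis by (simp only:)
qed

lemma integrable_bounded_scaleR: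
  fixes h :: "'a \<Rightarrow> 'b::{banach, second_countable_topology}" and q :: "'a \<Rightarrow> real"
  assumes "integrable M h" and [measurable]: "q \<in> borel_measurable M" and "\<And>x. \<bar>q x\<bar> \<le> c"
  shows "integrable M (\<lambda>x. q x *\<^sub>R h x)"
proof (rule Bochner_Integration.integrable_bound[where f="\<lambda>x. c *\<^sub>R h x"])
  show "AE x in M. norm (q x *\<^sub>R h x) \<le> norm (c *\<^sub>R h x)"
  proof (rule AE_I2)
    fix x
    have "\<bar>q x\<bar> \<le> \<bar>c\<bar>" using assms(3)[of x] by simp
    then show "norm (q x *\<^sub>R h x) \<le> norm (c *\<^sub>R h x)"
      by (simp add: mult_right_mono)
  qed
qed (use assms(1) in \<open>auto simp: borel_measurable_integrable\<close>)

lemma integrable_mult_bounded: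
  fixes p q :: "'a \<Rightarrow> real"
  assumes "integrable M p" and "q \<in> borel_measurable M" and "\<And>x. \<bar>q x\<bar> \<le> c"
  shows "integrable M (\<lambda>x. p x * q x)"
  using integrable_bounded_scaleR[OF assms] by (simp add: mult.commute)

lemma young_quadratic:
  fixes g h :: "'a::real_inner"
  assumes "a > 0"
  shows "- e * (g \<bullet> h) - a * (norm h)\<^sup>2 \<le> e\<^sup>2 * (norm g)\<^sup>2 / (4 * a)"
proof -
  have "0 \<le> (norm (e *\<^sub>R g + (2 * a) *\<^sub>R h))\<^sup>2" by simp
  also have "\<dots> = e\<^sup>2 * (norm g)\<^sup>2 + 4 * a * e * (g \<bullet> h) + 4 * a\<^sup>2 * (norm h)\<^sup>2"
    unfolding power2_norm_eq_inner
    by (simp add: inner_simps inner_commute power2_eq_square algebra_simps)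
  finally have "0 \<le> (e\<^sup>2 * (norm g)\<^sup>2 + 4 * a * e * (g \<bullet> h) + 4 * a\<^sup>2 * (norm h)\<^sup>2) / (4 * a)"
    using assms by simp
  also have "\<dots> = e\<^sup>2 * (norm g)\<^sup>2 / (4 * a) + e * (g \<bullet> h) + a * (norm h)\<^sup>2"
    using assms by (simp add: field_simps power2_eq_square)
  finally show ?thesis by simp
qed

text \<open>
  The Prekopa-Leindler inequality for \<open>p * exp (Q)\<close>, \<open>p * exp (- e * F)\<close> and \<open>p\<close>, where
  \<open>Q = e * F - e\<^sup>2 * |G|\<^sup>2 / (\<rho> - 4 * e * M)\<close>. The quadratic minorant shows that
  \<open>Q x - e * F y \<le> \<rho> / 4 * |x - y|\<^sup>2\<close> on \<open>K\<close>: the error \<open>e * M * |x - y|\<^sup>2\<close> is absorbed by lowering \<open>\<rho> / 4\<close>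
  to \<open>\<rho> / 4 - e * M\<close>, and Young's inequality then handles the linear term \<open>e * (G x \<bullet> (y - x))\<close>. What
  remains is exactly the gain from the strong log-concavity of \<open>p\<close>.
\<close>

proposition infimum_convolution_inequality:
  fixes p F :: "'a::euclidean_space \<Rightarrow> real" and G :: "'a \<Rightarrow> 'a"
  assumes p: "strongly_log_concave \<rho> p" and p_int: "integrable lborel p"
    and supp: "\<And>x. p x \<noteq> 0 \<Longrightarrow> x \<in> K"
    and [measurable]: "F \<in> borel_measurable borel" "G \<in> borel_measurable borel"
    and bF: "\<And>x. \<bar>F x\<bar> \<le> c"
    and min: "\<And>x y. x \<in> K \<Longrightarrow> y \<in> K \<Longrightarrow> F y \<ge> F x + G x \<bullet> (y - x) - M * (norm (y - x))\<^sup>2"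
    and e: "e > 0" "4 * e * M < \<rho>"
  shows "(\<integral>x. p x * exp (e * F x - e\<^sup>2 * (norm (G x))\<^sup>2 / (\<rho> - 4 * e * M)) \<partial>lborel)
      * (\<integral>x. p x * exp (- e * F x) \<partial>lborel) \<le> (\<integral>x. p x \<partial>lborel)\<^sup>2"
proof -
  have p0: "0 \<le> p x" for x using p by (simp add: strongly_log_concave_def)
  have [measurable]: "p \<in> borel_measurable borel"
    using borel_measurable_integrable[OF p_int] by simp
  let ?u = "\<lambda>x. p x * exp (e * F x - e\<^sup>2 * (norm (G x))\<^sup>2 / (\<rho> - 4 * e * M))"
  let ?v = "\<lambda>x. p x * exp (- e * F x)"
  have eF: "\<bar>e * F x\<bar> \<le> e * c" for x
    using bF[of x] e by (simp add: abs_mult mult_left_mono)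
  have u_int: "integrable lborel ?u"
  proof (rule integrable_mult_bounded[OF p_int])
    fix x
    have "e\<^sup>2 * (norm (G x))\<^sup>2 / (\<rho> - 4 * e * M) \<ge> 0" using e by simp
    then show "\<bar>exp (e * F x - e\<^sup>2 * (norm (G x))\<^sup>2 / (\<rho> - 4 * e * M))\<bar> \<le> exp (e * c)"
      using eF[of x] by auto
  qed measurable
  have v_int: "integrable lborel ?v"
  proof (rule integrable_mult_bounded[OF p_int])
    show "\<bar>exp (- e * F x)\<bar> \<le> exp (e * c)" for x using eF[of x] by auto
  qed measurable
  have mid: "?u x * ?v y \<le> (p (midpoint x y))\<^sup>2" for x y
  proof (cases "x \<in> K \<and> y \<in> K")
    case True
    define a where "a = (\<rho> - 4 * e * M) / 4"
    have a: "a > 0" "\<rho> - 4 * e * M = 4 * a" "\<rho> / 4 = a + e * M" using e by (auto simp: a_def field_simps)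
    have "e * (F x - F y) \<le> e * (- (G x \<bullet> (y - x)) + M * (norm (y - x))\<^sup>2)"
      using min[of x y] True e by (intro mult_left_mono) auto
    also have "\<dots> = (- e * (G x \<bullet> (y - x)) - a * (norm (y - x))\<^sup>2) + \<rho> / 4 * (norm (x - y))\<^sup>2"
      unfolding a(3) norm_minus_commute[of x y] by (simp add: algebra_simps)
    also have "- e * (G x \<bullet> (y - x)) - a * (norm (y - x))\<^sup>2 \<le> e\<^sup>2 * (norm (G x))\<^sup>2 / (4 * a)"
      using a(1) by (rule young_quadratic)
    finally have le: "(e * F x - e\<^sup>2 * (norm (G x))\<^sup>2 / (\<rho> - 4 * e * M)) + (- e * F y)
        \<le> \<rho> / 4 * (norm (x - y))\<^sup>2"
      unfolding a(2) by (simp add: algebra_simps)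
    have "?u x * ?v y = p x * p y
        * exp ((e * F x - e\<^sup>2 * (norm (G x))\<^sup>2 / (\<rho> - 4 * e * M)) + (- e * F y))"
      unfolding exp_add by simp
    also have "\<dots> \<le> p x * p y * exp (\<rho> / 4 * (norm (x - y))\<^sup>2)"
      using le p0 by (intro mult_left_mono) auto
    also have "\<dots> \<le> (p (midpoint x y))\<^sup>2" using p by (simp add: strongly_log_concave_def)
    finally show ?thesis .
  next
    case False
    then have "p x = 0 \<or> p y = 0" using supp by blast
    then show ?thesis by auto
  qed
  have "(\<integral>\<^sup>+x. ennreal (?u x) \<partial>lborel) * (\<integral>\<^sup>+x. ennreal (?v x) \<partial>lborel) \<le> (\<integral>\<^sup>+x. ennreal (p x) \<partial>lborel)\<^sup>2"
  proof (rule prekopa_leindler)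
    show "ennreal (?u x) * ennreal (?v y) \<le> (ennreal (p (midpoint x y)))\<^sup>2" for x y
      using mid[of x y] p0
      by (subst ennreal_mult[symmetric]) (auto simp: ennreal_power intro!: ennreal_leI)
  qed measurable
  then show ?thesis
    using p0 u_int v_int p_int
    by (simp add: nn_integral_eq_integral ennreal_mult[symmetric] ennreal_power integral_nonneg)
qed

text \<open>
  Both sides of the infimum-convolution inequality equal \<open>Z\<^sup>2\<close> for \<open>e = 0\<close>, and the terms of first order
  in \<open>e\<close> cancel. Dividing by \<open>e\<^sup>2\<close> and letting \<open>e \<rightarrow> 0\<close> leaves the claim. The remainders \<open>Q k\<close> and \<open>R k\<close> of the
  two exponential integrals converge by dominated convergence.
\<close>

lemma poincare_quadratic_minorant:
  fixes p F :: "'a::euclidean_space \<Rightarrow> real" and G :: "'a \<Rightarrow> 'a"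
  assumes rho: "\<rho> > 0" and p: "strongly_log_concave \<rho> p" and p_int: "integrable lborel p"
    and supp: "\<And>x. p x \<noteq> 0 \<Longrightarrow> x \<in> K"
    and F[measurable]: "F \<in> borel_measurable borel" and G[measurable]: "G \<in> borel_measurable borel"
    and bF: "\<And>x. \<bar>F x\<bar> \<le> c" and bG: "\<And>x. norm (G x) \<le> c"
    and min: "\<And>x y. x \<in> K \<Longrightarrow> y \<in> K \<Longrightarrow> F y \<ge> F x + G x \<bullet> (y - x) - M * (norm (y - x))\<^sup>2"
    and M: "M \<ge> 0"
  shows "(\<integral>x. p x \<partial>lborel) * (\<integral>x. p x * (F x)\<^sup>2 \<partial>lborel) - (\<integral>x. p x * F x \<partial>lborel)\<^sup>2
     \<le> 1 / \<rho> * ((\<integral>x. p x \<partial>lborel) * (\<integral>x. p x * (norm (G x))\<^sup>2 \<partial>lborel))"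
proof -
  have c0: "c \<ge> 0" using bF[of 0] by linarith
  define D where "D = c + 2 * c\<^sup>2 / \<rho>"
  have D0: "D \<ge> 0" using c0 rho by (simp add: D_def)
  \<comment> \<open>The three bounds keep \<open>\<rho> - 4 * e * M\<close> above \<open>\<rho> / 2\<close> and all exponents in \<open>[-1, 1]\<close>.\<close>
  define e0 where "e0 = min 1 (min (\<rho> / (8 * (M + 1))) (1 / (D + 1)))"
  define e where "e k = e0 / real (Suc k)" for k
  have e0: "e0 > 0" using rho M D0 by (simp add: e0_def)
  have e_pos: "e k > 0" for k using e0 by (simp add: e_def)
  have e_le: "e k \<le> e0" for k
    using e0 by (simp add: e_def divide_le_eq mult_le_cancel_left1)
  have e1: "e k \<le> 1" for k using e_le[of k] by (simp add: e0_def)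
  have eM: "4 * e k * M \<le> \<rho> / 2" for k
  proof -
    have "e k \<le> \<rho> / (8 * (M + 1))" using e_le[of k] by (simp add: e0_def)
    then have "e k * (8 * (M + 1)) \<le> \<rho>" using M by (simp add: le_divide_eq)
    then have "8 * (e k * M) + 8 * e k \<le> \<rho>" by (simp add: algebra_simps)
    then show ?thesis using e_pos[of k] by simp
  qed
  have eD: "e k * D \<le> 1" for k
  proof -
    have "e k \<le> 1 / (D + 1)" using e_le[of k] by (simp add: e0_def)
    then have "e k * (D + 1) \<le> 1" using D0 by (simp add: le_divide_eq)
    then show ?thesis using e_pos[of k] by (simp add: algebra_simps)
  qed
  have e_lim: "e \<longlonglongrightarrow> 0"
    unfolding e_def[abs_def] by real_asymp
  have e_right: "filterlim e (at_right 0) sequentially"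
    using e_lim e_pos by (auto simp: filterlim_at less_imp_neq[symmetric] intro!: always_eventually)
  let ?t = "\<lambda>k x. e k * F x - (e k)\<^sup>2 * (norm (G x))\<^sup>2 / (\<rho> - 4 * e k * M)"
  let ?q = "\<lambda>k x. (exp (?t k x) - 1 - e k * F x) / (e k)\<^sup>2"
  let ?r = "\<lambda>k x. (exp (- e k * F x) - 1 + e k * F x) / (e k)\<^sup>2"
  have Hb: "(norm (G x))\<^sup>2 / (\<rho> - 4 * e k * M) \<le> 2 * c\<^sup>2 / \<rho>" for k x
  proof -
    have "(norm (G x))\<^sup>2 / (\<rho> - 4 * e k * M) \<le> c\<^sup>2 / (\<rho> / 2)"
      using eM[of k] bG[of x] rho by (intro frac_le power_mono) auto
    then show ?thesis by (simp add: mult.commute)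
  qed
  have H0: "0 \<le> (norm (G x))\<^sup>2 / (\<rho> - 4 * e k * M)" for k x
    using eM[of k] rho by simp
  have tb: "\<bar>?t k x\<bar> \<le> e k * D" for k x
  proof -
    have "\<bar>?t k x\<bar> \<le> \<bar>e k * F x\<bar> + \<bar>(e k)\<^sup>2 * ((norm (G x))\<^sup>2 / (\<rho> - 4 * e k * M))\<bar>"
      using abs_triangle_ineq4[of "e k * F x" "(e k)\<^sup>2 * ((norm (G x))\<^sup>2 / (\<rho> - 4 * e k * M))"]
      by simp
    also have "\<bar>e k * F x\<bar> \<le> e k * c" using bF[of x] e_pos[of k] by (simp add: abs_mult)
    also have "\<bar>(e k)\<^sup>2 * ((norm (G x))\<^sup>2 / (\<rho> - 4 * e k * M))\<bar>
        = (e k)\<^sup>2 * ((norm (G x))\<^sup>2 / (\<rho> - 4 * e k * M))"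
      by (intro abs_of_nonneg mult_nonneg_nonneg zero_le_power2 H0)
    also have "\<dots> \<le> e k * (2 * c\<^sup>2 / \<rho>)"
      using Hb[of x k] H0[of x k] e1[of k] e_pos[of k]
      by (intro mult_mono) (auto simp: power2_eq_square mult_le_cancel_left1)
    finally show ?thesis by (simp add: D_def algebra_simps)
  qed
  have qb: "\<bar>?q k x\<bar> \<le> D\<^sup>2 + 2 * c\<^sup>2 / \<rho>" for k x
  proof -
    have "?q k x = (exp (?t k x) - 1 - ?t k x) / (e k)\<^sup>2 - (norm (G x))\<^sup>2 / (\<rho> - 4 * e k * M)"
      using e_pos[of k] by (simp add: diff_divide_distrib)
    moreover have "\<bar>(exp (?t k x) - 1 - ?t k x) / (e k)\<^sup>2\<bar> \<le> D\<^sup>2"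
    proof -
      have "\<bar>exp (?t k x) - 1 - ?t k x\<bar> \<le> (?t k x)\<^sup>2"
        using tb[of k x] eD[of k] by (intro exp_quadratic_bound) linarith
      also have "\<dots> \<le> (e k * D)\<^sup>2" using power_mono[OF tb[of k x], of 2] by simp
      finally show ?thesis using e_pos[of k] by (simp add: divide_le_eq power_mult_distrib mult.commute)
    qed
    ultimately show ?thesis using Hb[of x k] H0[of x k] by linarith
  qed
  have rb: "\<bar>?r k x\<bar> \<le> D\<^sup>2" for k x
  proof -
    have "0 \<le> 2 * c\<^sup>2 / \<rho>" using rho by simp
    then have "c \<le> D" by (simp add: D_def)
    then have s: "\<bar>- e k * F x\<bar> \<le> e k * D"
      using bF[of x] e_pos[of k] by (simp add: abs_mult)
    then have "\<bar>exp (- e k * F x) - 1 - (- e k * F x)\<bar> \<le> (- e k * F x)\<^sup>2"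
      using eD[of k] by (intro exp_quadratic_bound) linarith
    also have "\<dots> \<le> (e k * D)\<^sup>2" using power_mono[OF s, of 2] by simp
    finally show ?thesis using e_pos[of k] by (simp add: divide_le_eq power_mult_distrib mult.commute)
  qed
  have [measurable]: "p \<in> borel_measurable borel"
    using borel_measurable_integrable[OF p_int] by simp
  let ?H = "\<lambda>x. (norm (G x))\<^sup>2"
  define Z where "Z = (\<integral>x. p x \<partial>lborel)"
  define A where "A = (\<integral>x. p x * F x \<partial>lborel)"
  define B where "B = (\<integral>x. p x * (F x)\<^sup>2 \<partial>lborel)"
  define \<Gamma> where "\<Gamma> = (\<integral>x. p x * ?H x \<partial>lborel)"
  define Q where "Q k = (\<integral>x. p x * ?q k x \<partial>lborel)" for k
  define R where "R k = (\<integral>x. p x * ?r k x \<partial>lborel)" for k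
  note p_int[simp]
  have F_int[simp]: "integrable lborel (\<lambda>x. p x * F x)"
    by (rule integrable_mult_bounded[OF p_int _ bF]) simp
  have F2_int[simp]: "integrable lborel (\<lambda>x. p x * (F x)\<^sup>2)"
    using power_mono[OF bF, where n=2] by (intro integrable_mult_bounded[OF p_int, where c="c\<^sup>2"]) auto
  have H_int[simp]: "integrable lborel (\<lambda>x. p x * ?H x)"
    using power_mono[OF bG, where n=2] by (intro integrable_mult_bounded[OF p_int, where c="c\<^sup>2"]) auto
  have q_int[simp]: "integrable lborel (\<lambda>x. p x * ?q k x)" for k
    by (rule integrable_mult_bounded[OF p_int _ qb]) measurable
  have r_int[simp]: "integrable lborel (\<lambda>x. p x * ?r k x)" for k
    by (rule integrable_mult_bounded[OF p_int _ rb]) measurable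
  have dom: "(\<lambda>k. \<integral>x. p x * s k x \<partial>lborel) \<longlonglongrightarrow> (\<integral>x. p x * l x \<partial>lborel)"
    if [measurable]: "\<And>k. s k \<in> borel_measurable borel" "l \<in> borel_measurable borel"
      and "\<And>x. (\<lambda>k. s k x) \<longlonglongrightarrow> l x" and b: "\<And>k x. \<bar>s k x\<bar> \<le> C"
    for s :: "nat \<Rightarrow> 'a \<Rightarrow> real" and l C
  proof (rule integral_dominated_convergence[where w="\<lambda>x. C * \<bar>p x\<bar>"])
    show "AE x in lborel. (\<lambda>k. p x * s k x) \<longlonglongrightarrow> p x * l x"
      using that(3) by (auto intro!: tendsto_intros)
    show "AE x in lborel. norm (p x * s k x) \<le> C * \<bar>p x\<bar>" for k
      using b by (auto simp: abs_mult mult.commute[of C] mult_left_mono)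
  qed auto
  have "Q \<longlonglongrightarrow> (\<integral>x. p x * ((F x)\<^sup>2 / 2 - ?H x / \<rho>) \<partial>lborel)"
    unfolding Q_def
    by (rule dom[OF _ _ filterlim_compose[OF second_order_exp_limit[OF rho] e_right] qb]) measurable
  also have "(\<integral>x. p x * ((F x)\<^sup>2 / 2 - ?H x / \<rho>) \<partial>lborel)
      = (\<integral>x. (p x * (F x)\<^sup>2) / 2 - (p x * ?H x) / \<rho> \<partial>lborel)"
    by (simp add: algebra_simps)
  also have "\<dots> = B / 2 - \<Gamma> / \<rho>"
    by (subst Bochner_Integration.integral_diff) (simp_all add: B_def \<Gamma>_def)
  finally have Q: "Q \<longlonglongrightarrow> B / 2 - \<Gamma> / \<rho>" .
  have "(\<lambda>k. ?r k x) \<longlonglongrightarrow> (F x)\<^sup>2 / 2" for x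
    using filterlim_compose[OF second_order_exp_limit[OF rho, of "- F x" 0 0] e_right] by simp
  from dom[OF _ _ this rb] have R: "R \<longlonglongrightarrow> B / 2"
    by (simp add: R_def[abs_def] B_def)
  have lin: "(\<integral>x. (f x + a * g x) + b * h x \<partial>lborel)
      = (\<integral>x. f x \<partial>lborel) + a * (\<integral>x. g x \<partial>lborel) + b * (\<integral>x. h x \<partial>lborel)"
    if "integrable lborel f" "integrable lborel g" "integrable lborel h"
    for f g h :: "'a \<Rightarrow> real" and a b
    using that by simp
  have ineq: "Z * (Q k + R k) - A\<^sup>2 + e k * (A * (R k - Q k)) + (e k)\<^sup>2 * (Q k * R k) \<le> 0" for k
  proof -
    have lt: "4 * e k * M < \<rho>" using eM[of k] rho by linarith
    have "(\<integral>x. p x * exp (?t k x) \<partial>lborel)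
        = (\<integral>x. (p x + e k * (p x * F x)) + (e k)\<^sup>2 * (p x * ?q k x) \<partial>lborel)"
      using e_pos[of k] by (intro Bochner_Integration.integral_cong) (auto simp: field_simps)
    also have "\<dots> = Z + e k * A + (e k)\<^sup>2 * Q k"
      unfolding Z_def A_def Q_def by (rule lin[OF p_int F_int q_int])
    finally have u: "(\<integral>x. p x * exp (?t k x) \<partial>lborel) = Z + e k * A + (e k)\<^sup>2 * Q k" .
    have "(\<integral>x. p x * exp (- e k * F x) \<partial>lborel)
        = (\<integral>x. (p x + (- e k) * (p x * F x)) + (e k)\<^sup>2 * (p x * ?r k x) \<partial>lborel)"
      using e_pos[of k] by (intro Bochner_Integration.integral_cong) (auto simp: field_simps)
    also have "\<dots> = Z + (- e k) * A + (e k)\<^sup>2 * R k"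
      unfolding Z_def A_def R_def by (rule lin[OF p_int F_int r_int])
    finally have v: "(\<integral>x. p x * exp (- e k * F x) \<partial>lborel) = Z - e k * A + (e k)\<^sup>2 * R k"
      by simp
    have "(Z + e k * A + (e k)\<^sup>2 * Q k) * (Z - e k * A + (e k)\<^sup>2 * R k) \<le> Z\<^sup>2"
      using infimum_convolution_inequality[OF p p_int supp F G bF min e_pos[of k] lt]
      unfolding u v Z_def .
    moreover have "(Z + e k * A + (e k)\<^sup>2 * Q k) * (Z - e k * A + (e k)\<^sup>2 * R k)
       = Z\<^sup>2 + (e k)\<^sup>2 * (Z * (Q k + R k) - A\<^sup>2 + e k * (A * (R k - Q k)) + (e k)\<^sup>2 * (Q k * R k))"
      by (simp add: power2_eq_square algebra_simps)
    ultimately have "(e k)\<^sup>2 * (Z * (Q k + R k) - A\<^sup>2 + e k * (A * (R k - Q k)) + (e k)\<^sup>2 * (Q k * R k)) \<le> 0"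
      by linarith
    then show ?thesis using e_pos[of k] by (simp add: mult_le_0_iff)
  qed
  have "(\<lambda>k. Z * (Q k + R k) - A\<^sup>2 + e k * (A * (R k - Q k)) + (e k)\<^sup>2 * (Q k * R k))
     \<longlonglongrightarrow> Z * ((B / 2 - \<Gamma> / \<rho>) + B / 2) - A\<^sup>2 + 0 * (A * (B / 2 - (B / 2 - \<Gamma> / \<rho>)))
        + 0\<^sup>2 * ((B / 2 - \<Gamma> / \<rho>) * (B / 2))"
    by (intro tendsto_intros Q R e_lim)
  then have "Z * ((B / 2 - \<Gamma> / \<rho>) + B / 2) - A\<^sup>2 + 0 * (A * (B / 2 - (B / 2 - \<Gamma> / \<rho>)))
        + 0\<^sup>2 * ((B / 2 - \<Gamma> / \<rho>) * (B / 2)) \<le> 0"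
    by (rule LIMSEQ_le_const2) (use ineq in blast)
  then have "Z * B - A\<^sup>2 \<le> 1 / \<rho> * (Z * \<Gamma>)"
    by (simp add: algebra_simps)
  then show ?thesis by (simp add: Z_def A_def B_def \<Gamma>_def)
qed

section \<open>Smooth functions of compact support\<close>

text \<open>
  The classical smooth function that is flat at the origin, \<open>exp (- 1 / t)\<close>. Including the powers
  \<open>1 / t ^ m\<close> makes the span of the family closed under differentiation.
\<close>

definition flat_exp :: "nat \<Rightarrow> real \<Rightarrow> real" where
  "flat_exp m t = (if t > 0 then exp (- 1 / t) / t ^ m else 0)"

lemma flat_exp_nonneg: "flat_exp m t \<ge> 0"
  by (simp add: flat_exp_def)

lemma flat_exp_tendsto_0: "(flat_exp m \<longlongrightarrow> 0) (at 0)"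
proof -
  have "((\<lambda>s::real. s ^ m / exp s) \<longlongrightarrow> 0) at_top"
    by (rule tendsto_power_div_exp_0)
  then have "((\<lambda>t::real. (inverse t) ^ m / exp (inverse t)) \<longlongrightarrow> 0) (at_right 0)"
    by (rule filterlim_compose[OF _ filterlim_inverse_at_top_right])
  then have "(flat_exp m \<longlongrightarrow> 0) (at_right 0)"
    by (rule Lim_transform_eventually)
       (auto simp: eventually_at_filter flat_exp_def exp_minus field_simps intro!: always_eventually)
  moreover have "(flat_exp m \<longlongrightarrow> 0) (at_left 0)"
    by (rule Lim_transform_eventually[OF tendsto_const])
       (auto simp: eventually_at_filter flat_exp_def)
  ultimately show ?thesis by (simp add: filterlim_split_at)
qed

lemma flat_exp_has_derivative:
  "(flat_exp m has_real_derivative flat_exp (m + 2) t - real m * flat_exp (m + 1) t) (at t)"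
proof -
  consider "t > 0" | "t < 0" | "t = 0" by linarith
  then show ?thesis
  proof cases
    case 1
    have "((\<lambda>t. exp (- 1 / t) / t ^ m) has_real_derivative
        flat_exp (m + 2) t - real m * flat_exp (m + 1) t) (at t)"
    proof -
      have "((\<lambda>t. t ^ m) has_real_derivative real m * t ^ m / t) (at t)"
        using DERIV_pow[of m t] 1 by (cases m) auto
      moreover have "((\<lambda>t. exp (- 1 / t)) has_real_derivative exp (- 1 / t) / t\<^sup>2) (at t)"
        using 1 by (auto intro!: derivative_eq_intros simp: power2_eq_square)
      ultimately have "((\<lambda>t. exp (- 1 / t) / t ^ m) has_real_derivative
          (exp (- 1 / t) / t\<^sup>2 * t ^ m - exp (- 1 / t) * (real m * t ^ m / t)) / (t ^ m * t ^ m)) (at t)"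
        using 1 by (intro DERIV_divide) auto
      also have "(exp (- 1 / t) / t\<^sup>2 * t ^ m - exp (- 1 / t) * (real m * t ^ m / t)) / (t ^ m * t ^ m)
          = flat_exp (m + 2) t - real m * flat_exp (m + 1) t"
        using 1 by (simp add: flat_exp_def field_simps power2_eq_square)
      finally show ?thesis .
    qed
    then show ?thesis
      by (rule has_field_derivative_transform_within_open[where S="{0<..}"])
         (use 1 in \<open>auto simp: flat_exp_def\<close>)
  next
    case 2
    have "((\<lambda>t. 0) has_real_derivative flat_exp (m + 2) t - real m * flat_exp (m + 1) t) (at t)"
      using 2 by (simp add: flat_exp_def)
    then show ?thesis
      by (rule has_field_derivative_transform_within_open[where S="{..<0}"])
         (use 2 in \<open>auto simp: flat_exp_def\<close>)
  next
    case 3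
    \<comment> \<open>The difference quotient at \<open>0\<close> is itself \<open>flat_exp (Suc m)\<close>.\<close>
    have "((\<lambda>h. (flat_exp m (0 + h) - flat_exp m 0) / h) \<longlongrightarrow> 0) (at 0)"
      by (rule Lim_transform_eventually[OF flat_exp_tendsto_0[of "Suc m"]])
         (auto simp: eventually_at_filter flat_exp_def)
    then show ?thesis using 3 by (simp add: DERIV_def flat_exp_def)
  qed
qed

text \<open>
  A class of functions that contains the bumps used below and is closed under partial derivatives.
  Membership therefore gives \<open>C_k\<close> for every \<open>k\<close> by induction.
\<close>

inductive smooth_expr :: "('a::euclidean_space \<Rightarrow> real) \<Rightarrow> bool" where
  const: "smooth_expr (\<lambda>x. c)"
| coord: "smooth_expr (\<lambda>x. x \<bullet> b)"
| add: "smooth_expr f \<Longrightarrow> smooth_expr g \<Longrightarrow> smooth_expr (\<lambda>x. f x + g x)"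
| mult: "smooth_expr f \<Longrightarrow> smooth_expr g \<Longrightarrow> smooth_expr (\<lambda>x. f x * g x)"
| bump: "smooth_expr (\<lambda>x. flat_exp m (s - (norm (x - z))\<^sup>2))"

lemma smooth_expr_derivative:
  "smooth_expr f \<Longrightarrow> \<exists>f'. (\<forall>x. (f has_derivative f' x) (at x)) \<and> (\<forall>b. smooth_expr (\<lambda>x. f' x b))"
proof (induction rule: smooth_expr.induct)
  case (const c)
  show ?case by (rule exI[of _ "\<lambda>_ _. 0"]) (auto intro: smooth_expr.const)
next
  case (coord b)
  show ?case
    by (rule exI[of _ "\<lambda>_ h. h \<bullet> b"]) (auto intro!: derivative_eq_intros smooth_expr.const)
next
  case (add f g)
  then obtain f' g' where f': "\<And>x. (f has_derivative f' x) (at x)" "\<And>b. smooth_expr (\<lambda>x. f' x b)"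
    and g': "\<And>x. (g has_derivative g' x) (at x)" "\<And>b. smooth_expr (\<lambda>x. g' x b)" by blast
  show ?case
    by (rule exI[of _ "\<lambda>x h. f' x h + g' x h"])
       (auto intro!: derivative_intros smooth_expr.add f' g')
next
  case (mult f g)
  then obtain f' g' where f': "\<And>x. (f has_derivative f' x) (at x)" "\<And>b. smooth_expr (\<lambda>x. f' x b)"
    and g': "\<And>x. (g has_derivative g' x) (at x)" "\<And>b. smooth_expr (\<lambda>x. g' x b)" by blast
  show ?case
    by (rule exI[of _ "\<lambda>x h. f x * g' x h + f' x h * g x"])
       (auto intro!: derivative_intros smooth_expr.add smooth_expr.mult mult.hyps f' g')
next
  case (bump m s z)
  let ?q = "\<lambda>x. s - (norm (x - z))\<^sup>2"
  let ?d = "\<lambda>x. flat_exp (m + 2) (?q x) + (- real m) * flat_exp (m + 1) (?q x)"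
  let ?f' = "\<lambda>x h. ?d x * (-2 * (x \<bullet> h + - (z \<bullet> h)))"
  have "((\<lambda>x. flat_exp m (?q x)) has_derivative ?f' x) (at x)" for x
  proof -
    have "(?q has_derivative (\<lambda>h. -2 * ((x - z) \<bullet> h))) (at x)"
      unfolding power2_norm_eq_inner
      by (auto intro!: derivative_eq_intros simp: inner_commute)
    from has_derivative_compose[OF this flat_exp_has_derivative[THEN has_field_derivative_imp_has_derivative]]
    show ?thesis by (simp add: inner_diff_left mult.commute)
  qed
  moreover have "smooth_expr (\<lambda>x. ?f' x b)" for b
    by (intro smooth_expr.mult smooth_expr.add smooth_expr.const smooth_expr.coord smooth_expr.bump)
  ultimately show ?case by (intro exI[of _ ?f']) blast
qed

lemma smooth_expr_C_k: "smooth_expr f \<Longrightarrow> C_k k f"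
proof (induction k arbitrary: f)
  case 0
  then obtain f' where "\<And>x. (f has_derivative f' x) (at x)" using smooth_expr_derivative by blast
  then show ?case by (auto intro!: continuous_at_imp_continuous_on has_derivative_continuous)
next
  case (Suc k)
  then obtain f' where f': "\<And>x. (f has_derivative f' x) (at x)" "\<And>b. smooth_expr (\<lambda>x. f' x b)"
    using smooth_expr_derivative by blast
  then have "frechet_derivative f (at x) = f' x" for x by (metis frechet_derivative_at)
  then show ?case using f' Suc.IH by (auto simp: differentiable_def)
qed

lemma frechet_derivative_eq_0_off_support:
  fixes f :: "'a::euclidean_space \<Rightarrow> real"
  assumes "closed S" and f0: "\<And>x. x \<notin> S \<Longrightarrow> f x = 0" and "x \<notin> S"
  shows "frechet_derivative f (at x) = (\<lambda>_. 0)"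
proof -
  have "((\<lambda>_. 0) has_derivative (\<lambda>_. 0)) (at x)" by simp
  then have "(f has_derivative (\<lambda>_. 0)) (at x)"
    by (rule has_derivative_transform_within_open[where s="- S"]) (use assms in auto)
  then show ?thesis by (metis frechet_derivative_at)
qed

lemma bounded_of_compact_support:
  fixes f :: "'a::euclidean_space \<Rightarrow> real"
  assumes "compact S" "\<And>x. x \<notin> S \<Longrightarrow> f x = 0" "continuous_on UNIV f"
  obtains C where "C \<ge> 0" "\<And>x. \<bar>f x\<bar> \<le> C"
proof -
  have "bounded (f ` S)"
    using assms by (intro compact_imp_bounded compact_continuous_image) (auto intro: continuous_on_subset)
  then obtain C where C: "\<And>x. x \<in> S \<Longrightarrow> \<bar>f x\<bar> \<le> C" by (auto simp: bounded_iff)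
  show thesis
    by (rule that[of "max C 0"]) (use C assms(2) in \<open>force simp: max_def\<close>)+
qed

lemma linear_bound_Basis:
  fixes D :: "'a::euclidean_space \<Rightarrow> real"
  assumes "linear D" "\<And>b. b \<in> Basis \<Longrightarrow> \<bar>D b\<bar> \<le> L"
  shows "\<bar>D h\<bar> \<le> real DIM('a) * L * norm h"
proof -
  have "D h = D (\<Sum>b\<in>Basis. (h \<bullet> b) *\<^sub>R b)" by (simp add: euclidean_representation)
  also have "\<dots> = (\<Sum>b\<in>Basis. (h \<bullet> b) * D b)"
    using assms(1) by (simp add: linear_sum linear_cmul)
  finally have "\<bar>D h\<bar> \<le> (\<Sum>b\<in>Basis. \<bar>h \<bullet> b\<bar> * \<bar>D b\<bar>)"
    by (simp add: abs_mult[symmetric])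
  also have "\<dots> \<le> (\<Sum>b\<in>(Basis::'a set). norm h * L)"
    using assms(2) by (intro sum_mono mult_mono) (auto simp: Basis_le_norm)
  finally show ?thesis by (simp add: mult_ac)
qed

text \<open>
  The second derivatives are continuous with compact support, hence bounded. The mean value theorem
  makes the gradient Lipschitz, and a second application bounds the first-order Taylor remainder.
\<close>

lemma quadratic_remainder_of_compact_support:
  fixes f :: "'a::euclidean_space \<Rightarrow> real"
  assumes f: "C_k 2 f" and S: "compact S" "\<And>x. x \<notin> S \<Longrightarrow> f x = 0"
  obtains M where "M \<ge> 0"
    "\<And>x y. \<bar>f y - f x - frechet_derivative f (at x) (y - x)\<bar> \<le> M * (norm (y - x))\<^sup>2"
proof -
  define D where "D b x = frechet_derivative f (at x) b" for b x
  define DD where "DD b c x = frechet_derivative (D b) (at x) c" for b c x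
  have f_deriv: "(f has_derivative (\<lambda>h. D h x)) (at x)" for x
    using f frechet_derivative_works by (auto simp: D_def numeral_2_eq_2 frechet_derivative_works[symmetric])
  have D_deriv: "(D b has_derivative (\<lambda>h. DD b h x)) (at x)" if "b \<in> Basis" for b x
    using f that by (auto simp: DD_def D_def[abs_def] numeral_2_eq_2 frechet_derivative_works[symmetric])
  have DD_cont: "continuous_on UNIV (DD b c)" if "b \<in> Basis" "c \<in> Basis" for b c
    using f that by (auto simp: DD_def[abs_def] D_def[abs_def] numeral_2_eq_2)
  have D0: "D b x = 0" if "x \<notin> S" for b x
    using frechet_derivative_eq_0_off_support[of S f x] S that by (auto simp: D_def compact_imp_closed)
  have DD0: "DD b c x = 0" if "x \<notin> S" for b c x
    using frechet_derivative_eq_0_off_support[of S "D b" x] D0 S that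
    by (auto simp: DD_def compact_imp_closed)
  have "\<forall>b\<in>Basis. \<forall>c\<in>Basis. \<exists>C. C \<ge> 0 \<and> (\<forall>x. \<bar>DD b c x\<bar> \<le> C)"
    using bounded_of_compact_support[OF S(1) DD0 DD_cont] by metis
  then obtain C where C: "\<And>b c. b \<in> Basis \<Longrightarrow> c \<in> Basis \<Longrightarrow> C b c \<ge> 0 \<and> (\<forall>x. \<bar>DD b c x\<bar> \<le> C b c)"
    by metis
  define L where "L = (\<Sum>b\<in>Basis. \<Sum>c\<in>Basis. C b c)"
  have L0: "L \<ge> 0" unfolding L_def using C by (intro sum_nonneg) auto
  have L: "\<bar>DD b c x\<bar> \<le> L" if bc: "b \<in> Basis" "c \<in> Basis" for b c x
  proof -
    have "\<bar>DD b c x\<bar> \<le> C b c" using C bc by auto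
    also have "\<dots> \<le> (\<Sum>c\<in>Basis. C b c)" using C bc by (intro member_le_sum) auto
    also have "\<dots> \<le> L" unfolding L_def using C bc by (intro member_le_sum) (auto intro!: sum_nonneg)
    finally show ?thesis .
  qed
  let ?n = "real DIM('a)"
  have D_lip: "\<bar>D b z - D b x\<bar> \<le> ?n * L * norm (z - x)" if b: "b \<in> Basis" for b x z
  proof -
    have "norm (D b z - D b x) \<le> (?n * L) * norm (z - x)"
    proof (rule differentiable_bound[where S=UNIV and f'="\<lambda>x h. DD b h x"])
      show "onorm (\<lambda>h. DD b h x) \<le> ?n * L" for x
        using linear_bound_Basis[OF has_derivative_linear[OF D_deriv[OF b, of x]], of L] L[OF b]
        by (intro onorm_le) auto
    qed (auto intro: D_deriv b)
    then show ?thesis by simp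
  qed
  show thesis
  proof (rule that[of "?n * (?n * L)"])
    show "?n * (?n * L) \<ge> 0" using L0 by simp
    fix x y
    let ?g = "\<lambda>z. f z - D z x"
    have lin: "linear (\<lambda>h. D h x)" using has_derivative_linear[OF f_deriv[of x]] .
    have "norm (?g y - ?g x) \<le> (?n * (?n * L * norm (y - x))) * norm (y - x)"
    proof (rule differentiable_bound[where S="closed_segment x y" and f'="\<lambda>z h. D h z - D h x"])
      show "(?g has_derivative (\<lambda>h. D h z - D h x)) (at z within closed_segment x y)" for z
        by (intro derivative_intros has_derivative_at_withinI[OF f_deriv]
            bounded_linear.has_derivative[OF has_derivative_bounded_linear[OF f_deriv]] has_derivative_ident)
      fix z assume z: "z \<in> closed_segment x y"
      have "\<bar>D b z - D b x\<bar> \<le> ?n * L * norm (y - x)" if "b \<in> Basis" for b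
      proof -
        have "\<bar>D b z - D b x\<bar> \<le> ?n * L * norm (z - x)" by (rule D_lip[OF that])
        also have "\<dots> \<le> ?n * L * norm (y - x)"
          using segment_bound1[OF z] L0 by (intro mult_left_mono) auto
        finally show ?thesis .
      qed
      moreover have "linear (\<lambda>h. D h z - D h x)"
        by (intro linear_compose_sub has_derivative_linear[OF f_deriv])
      ultimately show "onorm (\<lambda>h. D h z - D h x) \<le> ?n * (?n * L * norm (y - x))"
        using linear_bound_Basis[of "\<lambda>h. D h z - D h x"] by (intro onorm_le) auto
    qed auto
    moreover have "?g y - ?g x = f y - f x - frechet_derivative f (at x) (y - x)"
      using linear_diff[OF lin, of y x] by (simp add: D_def)
    ultimately show "\<bar>f y - f x - frechet_derivative f (at x) (y - x)\<bar> \<le> ?n * (?n * L) * (norm (y - x))\<^sup>2"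
      by (simp add: power2_eq_square mult_ac)
  qed
qed

section \<open>Mollification in \<open>L\<^sup>1\<close>\<close>

lemma lborel_distr_reflect: "distr lborel borel (\<lambda>x. a - x) = (lborel :: 'a::euclidean_space measure)"
  using lborel_affine[of "-1" a] by (simp add: density_1)

lemma lborel_distr_translate: "distr lborel borel (\<lambda>x. x - s) = (lborel :: 'a::euclidean_space measure)"
proof -
  have "(\<lambda>x. x - s) = (+) (- s)" by auto
  then show ?thesis by (simp only: lborel_distr_plus)
qed

lemma integrable_reflect:
  fixes f :: "'a::euclidean_space \<Rightarrow> 'b::{banach, second_countable_topology}"
  assumes "integrable lborel f"
  shows "integrable lborel (\<lambda>z. f (a - z))"
  using integrable_distr[of "\<lambda>z. a - z" lborel borel f] assms by (simp add: lborel_distr_reflect)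

lemma integral_reflect:
  fixes f :: "'a::euclidean_space \<Rightarrow> real"
  assumes "f \<in> borel_measurable borel"
  shows "(\<integral>z. f (a - z) \<partial>lborel) = (\<integral>z. f z \<partial>lborel)"
  using integral_distr[of "\<lambda>z. a - z" lborel borel f] assms by (simp add: lborel_distr_reflect)

lemma integrable_translate:
  fixes f :: "'a::euclidean_space \<Rightarrow> real"
  assumes "integrable lborel f"
  shows "integrable lborel (\<lambda>z. f (z - s))"
  using integrable_distr[of "\<lambda>z. z - s" lborel borel f] assms by (simp add: lborel_distr_translate)

lemma integral_translate:
  fixes f :: "'a::euclidean_space \<Rightarrow> real"
  assumes "f \<in> borel_measurable borel"
  shows "(\<integral>z. f (z - s) \<partial>lborel) = (\<integral>z. f z \<partial>lborel)"
  using integral_distr[of "\<lambda>z. z - s" lborel borel f] assms by (simp add: lborel_distr_translate)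

definition L1_modulus :: "('a::euclidean_space \<Rightarrow> real) \<Rightarrow> 'a \<Rightarrow> real" where
  "L1_modulus h s = (\<integral>x. \<bar>h (x - s) - h x\<bar> \<partial>lborel)"

lemma L1_modulus_triangle:
  assumes h: "integrable lborel h" and g: "integrable lborel g"
  shows "L1_modulus h s \<le> L1_modulus g s + 2 * (\<integral>x. \<bar>h x - g x\<bar> \<partial>lborel)"
proof -
  note [simp] = h g integrable_translate[OF h] integrable_translate[OF g]
  have d: "integrable lborel (\<lambda>x. \<bar>h x - g x\<bar>)" by simp
  note [simp] = integrable_translate[OF d]
  have [measurable]: "h \<in> borel_measurable borel" "g \<in> borel_measurable borel"
    using borel_measurable_integrable[OF h] borel_measurable_integrable[OF g] by simp_all
  have "L1_modulus h s \<le> (\<integral>x. (\<bar>g (x - s) - g x\<bar> + \<bar>h (x - s) - g (x - s)\<bar>) + \<bar>h x - g x\<bar> \<partial>lborel)"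
    unfolding L1_modulus_def by (rule integral_mono) (auto)
  also have "\<dots> = L1_modulus g s + (\<integral>x. \<bar>h (x - s) - g (x - s)\<bar> \<partial>lborel) + (\<integral>x. \<bar>h x - g x\<bar> \<partial>lborel)"
    by (simp add: L1_modulus_def)
  also have "(\<integral>x. \<bar>h (x - s) - g (x - s)\<bar> \<partial>lborel) = (\<integral>x. \<bar>h x - g x\<bar> \<partial>lborel)"
    by (rule integral_translate[of "\<lambda>x. \<bar>h x - g x\<bar>"]) measurable
  finally show ?thesis by simp
qed

lemma L1_modulus_nonneg: "0 \<le> L1_modulus h s"
  by (simp add: L1_modulus_def)

lemma L1_modulus_tendsto_0_approx:
  assumes h: "integrable lborel h"
    and ap: "\<And>e. e > 0 \<Longrightarrow> \<exists>g. integrable lborel g \<and> (L1_modulus g \<longlongrightarrow> 0) (at 0)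
        \<and> (\<integral>x. \<bar>h x - g x\<bar> \<partial>lborel) < e"
  shows "(L1_modulus h \<longlongrightarrow> 0) (at 0)"
proof (rule tendstoI)
  fix e :: real assume "e > 0"
  then obtain g where g: "integrable lborel g" "(L1_modulus g \<longlongrightarrow> 0) (at 0)"
      "(\<integral>x. \<bar>h x - g x\<bar> \<partial>lborel) < e / 4"
    using ap[of "e / 4"] by auto
  have "eventually (\<lambda>s. L1_modulus g s < e / 2) (at 0)"
    using order_tendstoD(2)[OF g(2), of "e/2"] \<open>e > 0\<close> by simp
  then show "eventually (\<lambda>s. dist (L1_modulus h s) 0 < e) (at 0)"
  proof eventually_elim
    case (elim s)
    then show ?case
      using L1_modulus_triangle[OF h g(1), of s] g(3) L1_modulus_nonneg[of h s] by simp
  qed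
qed

text \<open>
  At a point of the open set \<open>U\<close> the indicator of \<open>U\<close> takes the value \<open>1\<close> also after a small translation.
  So the measure of \<open>U \<inter> (U + s)\<close> tends to that of \<open>U\<close> by dominated convergence, and the measure of the
  symmetric difference is twice the defect.
\<close>

lemma L1_modulus_open_set:
  fixes U :: "'a::euclidean_space set"
  assumes U: "open U" and fin: "emeasure lborel U < \<infinity>"
  shows "(L1_modulus (indicator U) \<longlongrightarrow> 0) (at 0)"
  unfolding tendsto_at_iff_sequentially comp_def
proof safe
  fix s :: "nat \<Rightarrow> 'a" assume s: "s \<longlonglongrightarrow> 0"
  have [measurable]: "U \<in> sets borel" using U by auto
  let ?i = "indicator U :: 'a \<Rightarrow> real"
  have i_int: "integrable lborel ?i" using fin by simp
  have p_int: "integrable lborel (\<lambda>x. ?i (x - t) * ?i x)" for t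
    by (rule Bochner_Integration.integrable_bound[OF i_int]) (auto simp: indicator_def)
  have eq: "L1_modulus ?i t = 2 * (\<integral>x. ?i x \<partial>lborel) - 2 * (\<integral>x. ?i (x - t) * ?i x \<partial>lborel)" for t
  proof -
    have "L1_modulus ?i t = (\<integral>x. (?i (x - t) + ?i x) - 2 * (?i (x - t) * ?i x) \<partial>lborel)"
      unfolding L1_modulus_def by (intro Bochner_Integration.integral_cong) (auto simp: indicator_def)
    also have "\<dots> = (\<integral>x. ?i (x - t) \<partial>lborel) + (\<integral>x. ?i x \<partial>lborel) - 2 * (\<integral>x. ?i (x - t) * ?i x \<partial>lborel)"
      using i_int integrable_translate[OF i_int, of t] p_int[of t] by simp
    also have "(\<integral>x. ?i (x - t) \<partial>lborel) = (\<integral>x. ?i x \<partial>lborel)"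
      by (rule integral_translate) simp
    finally show ?thesis by simp
  qed
  have "(\<lambda>k. \<integral>x. ?i (x - s k) * ?i x \<partial>lborel) \<longlonglongrightarrow> (\<integral>x. ?i x \<partial>lborel)"
  proof (rule integral_dominated_convergence[where w="?i"])
    show "AE x in lborel. (\<lambda>k. ?i (x - s k) * ?i x) \<longlonglongrightarrow> ?i x"
    proof (rule AE_I2)
      fix x
      show "(\<lambda>k. ?i (x - s k) * ?i x) \<longlonglongrightarrow> ?i x"
      proof (cases "x \<in> U")
        case True
        have "(\<lambda>k. x - s k) \<longlonglongrightarrow> x" using tendsto_diff[OF tendsto_const s, of x] by simp
        then have "eventually (\<lambda>k. x - s k \<in> U) sequentially"
          using topological_tendstoD U True by blast
        then have "eventually (\<lambda>k. 1 = ?i (x - s k) * ?i x) sequentially"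
          by eventually_elim (use True in auto)
        from Lim_transform_eventually[OF tendsto_const this] show ?thesis using True by simp
      qed simp
    qed
  qed (auto simp: indicator_def intro: i_int[unfolded indicator_def[abs_def]] i_int)
  then have "(\<lambda>k. 2 * (\<integral>x. ?i x \<partial>lborel) - 2 * (\<integral>x. ?i (x - s k) * ?i x \<partial>lborel))
      \<longlonglongrightarrow> 2 * (\<integral>x. ?i x \<partial>lborel) - 2 * (\<integral>x. ?i x \<partial>lborel)"
    by (intro tendsto_intros)
  then show "(\<lambda>k. L1_modulus ?i (s k)) \<longlonglongrightarrow> 0" by (simp add: eq)
qed

lemma L1_modulus_scale: "L1_modulus (\<lambda>x. c * h x) s = \<bar>c\<bar> * L1_modulus h s"
  by (simp add: L1_modulus_def abs_mult flip: right_diff_distrib)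

text \<open>
  The functions with this property form a closed subspace of \<open>L\<^sup>1\<close>, which contains the indicators of open
  sets of finite measure, and then those of all Borel sets of finite measure by outer regularity.
\<close>

proposition L1_translation_continuous:
  fixes h :: "'a::euclidean_space \<Rightarrow> real"
  assumes "integrable lborel h"
  shows "(L1_modulus h \<longlongrightarrow> 0) (at 0)"
  using assms
proof (induction rule: integrable_induct)
  case (base A c)
  then have [measurable]: "A \<in> sets borel" by simp
  have A_int: "integrable lborel (indicator A :: 'a \<Rightarrow> real)" using base by simp
  have "(L1_modulus (indicator A) \<longlongrightarrow> 0) (at (0::'a))"
  proof (rule L1_modulus_tendsto_0_approx[OF A_int])
    fix e :: real assume "e > 0"
    then obtain U where U: "open U" "A \<subseteq> U" "emeasure lborel (U - A) < e"
      using outer_regular_lborel[of A e] by auto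
    have [measurable]: "U \<in> sets borel" using U by auto
    have "emeasure lborel U \<le> emeasure lborel A + emeasure lborel (U - A)"
      using emeasure_subadditive[of A lborel "U - A"] U(2) by (simp add: Un_absorb1)
    also have "\<dots> < \<infinity>" using base U(3) by (auto simp: less_top[symmetric])
    finally have fin: "emeasure lborel U < \<infinity>" .
    have "(\<integral>x. \<bar>indicator A x - indicator U x :: real\<bar> \<partial>lborel) = (\<integral>x. indicator (U - A) x \<partial>lborel)"
      using U(2) by (intro Bochner_Integration.integral_cong) (auto simp: indicator_def)
    also have "\<dots> = measure lborel (U - A)" by simp
    also have "\<dots> < e"
      using U(3) \<open>e > 0\<close>
      by (cases "emeasure lborel (U - A)") (auto simp: measure_def ennreal_less_iff)
    finally show "\<exists>g. integrable lborel g \<and> (L1_modulus g \<longlongrightarrow> 0) (at 0)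
        \<and> (\<integral>x. \<bar>indicator A x - g x\<bar> \<partial>lborel) < e"
      using fin L1_modulus_open_set[OF U(1) fin] by (intro exI[of _ "indicator U"]) simp
  qed
  from tendsto_mult_left[OF this, of "\<bar>c\<bar>"]
  have "((\<lambda>s. L1_modulus (\<lambda>x. c * indicator A x) s) \<longlongrightarrow> 0) (at (0::'a))"
    unfolding L1_modulus_scale by simp
  then show ?case by (simp add: mult.commute)
next
  case (add f g)
  have "((\<lambda>s. L1_modulus f s + L1_modulus g s) \<longlongrightarrow> 0) (at 0)"
    using tendsto_add[OF add.IH] by simp
  moreover
  have "L1_modulus (\<lambda>x. f x + g x) s \<le> L1_modulus f s + L1_modulus g s" for s
  proof -
    have i: "integrable lborel (\<lambda>x. \<bar>f (x - s) - f x\<bar>)" "integrable lborel (\<lambda>x. \<bar>g (x - s) - g x\<bar>)"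
      by (intro integrable_abs Bochner_Integration.integrable_diff integrable_translate add.hyps)+
    have "L1_modulus (\<lambda>x. f x + g x) s \<le> (\<integral>x. \<bar>f (x - s) - f x\<bar> + \<bar>g (x - s) - g x\<bar> \<partial>lborel)"
      unfolding L1_modulus_def
    proof (rule integral_mono)
      show "integrable lborel (\<lambda>x. \<bar>f (x - s) + g (x - s) - (f x + g x)\<bar>)"
        by (intro integrable_abs Bochner_Integration.integrable_diff Bochner_Integration.integrable_add
            integrable_translate add.hyps)
    qed (use i in auto)
    also have "\<dots> = L1_modulus f s + L1_modulus g s"
      unfolding L1_modulus_def by (rule Bochner_Integration.integral_add[OF i])
    finally show ?thesis .
  qed
  then have "\<forall>\<^sub>F s in at 0. norm (L1_modulus (\<lambda>x. f x + g x) s) \<le> L1_modulus f s + L1_modulus g s"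
    by (simp add: L1_modulus_nonneg)
  ultimately show ?case by (rule Lim_null_comparison[rotated])
next
  case (lim f s)
  have "(\<lambda>i. \<integral>x. \<bar>f x - s i x\<bar> \<partial>lborel) \<longlonglongrightarrow> integral\<^sup>L lborel (\<lambda>x::'a. 0)"
  proof (rule integral_dominated_convergence[where w="\<lambda>x. 3 * \<bar>f x\<bar>"])
    show "AE x in lborel. (\<lambda>i. \<bar>f x - s i x\<bar>) \<longlonglongrightarrow> 0"
    proof (rule AE_I2)
      fix x
      have "(\<lambda>i. s i x) \<longlonglongrightarrow> f x" using lim by simp
      from tendsto_rabs[OF tendsto_diff[OF tendsto_const this, of "f x"]]
      show "(\<lambda>i. \<bar>f x - s i x\<bar>) \<longlonglongrightarrow> 0" by simp
    qed
    show "AE x in lborel. norm \<bar>f x - s i x\<bar> \<le> 3 * \<bar>f x\<bar>" for i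
    proof (rule AE_I2)
      fix x
      have "\<bar>s i x\<bar> \<le> 2 * \<bar>f x\<bar>" using lim by simp
      then show "norm \<bar>f x - s i x\<bar> \<le> 3 * \<bar>f x\<bar>" by simp
    qed
    show "(\<lambda>x. \<bar>f x - s i x\<bar>) \<in> borel_measurable lborel" for i
      using lim by (intro borel_measurable_integrable) simp
  qed (use lim in auto)
  then have l: "(\<lambda>i. \<integral>x. \<bar>f x - s i x\<bar> \<partial>lborel) \<longlonglongrightarrow> 0" by simp
  show ?case
  proof (rule L1_modulus_tendsto_0_approx[OF \<open>integrable lborel f\<close>])
    fix e :: real assume "e > 0"
    from order_tendstoD(2)[OF l this] obtain i where "(\<integral>x. \<bar>f x - s i x\<bar> \<partial>lborel) < e"
      by (auto simp: eventually_sequentially)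
    then show "\<exists>g. integrable lborel g \<and> (L1_modulus g \<longlongrightarrow> 0) (at 0) \<and> (\<integral>x. \<bar>f x - g x\<bar> \<partial>lborel) < e"
      using lim by (intro exI[of _ "s i"]) auto
  qed
qed

text \<open>
  The mass depends on the space, which does not occur in the type of \<open>r\<close>; hence the type argument.
\<close>

definition bump_mass :: "'a::euclidean_space itself \<Rightarrow> real \<Rightarrow> real" where
  "bump_mass T r = (\<integral>x. flat_exp 0 (r\<^sup>2 - (norm (x::'a))\<^sup>2) \<partial>lborel)"

definition mollifier :: "real \<Rightarrow> 'a::euclidean_space \<Rightarrow> real" where
  "mollifier r x = flat_exp 0 (r\<^sup>2 - (norm x)\<^sup>2) / bump_mass TYPE('a) r"

lemma bump_continuous: "continuous_on UNIV (\<lambda>x::'a::euclidean_space. flat_exp 0 (s - (norm x)\<^sup>2))"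
  using smooth_expr_C_k[OF smooth_expr.bump[of 0 s 0], of 0] by simp

lemma bump_eq_0_iff:
  assumes "r > 0"
  shows "flat_exp 0 (r\<^sup>2 - (norm x)\<^sup>2) = 0 \<longleftrightarrow> norm x \<ge> r"
proof -
  have "flat_exp 0 (r\<^sup>2 - (norm x)\<^sup>2) = 0 \<longleftrightarrow> r\<^sup>2 \<le> (norm x)\<^sup>2"
    by (auto simp: flat_exp_def)
  also have "\<dots> \<longleftrightarrow> r \<le> norm x"
    using assms by (simp add: abs_le_square_iff[symmetric])
  finally show ?thesis .
qed

lemma bump_integrable:
  assumes "r > 0"
  shows "integrable lborel (\<lambda>x::'a::euclidean_space. flat_exp 0 (r\<^sup>2 - (norm x)\<^sup>2))"
proof (rule Bochner_Integration.integrable_bound)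
  show "integrable lborel (indicator (cball 0 r) :: 'a \<Rightarrow> real)"
    using emeasure_lborel_cball_finite[of "0::'a" r] by (simp add: less_top)
  show "(\<lambda>x::'a. flat_exp 0 (r\<^sup>2 - (norm x)\<^sup>2)) \<in> borel_measurable lborel"
    using borel_measurable_continuous_onI[OF bump_continuous] by simp
  show "AE x::'a in lborel. norm (flat_exp 0 (r\<^sup>2 - (norm x)\<^sup>2)) \<le> norm (indicator (cball 0 r) x :: real)"
  proof (rule AE_I2)
    fix x :: 'a
    show "norm (flat_exp 0 (r\<^sup>2 - (norm x)\<^sup>2)) \<le> norm (indicator (cball 0 r) x :: real)"
      using bump_eq_0_iff[OF assms, of x] by (cases "norm x < r") (auto simp: flat_exp_def)
  qed
qed

lemma open_not_null:
  fixes S :: "'a::euclidean_space set"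
  assumes "open S" "AE x in lborel. x \<notin> S"
  shows "S = {}"
proof (rule ccontr)
  assume "S \<noteq> {}"
  have "S \<in> null_sets lborel"
    using assms by (subst AE_iff_null_sets) auto
  then have "negligible S" by (simp add: negligible_iff_null_sets null_sets_completionI)
  then show False using open_not_negligible assms(1) \<open>S \<noteq> {}\<close> by blast
qed

lemma bump_mass_pos:
  assumes "r > 0"
  shows "bump_mass TYPE('a::euclidean_space) r > 0"
proof -
  let ?b = "\<lambda>x::'a. flat_exp 0 (r\<^sup>2 - (norm x)\<^sup>2)"
  have "bump_mass TYPE('a) r \<noteq> 0"
  proof
    assume "bump_mass TYPE('a) r = 0"
    then have "AE x in lborel. ?b x = 0"
      unfolding bump_mass_def
      by (subst (asm) integral_nonneg_eq_0_iff_AE[OF bump_integrable[OF assms]]) (auto simp: flat_exp_nonneg)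
    then have "AE x::'a in lborel. x \<notin> ball 0 r"
      by eventually_elim (use bump_eq_0_iff[OF assms, where ?'a='a] in auto)
    then show False using open_not_null[OF open_ball, of "0::'a" r] assms by simp
  qed
  moreover have "bump_mass TYPE('a) r \<ge> 0"
    by (auto simp: bump_mass_def flat_exp_nonneg)
  ultimately show ?thesis by simp
qed

context
  fixes r :: real assumes r: "r > 0"
begin

lemma mollifier_nonneg: "mollifier r (x::'a::euclidean_space) \<ge> 0"
  using bump_mass_pos[OF r, where ?'a='a] by (simp add: mollifier_def flat_exp_nonneg less_imp_le)

lemma mollifier_eq_0: "norm (x::'a::euclidean_space) \<ge> r \<Longrightarrow> mollifier r x = 0"
  using bump_eq_0_iff[OF r, of x] by (simp add: mollifier_def)

lemma mollifier_smooth: "smooth_expr (\<lambda>z::'a::euclidean_space. mollifier r (x - z))"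
proof -
  have "(\<lambda>z. mollifier r (x - z))
      = (\<lambda>z. (1 / bump_mass TYPE('a) r) * flat_exp 0 (r\<^sup>2 - (norm (z - x))\<^sup>2))"
    by (simp add: mollifier_def norm_minus_commute)
  then show ?thesis by (simp only: smooth_expr.mult smooth_expr.const smooth_expr.bump)
qed

lemma mollifier_smooth': "smooth_expr (mollifier r :: 'a::euclidean_space \<Rightarrow> real)"
proof -
  have "(\<lambda>z. mollifier r (0 - z)) = (mollifier r :: 'a \<Rightarrow> real)"
    by (simp add: mollifier_def fun_eq_iff)
  then show ?thesis using mollifier_smooth[of "0::'a"] by simp
qed

lemma mollifier_measurable[measurable]: "(mollifier r :: 'a::euclidean_space \<Rightarrow> real) \<in> borel_measurable borel"
  using smooth_expr_C_k[OF mollifier_smooth', of 0] by (auto intro: borel_measurable_continuous_onI)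

lemma mollifier_integrable: "integrable lborel (mollifier r :: 'a::euclidean_space \<Rightarrow> real)"
  unfolding mollifier_def[abs_def]
  using bump_integrable[OF r, where ?'a='a] by (rule integrable_divide)

lemma mollifier_integral: "(\<integral>x. mollifier r (x::'a::euclidean_space) \<partial>lborel) = 1"
  unfolding mollifier_def using bump_mass_pos[OF r, where ?'a='a]
  by (simp add: bump_mass_def)

lemma mollifier_le: "\<bar>mollifier r (x::'a::euclidean_space)\<bar> \<le> 1 / bump_mass TYPE('a) r"
  using bump_mass_pos[OF r, where ?'a='a]
  by (auto simp: mollifier_def flat_exp_def divide_right_mono)

end

definition mollify :: "real \<Rightarrow> ('a::euclidean_space \<Rightarrow> 'b::{banach, second_countable_topology}) \<Rightarrow> 'a \<Rightarrow> 'b" where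
  "mollify r h x = (\<integral>z. mollifier r (x - z) *\<^sub>R h z \<partial>lborel)"

lemma mollify_integrand_integrable:
  fixes h :: "'a::euclidean_space \<Rightarrow> 'b::{banach, second_countable_topology}"
  assumes "r > 0" "integrable lborel h"
  shows "integrable lborel (\<lambda>z. mollifier r (x - z) *\<^sub>R h z)"
proof (rule integrable_bounded_scaleR[OF assms(2)])
  note [measurable] = mollifier_measurable[OF assms(1)]
  show "(\<lambda>z. mollifier r (x - z)) \<in> borel_measurable lborel" by measurable
qed (rule mollifier_le[OF assms(1)])

lemma mollify_measurable:
  fixes h :: "'a::euclidean_space \<Rightarrow> 'b::{banach, second_countable_topology}"
  assumes "r > 0" and "integrable lborel h"
  shows "mollify r h \<in> borel_measurable borel"
proof -
  note [measurable] = mollifier_measurable[OF assms(1)]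
  have [measurable]: "h \<in> borel_measurable borel" using borel_measurable_integrable[OF assms(2)] by simp
  have "(\<lambda>x. \<integral>z. mollifier r (x - z) *\<^sub>R h z \<partial>lborel) \<in> borel_measurable lborel"
    by measurable
  then show ?thesis by (simp add: mollify_def[abs_def])
qed

lemma mollify_bounded:
  fixes h :: "'a::euclidean_space \<Rightarrow> 'b::{banach, second_countable_topology}"
  assumes "r > 0" and h: "integrable lborel h"
  shows "norm (mollify r h x) \<le> 1 / bump_mass TYPE('a) r * (\<integral>z. norm (h z) \<partial>lborel)"
proof -
  have "norm (mollify r h x) \<le> (\<integral>z. norm (mollifier r (x - z) *\<^sub>R h z) \<partial>lborel)"
    unfolding mollify_def by (rule integral_norm_bound)
  also have "\<dots> \<le> (\<integral>z. 1 / bump_mass TYPE('a) r * norm (h z) \<partial>lborel)"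
  proof (rule integral_mono)
    show "integrable lborel (\<lambda>z. norm (mollifier r (x - z) *\<^sub>R h z))"
      by (intro integrable_norm mollify_integrand_integrable assms)
    show "norm (mollifier r (x - z) *\<^sub>R h z) \<le> 1 / bump_mass TYPE('a) r * norm (h z)" for z
      unfolding norm_scaleR by (intro mult_right_mono mollifier_le assms norm_ge_zero)
  qed (use h in simp)
  finally show ?thesis by simp
qed

text \<open>
  The mollification is an average of translates of \<open>h\<close>, because the mollifier has total mass one.
\<close>

lemma mollify_minus_le:
  fixes h :: "'a::euclidean_space \<Rightarrow> real"
  assumes r: "r > 0" and h: "integrable lborel h"
  shows "ennreal \<bar>mollify r h x - h x\<bar> \<le> (\<integral>\<^sup>+s. ennreal (mollifier r s) * ennreal \<bar>h (x - s) - h x\<bar> \<partial>lborel)"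
proof -
  note [measurable] = mollifier_measurable[OF r]
  have [measurable]: "h \<in> borel_measurable borel" using borel_measurable_integrable[OF h] by simp
  have int1: "integrable lborel (\<lambda>z. mollifier r (x - z) * h z)"
    using mollify_integrand_integrable[OF r h] by simp
  have int2: "integrable lborel (\<lambda>z. mollifier r (x - z))"
    by (rule integrable_reflect[OF mollifier_integrable[OF r]])
  have one: "(\<integral>z. mollifier r (x - z) \<partial>lborel) = 1"
    using integral_reflect[OF mollifier_measurable[OF r], of x] mollifier_integral[OF r, where ?'a='a] by simp
  have "mollify r h x - h x = (\<integral>z. mollifier r (x - z) * h z \<partial>lborel) - (\<integral>z. mollifier r (x - z) * h x \<partial>lborel)"
    using one by (simp add: mollify_def)
  also have "\<dots> = (\<integral>z. mollifier r (x - z) * h z - mollifier r (x - z) * h x \<partial>lborel)"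
    using int1 int2 by simp
  also have "\<dots> = (\<integral>z. (\<lambda>s. mollifier r s * (h (x - s) - h x)) (x - z) \<partial>lborel)"
    by (simp add: algebra_simps)
  also have "\<dots> = (\<integral>s. mollifier r s * (h (x - s) - h x) \<partial>lborel)"
    by (rule integral_reflect) measurable
  finally have eq: "mollify r h x - h x = (\<integral>s. mollifier r s * (h (x - s) - h x) \<partial>lborel)" .
  have int: "integrable lborel (\<lambda>s. mollifier r s * (h (x - s) - h x))"
  proof -
    have "integrable lborel (\<lambda>z. (\<lambda>z. mollifier r (x - z) * h z - mollifier r (x - z) * h x) (x - z))"
      using int1 int2 by (intro integrable_reflect) auto
    then show ?thesis by (simp add: algebra_simps)
  qed
  have "ennreal \<bar>mollify r h x - h x\<bar> \<le> (\<integral>\<^sup>+s. norm (mollifier r s * (h (x - s) - h x)) \<partial>lborel)"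
    unfolding eq using integral_norm_bound_ennreal[OF int] by simp
  also have "\<dots> = (\<integral>\<^sup>+s. ennreal (mollifier r s) * ennreal \<bar>h (x - s) - h x\<bar> \<partial>lborel)"
    using mollifier_nonneg[OF r, where ?'a='a] by (simp add: abs_mult ennreal_mult)
  finally show ?thesis .
qed

text \<open>
  By Fubini's theorem the \<open>L\<^sup>1\<close> distance is at most the average of the translation modulus against the
  mollifier, which charges only translations shorter than \<open>r\<close>.
\<close>

lemma mollify_L1_bound:
  fixes h :: "'a::euclidean_space \<Rightarrow> real"
  assumes r: "r > 0" and h: "integrable lborel h"
    and e: "\<And>s. norm s < r \<Longrightarrow> L1_modulus h s \<le> e"
  shows "(\<integral>\<^sup>+x. ennreal \<bar>mollify r h x - h x\<bar> \<partial>lborel) \<le> ennreal e"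
proof -
  note [measurable] = mollifier_measurable[OF r]
  have [measurable]: "h \<in> borel_measurable borel" using borel_measurable_integrable[OF h] by simp
  have "(\<integral>\<^sup>+x. ennreal \<bar>mollify r h x - h x\<bar> \<partial>lborel)
      \<le> (\<integral>\<^sup>+x. \<integral>\<^sup>+s. ennreal (mollifier r s) * ennreal \<bar>h (x - s) - h x\<bar> \<partial>lborel \<partial>lborel)"
    by (intro nn_integral_mono mollify_minus_le r h)
  also have "\<dots> = (\<integral>\<^sup>+s. \<integral>\<^sup>+x. ennreal (mollifier r s) * ennreal \<bar>h (x - s) - h x\<bar> \<partial>lborel \<partial>lborel)"
    by (rule lborel_pair.Fubini') measurable
  also have "\<dots> = (\<integral>\<^sup>+s. ennreal (mollifier r s) * ennreal (L1_modulus h s) \<partial>lborel)"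
    unfolding L1_modulus_def
    by (intro nn_integral_cong, subst nn_integral_cmult, measurable, subst nn_integral_eq_integral)
       (use h in \<open>auto intro!: integrable_translate\<close>)
  also have "\<dots> \<le> (\<integral>\<^sup>+s. ennreal (mollifier r (s::'a)) * ennreal e \<partial>lborel)"
  proof (rule nn_integral_mono)
    fix s :: 'a
    show "ennreal (mollifier r s) * ennreal (L1_modulus h s) \<le> ennreal (mollifier r s) * ennreal e"
    proof (cases "norm s < r")
      case True
      then show ?thesis using e by (intro mult_left_mono ennreal_leI) auto
    qed (simp add: mollifier_eq_0[OF r])
  qed
  also have "\<dots> = ennreal e"
    using mollifier_integral[OF r, where ?'a='a] mollifier_nonneg[OF r, where ?'a='a]
      mollifier_integrable[OF r, where ?'a='a]
    by (simp add: nn_integral_multc nn_integral_eq_integral)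
  finally show ?thesis .
qed

lemma mollify_integrable:
  fixes h :: "'a::euclidean_space \<Rightarrow> real"
  assumes r: "r > 0" and h: "integrable lborel h"
  shows "integrable lborel (mollify r h)"
proof -
  note [measurable] = mollify_measurable[OF r h]
  have [measurable]: "h \<in> borel_measurable borel" using borel_measurable_integrable[OF h] by simp
  have "L1_modulus h s \<le> 2 * (\<integral>x. \<bar>h x\<bar> \<partial>lborel)" for s
    using L1_modulus_triangle[OF h, of "\<lambda>_. 0" s] by (simp add: L1_modulus_def)
  then have "(\<integral>\<^sup>+x. ennreal \<bar>mollify r h x - h x\<bar> \<partial>lborel) \<le> ennreal (2 * (\<integral>x. \<bar>h x\<bar> \<partial>lborel))"
    by (rule mollify_L1_bound[OF r h])
  then have "integrable lborel (\<lambda>x. mollify r h x - h x)"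
    by (intro integrableI_bounded) (auto intro: le_less_trans)
  from Bochner_Integration.integrable_add[OF this h] show ?thesis by simp
qed

proposition mollify_tendsto_L1:
  fixes h :: "'a::euclidean_space \<Rightarrow> real"
  assumes h: "integrable lborel h"
  shows "((\<lambda>r. \<integral>x. \<bar>mollify r h x - h x\<bar> \<partial>lborel) \<longlongrightarrow> 0) (at_right 0)"
proof (rule tendstoI)
  fix e :: real assume "e > 0"
  then have "eventually (\<lambda>s. L1_modulus h s < e / 2) (at 0)"
    using order_tendstoD(2)[OF L1_translation_continuous[OF h], of "e / 2"] by simp
  then obtain d where d: "d > 0" "\<And>s. s \<noteq> 0 \<Longrightarrow> norm s < d \<Longrightarrow> L1_modulus h s < e / 2"
    by (auto simp: eventually_at)
  have le: "L1_modulus h s \<le> e / 2" if "norm s < d" for s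
    using d(2)[of s] that \<open>e > 0\<close> by (cases "s = 0") (auto simp: L1_modulus_def less_imp_le)
  have "eventually (\<lambda>r. r \<in> {0<..<d}) (at_right 0)"
    using d(1) by (rule eventually_at_right_real)
  then show "eventually (\<lambda>r. dist (\<integral>x. \<bar>mollify r h x - h x\<bar> \<partial>lborel) 0 < e) (at_right 0)"
  proof eventually_elim
    case (elim r)
    then have "(\<integral>\<^sup>+x. ennreal \<bar>mollify r h x - h x\<bar> \<partial>lborel) \<le> ennreal (e / 2)"
      using le by (intro mollify_L1_bound h) auto
    moreover have "integrable lborel (\<lambda>x. \<bar>mollify r h x - h x\<bar>)"
      using mollify_integrable[of r h] elim h by simp
    ultimately have "(\<integral>x. \<bar>mollify r h x - h x\<bar> \<partial>lborel) \<le> e / 2"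
      using \<open>e > 0\<close> by (simp add: nn_integral_eq_integral)
    then show ?case using \<open>e > 0\<close> by simp
  qed
qed

section \<open>The Poincare inequality for weakly differentiable functions on compact sets\<close>

lemma mollifier_has_derivative:
  fixes x :: "'a::euclidean_space"
  assumes "r > 0"
  shows "(mollifier r has_derivative frechet_derivative (mollifier r) (at x)) (at x)"
  using smooth_expr_C_k[OF mollifier_smooth'[OF assms, where ?'a='a], of 1]
  by (simp add: frechet_derivative_works[symmetric])

lemma mollifier_derivative_eq_0:
  fixes x :: "'a::euclidean_space"
  assumes "r > 0" "norm x > r"
  shows "frechet_derivative (mollifier r) (at x) h = 0"
  using frechet_derivative_eq_0_off_support[of "cball 0 r" "mollifier r" x] assms mollifier_eq_0[OF assms(1), where ?'a='a]
  by simp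

lemma mollifier_derivative_continuous:
  fixes b :: "'a::euclidean_space"
  assumes "r > 0" "b \<in> Basis"
  shows "continuous_on UNIV (\<lambda>x. frechet_derivative (mollifier r) (at x) b)"
  using smooth_expr_C_k[OF mollifier_smooth'[OF assms(1), where ?'a='a], of 1] assms(2) by simp

lemma test_function_mollifier:
  fixes x :: "'a::euclidean_space"
  assumes r: "r > 0" and sub: "cball x r \<subseteq> \<Omega>"
  shows "test_function \<Omega> (\<lambda>z. mollifier r (x - z))"
proof -
  have "{z. mollifier r (x - z) \<noteq> 0} \<subseteq> cball x r"
    using mollifier_eq_0[OF r, of "x - _"] by (force simp: dist_norm)
  then have cl: "closure {z. mollifier r (x - z) \<noteq> 0} \<subseteq> cball x r"
    by (rule closure_minimal) simp
  then have "compact (closure {z. mollifier r (x - z) \<noteq> 0})"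
    by (meson bounded_cball bounded_subset closed_closure compact_eq_bounded_closed)
  then show ?thesis
    using cl sub smooth_expr_C_k[OF mollifier_smooth[OF r]] by (auto simp: test_function_def)
qed

text \<open>
  The definition of the weak gradient, applied to the test function \<open>z \<mapsto> \<eta> (x - z)\<close>: derivatives of the
  kernel in the mollified \<open>f\<close> turn into the mollified \<open>g\<close>. The cut-off to \<open>C\<close>, which makes \<open>f\<close> and \<open>g\<close>
  integrable on the whole space, is invisible at \<open>x\<close> since the test function is supported in \<open>C\<close>.
\<close>

lemma mollify_weak_gradient:
  fixes f :: "'a::euclidean_space \<Rightarrow> real" and g :: "'a \<Rightarrow> 'a"
  assumes r: "r > 0" and wg: "has_weak_gradient \<Omega> f g"
    and C: "compact C" "C \<subseteq> \<Omega>" and x: "cball x r \<subseteq> C"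
  shows "integrable lborel (\<lambda>z. (indicator C z *\<^sub>R f z) * frechet_derivative (mollifier r) (at (x - z)) h)"
    "(\<integral>z. (indicator C z *\<^sub>R f z) * frechet_derivative (mollifier r) (at (x - z)) h \<partial>lborel)
      = mollify r (\<lambda>z. indicator C z *\<^sub>R g z) x \<bullet> h"
proof -
  let ?D = "\<lambda>w h. frechet_derivative (mollifier r) (at (w::'a)) h"
  let ?f = "\<lambda>z. indicator C z *\<^sub>R f z" and ?g = "\<lambda>z. indicator C z *\<^sub>R g z"
  have f_int: "integrable lborel ?f" and g_int: "integrable lborel ?g"
    using wg C by (auto simp: has_weak_gradient_def locally_integrable_def set_integrable_def)
  have off: "r < norm (x - z)" if "z \<notin> C" for z
    using x that by (force simp: dist_norm not_less)
  have Db_int: "integrable lborel (\<lambda>z. ?f z * ?D (x - z) b)" if b: "b \<in> Basis" for b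
  proof -
    have "\<And>w. w \<notin> cball 0 r \<Longrightarrow> ?D w b = 0" by (simp add: mollifier_derivative_eq_0[OF r])
    then obtain c where c: "\<And>w. \<bar>?D w b\<bar> \<le> c"
      using bounded_of_compact_support[OF compact_cball _ mollifier_derivative_continuous[OF r b], of 0 r]
      by blast
    have [measurable]: "(\<lambda>w. ?D w b) \<in> borel_measurable borel"
      by (intro borel_measurable_continuous_onI mollifier_derivative_continuous r b)
    have "integrable lborel (\<lambda>z. ?D (x - z) b *\<^sub>R ?f z)"
      by (rule integrable_bounded_scaleR[OF f_int _ c]) measurable
    then show ?thesis by (simp add: mult.commute)
  qed
  have Db: "(\<integral>z. ?f z * ?D (x - z) b \<partial>lborel) = mollify r ?g x \<bullet> b" if b: "b \<in> Basis" for b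
  proof -
    have deriv: "frechet_derivative (\<lambda>z. mollifier r (x - z)) (at z) b = - ?D (x - z) b" for z
    proof -
      have "((\<lambda>z. x - z) has_derivative (\<lambda>h. - h)) (at z)"
        by (auto intro!: derivative_eq_intros)
      from has_derivative_compose[OF this mollifier_has_derivative[OF r]]
      have "((\<lambda>z. mollifier r (x - z)) has_derivative (\<lambda>h. ?D (x - z) (- h))) (at z)" .
      then have "frechet_derivative (\<lambda>z. mollifier r (x - z)) (at z) = (\<lambda>h. ?D (x - z) (- h))"
        by (metis frechet_derivative_at)
      then show ?thesis
        using linear_neg[OF has_derivative_linear[OF mollifier_has_derivative[OF r]]] by simp
    qed
    have "(\<integral>z. ?f z * ?D (x - z) b \<partial>lborel)
        = - (\<integral>z. f z * frechet_derivative (\<lambda>z. mollifier r (x - z)) (at z) b \<partial>lborel)"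
      unfolding deriv integral_minus[symmetric]
      by (intro Bochner_Integration.integral_cong) (auto simp: indicator_def mollifier_derivative_eq_0[OF r off])
    also have "\<dots> = (\<integral>z. (g z \<bullet> b) * mollifier r (x - z) \<partial>lborel)"
      using wg b test_function_mollifier[OF r, of x \<Omega>] x C by (simp add: has_weak_gradient_def)
    also have "\<dots> = (\<integral>z. (mollifier r (x - z) *\<^sub>R ?g z) \<bullet> b \<partial>lborel)"
      using off by (intro Bochner_Integration.integral_cong)
        (auto simp: indicator_def intro: mollifier_eq_0[OF r] less_imp_le)
    also have "\<dots> = mollify r ?g x \<bullet> b"
      unfolding mollify_def by (intro integral_inner_left mollify_integrand_integrable r g_int)
    finally show ?thesis .
  qed
  have lin: "?D w h = (\<Sum>b\<in>Basis. (h \<bullet> b) * ?D w b)" for w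
  proof -
    have l: "linear (?D w)" using has_derivative_linear[OF mollifier_has_derivative[OF r]] .
    have "?D w h = ?D w (\<Sum>b\<in>Basis. (h \<bullet> b) *\<^sub>R b)" by (simp add: euclidean_representation)
    then show ?thesis using l by (simp add: linear_sum linear_cmul)
  qed
  have eq: "?f z * ?D (x - z) h = (\<Sum>b\<in>Basis. (h \<bullet> b) * (?f z * ?D (x - z) b))" for z
    by (subst lin) (simp add: sum_distrib_left mult_ac)
  show "integrable lborel (\<lambda>z. ?f z * ?D (x - z) h)"
    unfolding eq using Db_int by auto
  have "(\<integral>z. ?f z * ?D (x - z) h \<partial>lborel) = (\<Sum>b\<in>Basis. (h \<bullet> b) * (\<integral>z. ?f z * ?D (x - z) b \<partial>lborel))"
    unfolding eq using Db_int by (subst Bochner_Integration.integral_sum) auto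
  also have "\<dots> = (\<Sum>b\<in>Basis. (h \<bullet> b) * (mollify r ?g x \<bullet> b))"
    by (intro sum.cong refl) (simp only: Db)
  also have "\<dots> = mollify r ?g x \<bullet> h"
    by (subst (2) euclidean_inner) (simp add: mult.commute)
  finally show "(\<integral>z. ?f z * ?D (x - z) h \<partial>lborel) = mollify r ?g x \<bullet> h" .
qed

text \<open>
  The Taylor remainder of the kernel, integrated against \<open>f\<close>, is the Taylor remainder of the
  mollification.
\<close>

lemma mollify_quadratic_minorant:
  fixes f :: "'a::euclidean_space \<Rightarrow> real" and g :: "'a \<Rightarrow> 'a"
  assumes r: "r > 0" and wg: "has_weak_gradient \<Omega> f g"
    and C: "compact C" "C \<subseteq> \<Omega>" and K: "\<And>x. x \<in> K \<Longrightarrow> cball x r \<subseteq> C"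
  obtains M where "M \<ge> 0" "\<And>x y. x \<in> K \<Longrightarrow>
    mollify r (\<lambda>z. indicator C z *\<^sub>R f z) y \<ge> mollify r (\<lambda>z. indicator C z *\<^sub>R f z) x
      + mollify r (\<lambda>z. indicator C z *\<^sub>R g z) x \<bullet> (y - x) - M * (norm (y - x))\<^sup>2"
proof -
  let ?D = "\<lambda>w h. frechet_derivative (mollifier r) (at (w::'a)) h"
  let ?f = "\<lambda>z. indicator C z *\<^sub>R f z" and ?g = "\<lambda>z. indicator C z *\<^sub>R g z"
  have f_int: "integrable lborel ?f"
    using wg C by (auto simp: has_weak_gradient_def locally_integrable_def set_integrable_def)
  obtain M0 where M0: "M0 \<ge> 0"
    "\<And>x y::'a. \<bar>mollifier r y - mollifier r x - ?D x (y - x)\<bar> \<le> M0 * (norm (y - x))\<^sup>2"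
    using quadratic_remainder_of_compact_support[of "mollifier r" "cball (0::'a) r"]
      smooth_expr_C_k[OF mollifier_smooth'[OF r, where ?'a='a]] mollifier_eq_0[OF r, where ?'a='a]
    by auto
  show thesis
  proof (rule that[of "M0 * (\<integral>z. \<bar>?f z\<bar> \<partial>lborel)"])
    show "0 \<le> M0 * (\<integral>z. \<bar>?f z\<bar> \<partial>lborel)" using M0 by simp
    fix x y assume x: "x \<in> K"
    note D = mollify_weak_gradient[OF r wg C K[OF x], of "y - x"]
    have m_int: "integrable lborel (\<lambda>z. mollifier r (w - z) *\<^sub>R ?f z)" for w
      by (rule mollify_integrand_integrable[OF r f_int])
    let ?R = "\<lambda>z. mollifier r (y - z) - mollifier r (x - z) - ?D (x - z) (y - x)"
    have eq: "?f z * ?R z = mollifier r (y - z) *\<^sub>R ?f z - mollifier r (x - z) *\<^sub>R ?f z - ?f z * ?D (x - z) (y - x)" for z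
      by (simp add: algebra_simps)
    have R_int: "integrable lborel (\<lambda>z. ?f z * ?R z)"
      unfolding eq by (intro Bochner_Integration.integrable_diff m_int D(1))
    have I: "mollify r ?f y - mollify r ?f x - mollify r ?g x \<bullet> (y - x) = (\<integral>z. ?f z * ?R z \<partial>lborel)"
      unfolding D(2)[symmetric] unfolding eq mollify_def
        Bochner_Integration.integral_diff[OF Bochner_Integration.integrable_diff[OF m_int[of y] m_int[of x]] D(1)]
        Bochner_Integration.integral_diff[OF m_int[of y] m_int[of x]] ..
    have "\<bar>mollify r ?f y - mollify r ?f x - mollify r ?g x \<bullet> (y - x)\<bar> \<le> (\<integral>z. \<bar>?f z * ?R z\<bar> \<partial>lborel)"
      unfolding I by (rule integral_abs_bound)
    also have "\<dots> \<le> (\<integral>z. (M0 * (norm (y - x))\<^sup>2) * \<bar>?f z\<bar> \<partial>lborel)"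
    proof (rule integral_mono)
      show "integrable lborel (\<lambda>z. \<bar>?f z * ?R z\<bar>)" using R_int by (rule integrable_abs)
      show "integrable lborel (\<lambda>z. (M0 * (norm (y - x))\<^sup>2) * \<bar>?f z\<bar>)"
        by (intro integrable_mult_right integrable_abs f_int)
      fix z
      have "\<bar>?R z\<bar> \<le> M0 * (norm (y - x))\<^sup>2" using M0(2)[of "y - z" "x - z"] by simp
      then show "\<bar>?f z * ?R z\<bar> \<le> (M0 * (norm (y - x))\<^sup>2) * \<bar>?f z\<bar>"
        unfolding abs_mult by (subst mult.commute) (rule mult_right_mono, auto)
    qed
    also have "\<dots> = M0 * (\<integral>z. \<bar>?f z\<bar> \<partial>lborel) * (norm (y - x))\<^sup>2"
      by (subst integral_mult_right_zero) (simp add: mult_ac)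
    finally show "mollify r ?f x + mollify r ?g x \<bullet> (y - x) - M0 * (\<integral>z. \<bar>?f z\<bar> \<partial>lborel) * (norm (y - x))\<^sup>2
        \<le> mollify r ?f y"
      by linarith
  qed
qed

text \<open>
  Jensen's inequality for the probability density \<open>z \<mapsto> mollifier r (x - z)\<close>: the variance of \<open>h\<close> under it
  is nonnegative.
\<close>

lemma mollify_jensen:
  fixes h :: "'a::euclidean_space \<Rightarrow> 'b::euclidean_space"
  assumes r: "r > 0" and h: "integrable lborel h" and h2: "integrable lborel (\<lambda>z. (norm (h z))\<^sup>2)"
  shows "(norm (mollify r h x))\<^sup>2 \<le> mollify r (\<lambda>z. (norm (h z))\<^sup>2) x"
proof -
  let ?m = "mollify r h x"
  let ?e = "\<lambda>z. mollifier r (x - z)"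
  note [simp] = mollify_integrand_integrable[OF r h] mollify_integrand_integrable[OF r h2]
  have one_int[simp]: "integrable lborel ?e"
    by (rule integrable_reflect[OF mollifier_integrable[OF r]])
  have one: "(\<integral>z. ?e z \<partial>lborel) = 1"
    using integral_reflect[OF mollifier_measurable[OF r], of x] mollifier_integral[OF r, where ?'a='a] by simp
  have eq: "?e z * (norm (h z - ?m))\<^sup>2
      = ?e z *\<^sub>R (norm (h z))\<^sup>2 - 2 * ((?e z *\<^sub>R h z) \<bullet> ?m) + ?e z * (norm ?m)\<^sup>2" for z
    by (simp add: power2_norm_eq_inner inner_diff_left inner_diff_right inner_commute algebra_simps)
  have "0 \<le> (\<integral>z. ?e z * (norm (h z - ?m))\<^sup>2 \<partial>lborel)"
    using mollifier_nonneg[OF r, where ?'a='a] by (intro integral_nonneg_AE) auto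
  also have "\<dots> = mollify r (\<lambda>z. (norm (h z))\<^sup>2) x - 2 * (?m \<bullet> ?m) + (norm ?m)\<^sup>2"
  proof -
    have i: "integrable lborel (\<lambda>z. ?e z *\<^sub>R (norm (h z))\<^sup>2)"
      "integrable lborel (\<lambda>z. 2 * ((?e z *\<^sub>R h z) \<bullet> ?m))" "integrable lborel (\<lambda>z. ?e z * (norm ?m)\<^sup>2)"
      by (intro mollify_integrand_integrable r h2 integrable_mult_right integrable_mult_left
          integrable_inner_left h one_int)+
    have "(\<integral>z. (?e z *\<^sub>R h z) \<bullet> ?m \<partial>lborel) = ?m \<bullet> ?m"
      by (subst (2) mollify_def) (intro integral_inner_left mollify_integrand_integrable r h)
    then show ?thesis
      unfolding eq Bochner_Integration.integral_add[OF Bochner_Integration.integrable_diff[OF i(1,2)] i(3)]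
        Bochner_Integration.integral_diff[OF i(1,2)]
      by (simp add: one mollify_def[of r "\<lambda>z. (norm (h z))\<^sup>2"])
  qed
  also have "\<dots> = mollify r (\<lambda>z. (norm (h z))\<^sup>2) x - (norm ?m)\<^sup>2"
    by (simp add: power2_norm_eq_inner)
  finally show ?thesis by simp
qed

text \<open>
  The inequality holds for the mollifications of \<open>f\<close>, cut off outside a neighbourhood \<open>C\<close> of \<open>K\<close>, and it
  passes to the limit. The mean of \<open>f\<close> and the bound \<open>\<integral> p * |g|\<^sup>2\<close> obtained from Jensen's inequality are
  linear in functions converging in \<open>L\<^sup>1\<close>, and \<open>p\<close> is bounded, so these terms converge. The integral of
  \<open>p * f\<^sup>2\<close> is only lower semicontinuous, by Fatou's lemma along a subsequence converging almost everywhere,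
  but it stands on the smaller side.
\<close>

proposition poincare_compact:
  fixes p f :: "'a::euclidean_space \<Rightarrow> real" and g :: "'a \<Rightarrow> 'a"
  assumes rho: "\<rho> > 0" and p: "strongly_log_concave \<rho> p" and p_int: "integrable lborel p"
    and p_le: "\<And>x. p x \<le> B" and supp: "\<And>x. p x \<noteq> 0 \<Longrightarrow> x \<in> K"
    and K: "compact K" "K \<subseteq> \<Omega>" and \<Omega>: "open \<Omega>"
    and wg: "has_weak_gradient \<Omega> f g"
    and g2: "\<And>C. compact C \<Longrightarrow> C \<subseteq> \<Omega> \<Longrightarrow> set_integrable lborel C (\<lambda>x. (norm (g x))\<^sup>2)"
    and f2: "integrable lborel (\<lambda>x. p x * (f x)\<^sup>2)"
  shows "(\<integral>x. p x \<partial>lborel) * (\<integral>x. p x * (f x)\<^sup>2 \<partial>lborel) - (\<integral>x. p x * f x \<partial>lborel)\<^sup>2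
     \<le> 1 / \<rho> * ((\<integral>x. p x \<partial>lborel) * (\<integral>x. p x * (norm (g x))\<^sup>2 \<partial>lborel))"
proof -
  have p0: "0 \<le> p x" for x using p by (simp add: strongly_log_concave_def)
  have pB: "\<bar>p x\<bar> \<le> B" for x using p0 p_le by simp
  have pm[measurable]: "p \<in> borel_measurable borel" using borel_measurable_integrable[OF p_int] by simp
  obtain d where d: "d > 0" "(\<Union>x\<in>K. cball x d) \<subseteq> \<Omega>"
    using compact_subset_open_imp_cball_epsilon_subset[OF K(1) \<Omega> K(2)] by blast
  define C where "C = (\<Union>x\<in>K. cball x d)"
  have C: "compact C" "C \<subseteq> \<Omega>"
    using d compact_minkowski_sum_cball[OF K(1)] by (auto simp: C_def)
  have KC: "x \<in> C" if "x \<in> K" for x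
    using that d(1) by (auto simp: C_def intro!: bexI[of _ x])
  let ?f = "\<lambda>z. indicator C z *\<^sub>R f z" and ?g = "\<lambda>z. indicator C z *\<^sub>R g z"
  let ?h = "\<lambda>z. (norm (?g z))\<^sup>2"
  have f_int: "integrable lborel ?f" and g_int: "integrable lborel ?g"
    using wg C by (auto simp: has_weak_gradient_def locally_integrable_def set_integrable_def)
  have h_int: "integrable lborel ?h"
  proof -
    have "?h = (\<lambda>z. indicator C z *\<^sub>R (norm (g z))\<^sup>2)"
      by (auto simp: fun_eq_iff indicator_def)
    then show ?thesis using g2[OF C] by (simp add: set_integrable_def)
  qed
  define Z where "Z = (\<integral>x. p x \<partial>lborel)"
  have Z0: "Z \<ge> 0" using p0 by (simp add: Z_def)
  have pf_eq: "(\<integral>x. p x * ?f x \<partial>lborel) = (\<integral>x. p x * f x \<partial>lborel)"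
    using supp KC by (intro Bochner_Integration.integral_cong) (auto simp: indicator_def)
  have pf2_eq: "p x * (?f x)\<^sup>2 = p x * (f x)\<^sup>2" for x
    using supp KC by (auto simp: indicator_def)
  have pg_eq: "(\<integral>x. p x * ?h x \<partial>lborel) = (\<integral>x. p x * (norm (g x))\<^sup>2 \<partial>lborel)"
    using supp KC by (intro Bochner_Integration.integral_cong) (auto simp: indicator_def)
  define \<Gamma> where "\<Gamma> = (\<integral>x. p x * ?h x \<partial>lborel)"
  define A where "A = (\<integral>x. p x * ?f x \<partial>lborel)"

  have mollified: "Z * (\<integral>x. p x * (mollify r ?f x)\<^sup>2 \<partial>lborel) - (\<integral>x. p x * mollify r ?f x \<partial>lborel)\<^sup>2
      \<le> 1 / \<rho> * (Z * (\<integral>x. p x * mollify r ?h x \<partial>lborel))"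
    and mollified_int: "integrable lborel (\<lambda>x. p x * (mollify r ?f x)\<^sup>2)"
    if r: "r > 0" "r \<le> d" for r
  proof -
    have sub: "cball x r \<subseteq> C" if "x \<in> K" for x
      using that r by (force simp: C_def)
    obtain M where M: "M \<ge> 0" "\<And>x y. x \<in> K \<Longrightarrow> mollify r ?f y \<ge> mollify r ?f x
        + mollify r ?g x \<bullet> (y - x) - M * (norm (y - x))\<^sup>2"
      using mollify_quadratic_minorant[OF r(1) wg C sub] by blast
    note [measurable] = mollify_measurable[OF r(1) f_int] mollify_measurable[OF r(1) g_int]
      mollify_measurable[OF r(1) h_int] mollify_measurable[OF r(1) f_int, unfolded real_scaleR_def]
    define c where "c = max (1 / bump_mass TYPE('a) r * (\<integral>z. norm (?f z) \<partial>lborel))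
      (max (1 / bump_mass TYPE('a) r * (\<integral>z. norm (?g z) \<partial>lborel))
         (1 / bump_mass TYPE('a) r * (\<integral>z. norm (?h z) \<partial>lborel)))"
    have bf: "\<bar>mollify r ?f x\<bar> \<le> c" for x
      using mollify_bounded[OF r(1) f_int, of x] by (simp add: c_def)
    have bg: "norm (mollify r ?g x) \<le> c" for x
      using mollify_bounded[OF r(1) g_int, of x] by (simp add: c_def)
    have bh: "\<bar>mollify r ?h x\<bar> \<le> c" for x
      using mollify_bounded[OF r(1) h_int, of x] by (simp add: c_def)
    have "Z * (\<integral>x. p x * (mollify r ?f x)\<^sup>2 \<partial>lborel) - (\<integral>x. p x * mollify r ?f x \<partial>lborel)\<^sup>2
        \<le> 1 / \<rho> * (Z * (\<integral>x. p x * (norm (mollify r ?g x))\<^sup>2 \<partial>lborel))"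
      unfolding Z_def
      by (rule poincare_quadratic_minorant[OF rho p p_int supp mollify_measurable[OF r(1) f_int]
          mollify_measurable[OF r(1) g_int] bf bg M(2) M(1)])
    also have "\<dots> \<le> 1 / \<rho> * (Z * (\<integral>x. p x * mollify r ?h x \<partial>lborel))"
    proof (intro mult_left_mono integral_mono)
      show "integrable lborel (\<lambda>x. p x * (norm (mollify r ?g x))\<^sup>2)"
        using power_mono[OF bg, where n=2] by (intro integrable_mult_bounded[OF p_int, where c="c\<^sup>2"]) auto
      show "integrable lborel (\<lambda>x. p x * mollify r ?h x)"
        by (rule integrable_mult_bounded[OF p_int _ bh]) measurable
    qed (use rho Z0 p0 mollify_jensen[OF r(1) g_int h_int] in auto)
    finally show "Z * (\<integral>x. p x * (mollify r ?f x)\<^sup>2 \<partial>lborel) - (\<integral>x. p x * mollify r ?f x \<partial>lborel)\<^sup>2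
      \<le> 1 / \<rho> * (Z * (\<integral>x. p x * mollify r ?h x \<partial>lborel))" .
    show "integrable lborel (\<lambda>x. p x * (mollify r ?f x)\<^sup>2)"
      using power_mono[OF bf, where n=2] by (intro integrable_mult_bounded[OF p_int, where c="c\<^sup>2"]) auto
  qed

  show ?thesis
  proof (cases "Z = 0")
    case True
    then show ?thesis by (simp add: Z_def)
  next
    case False
    then have Zpos: "Z > 0" using Z0 by simp
    define s where "s k = d / real (Suc k)" for k
    have s_pos: "s k > 0" and s_le: "s k \<le> d" for k
      using d(1) by (auto simp: s_def divide_le_eq mult_le_cancel_left1)
    have "s \<longlonglongrightarrow> 0" unfolding s_def[abs_def] by real_asymp
    then have s_right: "filterlim s (at_right 0) sequentially"
      using s_pos by (auto simp: filterlim_at less_imp_neq[symmetric] intro!: always_eventually)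
    have L1: "(\<lambda>k. \<integral>x. \<bar>mollify (s k) q x - q x\<bar> \<partial>lborel) \<longlonglongrightarrow> 0"
      if "integrable lborel q" for q :: "'a \<Rightarrow> real"
      by (rule filterlim_compose[OF mollify_tendsto_L1[OF that] s_right])
    have weighted: "(\<lambda>k. \<integral>x. p x * mollify (s k) q x \<partial>lborel) \<longlonglongrightarrow> (\<integral>x. p x * q x \<partial>lborel)"
      if q: "integrable lborel q" for q :: "'a \<Rightarrow> real"
    proof -
      have i: "integrable lborel (\<lambda>x. p x * v x)" if "integrable lborel v" for v :: "'a \<Rightarrow> real"
        using integrable_bounded_scaleR[OF that _ pB] by simp
      have "\<bar>(\<integral>x. p x * mollify (s k) q x \<partial>lborel) - (\<integral>x. p x * q x \<partial>lborel)\<bar>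
          \<le> B * (\<integral>x. \<bar>mollify (s k) q x - q x\<bar> \<partial>lborel)" for k
      proof -
        have m: "integrable lborel (mollify (s k) q)" by (rule mollify_integrable[OF s_pos q])
        then have di: "integrable lborel (\<lambda>x. mollify (s k) q x - q x)" using q by simp
        have "(\<integral>x. p x * mollify (s k) q x \<partial>lborel) - (\<integral>x. p x * q x \<partial>lborel)
            = (\<integral>x. p x * (mollify (s k) q x - q x) \<partial>lborel)"
          unfolding right_diff_distrib by (rule Bochner_Integration.integral_diff[OF i[OF m] i[OF q], symmetric])
        also have "\<bar>\<dots>\<bar> \<le> (\<integral>x. \<bar>p x * (mollify (s k) q x - q x)\<bar> \<partial>lborel)"
          by (rule integral_abs_bound)
        also have "\<dots> \<le> (\<integral>x. B * \<bar>mollify (s k) q x - q x\<bar> \<partial>lborel)"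
          by (intro integral_mono integrable_abs i di integrable_mult_right)
             (simp add: abs_mult mult_right_mono pB del: abs_of_nonneg)
        finally show ?thesis by simp
      qed
      then have "\<forall>\<^sub>F k in sequentially.
          norm ((\<integral>x. p x * mollify (s k) q x \<partial>lborel) - (\<integral>x. p x * q x \<partial>lborel))
          \<le> B * (\<integral>x. \<bar>mollify (s k) q x - q x\<bar> \<partial>lborel)"
        by simp
      moreover have "(\<lambda>k. B * (\<integral>x. \<bar>mollify (s k) q x - q x\<bar> \<partial>lborel)) \<longlonglongrightarrow> 0"
        using tendsto_mult_left[OF L1[OF q], of B] by simp
      ultimately have "(\<lambda>k. (\<integral>x. p x * mollify (s k) q x \<partial>lborel) - (\<integral>x. p x * q x \<partial>lborel)) \<longlonglongrightarrow> 0"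
        by (rule Lim_null_comparison)
      then show ?thesis by (simp add: LIM_zero_iff)
    qed
    have di: "integrable lborel (\<lambda>x. mollify (s k) ?f x - ?f x)" for k
      by (intro Bochner_Integration.integrable_diff mollify_integrable s_pos f_int)
    have "(\<lambda>k. \<integral>x. norm (mollify (s k) ?f x - ?f x) \<partial>lborel) \<longlonglongrightarrow> 0"
      using L1[OF f_int] by simp
    from tendsto_L1_AE_subseq[OF di this] obtain \<sigma> :: "nat \<Rightarrow> nat" where \<sigma>: "strict_mono \<sigma>"
        and ae: "AE x in lborel. (\<lambda>k. mollify (s (\<sigma> k)) ?f x - ?f x) \<longlonglongrightarrow> 0"
      by blast
    define R where "R k = ((\<integral>x. p x * mollify (s (\<sigma> k)) ?f x \<partial>lborel)\<^sup>2
        + 1 / \<rho> * (Z * (\<integral>x. p x * mollify (s (\<sigma> k)) ?h x \<partial>lborel))) / Z" for k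
    have sub: "(\<lambda>k. \<integral>x. p x * mollify (s (\<sigma> k)) q x \<partial>lborel) \<longlonglongrightarrow> (\<integral>x. p x * q x \<partial>lborel)"
      if "integrable lborel q" for q :: "'a \<Rightarrow> real"
      using LIMSEQ_subseq_LIMSEQ[OF weighted[OF that] \<sigma>] by (simp add: comp_def)
    have R: "R \<longlonglongrightarrow> (A\<^sup>2 + 1 / \<rho> * (Z * \<Gamma>)) / Z"
      unfolding R_def[abs_def] A_def \<Gamma>_def using Zpos
      by (intro tendsto_intros sub f_int h_int) auto
    have le_R: "(\<integral>x. p x * (mollify (s (\<sigma> k)) ?f x)\<^sup>2 \<partial>lborel) \<le> R k" for k
      using mollified[OF s_pos s_le, of "\<sigma> k"] Zpos
      by (simp add: R_def pos_le_divide_eq algebra_simps)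
    have [measurable]: "?f \<in> borel_measurable borel" using borel_measurable_integrable[OF f_int] by simp
    have mm[measurable]: "mollify (s (\<sigma> k)) ?f \<in> borel_measurable borel" for k
      by (rule mollify_measurable[OF s_pos f_int])
    note [measurable] = mm[unfolded real_scaleR_def]
    have "(\<integral>\<^sup>+x. ennreal (p x * (?f x)\<^sup>2) \<partial>lborel)
        = (\<integral>\<^sup>+x. liminf (\<lambda>k. ennreal (p x * (mollify (s (\<sigma> k)) ?f x)\<^sup>2)) \<partial>lborel)"
    proof (rule nn_integral_cong_AE, use ae in eventually_elim)
      case (elim x)
      then have "(\<lambda>k. mollify (s (\<sigma> k)) ?f x) \<longlonglongrightarrow> ?f x" by (simp add: LIM_zero_iff)
      then have "(\<lambda>k. ennreal (p x * (mollify (s (\<sigma> k)) ?f x)\<^sup>2)) \<longlonglongrightarrow> ennreal (p x * (?f x)\<^sup>2)"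
        by (intro tendsto_intros)
      then show ?case by (simp add: lim_imp_Liminf)
    qed
    also have "\<dots> \<le> liminf (\<lambda>k. \<integral>\<^sup>+x. ennreal (p x * (mollify (s (\<sigma> k)) ?f x)\<^sup>2) \<partial>lborel)"
      by (rule nn_integral_liminf) measurable
    also have "\<dots> \<le> liminf (\<lambda>k. ennreal (R k))"
    proof (rule Liminf_mono, rule always_eventually, rule allI)
      fix k
      show "(\<integral>\<^sup>+x. ennreal (p x * (mollify (s (\<sigma> k)) ?f x)\<^sup>2) \<partial>lborel) \<le> ennreal (R k)"
        using mollified_int[OF s_pos s_le, of "\<sigma> k"] p0 le_R[of k]
        by (subst nn_integral_eq_integral) (auto intro: ennreal_leI)
    qed
    also have "\<dots> = ennreal ((A\<^sup>2 + 1 / \<rho> * (Z * \<Gamma>)) / Z)"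
      by (intro lim_imp_Liminf tendsto_ennrealI R) simp
    finally have "(\<integral>\<^sup>+x. ennreal (p x * (f x)\<^sup>2) \<partial>lborel) \<le> ennreal ((A\<^sup>2 + 1 / \<rho> * (Z * \<Gamma>)) / Z)"
      unfolding pf2_eq .
    moreover have "\<Gamma> \<ge> 0" using p0 by (simp add: \<Gamma>_def)
    ultimately have "(\<integral>x. p x * (f x)\<^sup>2 \<partial>lborel) \<le> (A\<^sup>2 + 1 / \<rho> * (Z * \<Gamma>)) / Z"
      using p0 f2 rho Zpos by (simp add: nn_integral_eq_integral)
    then have "Z * (\<integral>x. p x * (f x)\<^sup>2 \<partial>lborel) - A\<^sup>2 \<le> 1 / \<rho> * (Z * \<Gamma>)"
      using Zpos by (simp add: pos_le_divide_eq algebra_simps)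
    then show ?thesis
      unfolding A_def \<Gamma>_def pf_eq pg_eq Z_def .
  qed
qed

section \<open>Strongly log-concave densities on open convex sets\<close>

lemma strongly_log_concave_exp_neg:
  fixes U :: "'a::real_inner \<Rightarrow> real"
  assumes "convex_on \<Omega> (\<lambda>x. U x - \<rho> / 2 * (norm x)\<^sup>2)"
  shows "strongly_log_concave \<rho> (\<lambda>x. indicator \<Omega> x * exp (- U x))"
  unfolding strongly_log_concave_def
proof (intro conjI allI)
  fix x y :: 'a
  show "indicator \<Omega> x * exp (- U x) * (indicator \<Omega> y * exp (- U y)) * exp (\<rho> / 4 * (norm (x - y))\<^sup>2)
      \<le> (indicator \<Omega> (midpoint x y) * exp (- U (midpoint x y)))\<^sup>2"
  proof (cases "x \<in> \<Omega> \<and> y \<in> \<Omega>")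
    case True
    let ?m = "midpoint x y"
    have m: "?m = (1 - 1/2) *\<^sub>R x + (1/2) *\<^sub>R y" by (simp add: midpoint_def scaleR_add_right)
    have "convex \<Omega>" using assms by (rule convex_on_imp_convex)
    then have "?m \<in> \<Omega>" using True using convexD_alt[of \<Omega> x y "1/2"] by (simp add: m)
    have "U ?m - \<rho> / 2 * (norm ?m)\<^sup>2
        \<le> (1 - 1/2) * (U x - \<rho> / 2 * (norm x)\<^sup>2) + (1/2) * (U y - \<rho> / 2 * (norm y)\<^sup>2)"
      unfolding m using True by (intro convex_onD[OF assms]) auto
    moreover have "(norm ?m)\<^sup>2 = (norm x)\<^sup>2 / 2 + (norm y)\<^sup>2 / 2 - (norm (x - y))\<^sup>2 / 4"
      unfolding midpoint_def power2_norm_eq_inner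
      by (simp add: inner_simps inner_commute field_simps)
    ultimately have "2 * U ?m \<le> U x + U y - \<rho> / 4 * (norm (x - y))\<^sup>2"
      by (simp add: algebra_simps)
    then have "exp (- U x + - U y + \<rho> / 4 * (norm (x - y))\<^sup>2) \<le> exp (- U ?m + - U ?m)" by simp
    then show ?thesis
      using True \<open>?m \<in> \<Omega>\<close> unfolding exp_add by (simp add: power2_eq_square)
  qed auto
qed (simp add: indicator_def)

lemma strongly_log_concave_restrict:
  assumes "strongly_log_concave \<rho> p" "convex K"
  shows "strongly_log_concave \<rho> (\<lambda>x. indicator K x * p x)"
  unfolding strongly_log_concave_def
proof (intro conjI allI)
  fix x y
  show "indicator K x * p x * (indicator K y * p y) * exp (\<rho> / 4 * (norm (x - y))\<^sup>2)
      \<le> (indicator K (midpoint x y) * p (midpoint x y))\<^sup>2"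
  proof (cases "x \<in> K \<and> y \<in> K")
    case True
    then have "midpoint x y \<in> K"
      using convexD_alt[OF assms(2), of x y "1/2"] by (simp add: midpoint_def scaleR_add_right)
    then show ?thesis using True assms(1) by (simp add: strongly_log_concave_def)
  qed auto
qed (use assms in \<open>simp add: strongly_log_concave_def\<close>)

text \<open>
  The points at distance at most \<open>n\<close> from the origin and at least \<open>1 / (n + 1)\<close> from the complement of \<open>\<Omega>\<close>.
\<close>

definition inner_exhaustion :: "'a::euclidean_space set \<Rightarrow> nat \<Rightarrow> 'a set" where
  "inner_exhaustion \<Omega> n = cball 0 (real n) \<inter> {x. ball x (1 / Suc n) \<subseteq> \<Omega>}"

lemma inner_exhaustion_subset: "inner_exhaustion \<Omega> n \<subseteq> \<Omega>"
proof
  fix x assume "x \<in> inner_exhaustion \<Omega> n"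
  then have "ball x (1 / Suc n) \<subseteq> \<Omega>" by (simp add: inner_exhaustion_def)
  moreover have "x \<in> ball x (1 / Suc n)" by simp
  ultimately show "x \<in> \<Omega>" by (rule subsetD)
qed

lemma compact_inner_exhaustion: "compact (inner_exhaustion \<Omega> n)"
proof -
  have "- {x. ball x (1 / Suc n) \<subseteq> \<Omega>} = (\<Union>y\<in>-\<Omega>. ball y (1 / Suc n))"
    by (auto simp: dist_commute)
  then have "closed {x. ball x (1 / Suc n) \<subseteq> \<Omega>}"
    unfolding closed_def by (simp only:) auto
  then show ?thesis by (auto simp: inner_exhaustion_def intro: compact_Int_closed)
qed

lemma convex_inner_exhaustion:
  assumes "convex \<Omega>"
  shows "convex (inner_exhaustion \<Omega> n)"
proof -
  have "convex {x. ball x d \<subseteq> \<Omega>}" for d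
  proof (rule convexI, safe)
    fix x y w and u v :: real
    assume x: "ball x d \<subseteq> \<Omega>" and y: "ball y d \<subseteq> \<Omega>" and uv: "0 \<le> u" "0 \<le> v" "u + v = 1"
      and w: "w \<in> ball (u *\<^sub>R x + v *\<^sub>R y) d"
    define h where "h = w - (u *\<^sub>R x + v *\<^sub>R y)"
    have "norm h < d" using w by (simp add: h_def dist_norm norm_minus_commute)
    then have "x + h \<in> \<Omega>" "y + h \<in> \<Omega>" using x y by (auto simp: dist_norm subset_iff)
    then have "u *\<^sub>R (x + h) + v *\<^sub>R (y + h) \<in> \<Omega>"
      using assms uv by (simp add: convexD)
    moreover have "u *\<^sub>R (x + h) + v *\<^sub>R (y + h) = (u *\<^sub>R x + v *\<^sub>R y) + (u + v) *\<^sub>R h"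
      by (simp add: algebra_simps)
    ultimately show "w \<in> \<Omega>" using uv by (simp add: h_def)
  qed
  then show ?thesis unfolding inner_exhaustion_def by (intro convex_Int convex_cball)
qed

lemma eventually_in_inner_exhaustion:
  assumes "open \<Omega>" "x \<in> \<Omega>"
  shows "eventually (\<lambda>n. x \<in> inner_exhaustion \<Omega> n) sequentially"
proof -
  obtain e where e: "e > 0" "ball x e \<subseteq> \<Omega>" using assms by (auto simp: open_contains_ball)
  obtain N1 where N1: "1 / Suc N1 < e" using e(1) nat_approx_posE by blast
  obtain N2 where N2: "norm x \<le> real N2" using real_arch_simple by blast
  show ?thesis
    unfolding eventually_sequentially
  proof (intro exI[of _ "max N1 N2"] allI impI)
    fix n assume n: "max N1 N2 \<le> n"
    then have "1 / Suc n \<le> 1 / real (Suc N1)" by (intro frac_le) auto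
    then have "ball x (1 / Suc n) \<subseteq> ball x e" using N1 by (intro subset_ball) simp
    moreover have "norm x \<le> real n" using N2 n by simp
    ultimately show "x \<in> inner_exhaustion \<Omega> n" using e(2) by (auto simp: inner_exhaustion_def)
  qed
qed

lemma continuous_on_of_strongly_convex:
  fixes U :: "'a::euclidean_space \<Rightarrow> real"
  assumes "open \<Omega>" "convex_on \<Omega> (\<lambda>x. U x - \<rho> / 2 * (norm x)\<^sup>2)"
  shows "continuous_on \<Omega> U"
proof -
  have "continuous_on \<Omega> (\<lambda>x. (U x - \<rho> / 2 * (norm x)\<^sup>2) + \<rho> / 2 * (norm x)\<^sup>2)"
    by (intro continuous_intros convex_on_continuous assms)
  then show ?thesis by simp
qed

text \<open>
  The restrictions \<open>pn n\<close> of \<open>p\<close> to the compact convex sets of the exhaustion are strongly log-concave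
  and bounded, so the compact case applies to them; dominated convergence removes the restriction.
  The square integrability of \<open>g\<close> on compact subsets of \<open>\<Omega>\<close> holds because \<open>p\<close> is bounded below there.
\<close>

theorem poincare_log_concave:
  fixes U f :: "'a::euclidean_space \<Rightarrow> real" and g :: "'a \<Rightarrow> 'a"
  assumes rho: "\<rho> > 0" and \<Omega>: "open \<Omega>"
    and conv: "convex_on \<Omega> (\<lambda>x. U x - \<rho> / 2 * (norm x)\<^sup>2)"
    and p_def: "p = (\<lambda>x. indicator \<Omega> x * exp (- U x))"
    and p_int: "integrable lborel p"
    and f[measurable]: "f \<in> borel_measurable borel" and g[measurable]: "g \<in> borel_measurable borel"
    and f2: "integrable lborel (\<lambda>x. p x * (f x)\<^sup>2)"
    and g2: "integrable lborel (\<lambda>x. p x * (norm (g x))\<^sup>2)"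
    and wg: "has_weak_gradient \<Omega> f g"
  shows "(\<integral>x. p x \<partial>lborel) * (\<integral>x. p x * (f x)\<^sup>2 \<partial>lborel) - (\<integral>x. p x * f x \<partial>lborel)\<^sup>2
     \<le> 1 / \<rho> * ((\<integral>x. p x \<partial>lborel) * (\<integral>x. p x * (norm (g x))\<^sup>2 \<partial>lborel))"
proof -
  have convex: "convex \<Omega>" using conv by (rule convex_on_imp_convex)
  have U_cont: "continuous_on \<Omega> U" by (rule continuous_on_of_strongly_convex[OF \<Omega> conv])
  have p0: "0 \<le> p x" for x by (simp add: p_def)
  have slc: "strongly_log_concave \<rho> p" unfolding p_def by (rule strongly_log_concave_exp_neg[OF conv])
  have [measurable]: "p \<in> borel_measurable borel" using borel_measurable_integrable[OF p_int] by simp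
  have g2_loc: "set_integrable lborel C (\<lambda>x. (norm (g x))\<^sup>2)" if C: "compact C" "C \<subseteq> \<Omega>" for C
  proof -
    have "compact (U ` C)" using C U_cont by (intro compact_continuous_image) (auto intro: continuous_on_subset)
    then have "bounded (U ` C)" by (rule compact_imp_bounded)
    then obtain b where b: "\<And>x. x \<in> C \<Longrightarrow> \<bar>U x\<bar> \<le> b" by (auto simp: bounded_iff)
    have [measurable]: "C \<in> sets borel" using C by (simp add: compact_imp_closed)
    show ?thesis
      unfolding set_integrable_def
    proof (rule Bochner_Integration.integrable_bound)
      show "integrable lborel (\<lambda>x. exp b * (p x * (norm (g x))\<^sup>2))" using g2 by simp
      show "AE x in lborel. norm (indicat_real C x *\<^sub>R (norm (g x))\<^sup>2) \<le> norm (exp b * (p x * (norm (g x))\<^sup>2))"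
      proof (rule AE_I2)
        fix x
        have "1 \<le> exp b * p x" if "x \<in> C"
          using that C b[OF that] by (auto simp: p_def exp_add[symmetric])
        then show "norm (indicat_real C x *\<^sub>R (norm (g x))\<^sup>2) \<le> norm (exp b * (p x * (norm (g x))\<^sup>2))"
          using p0[of x] mult_right_mono[of 1 "exp b * p x" "(norm (g x))\<^sup>2"]
          by (cases "x \<in> C") (auto simp: abs_mult mult.assoc)
      qed
    qed measurable
  qed
  define K where "K = inner_exhaustion \<Omega>"
  define pn where "pn n x = indicator (K n) x * p x" for n x
  have [measurable]: "K n \<in> sets borel" for n
    by (simp add: K_def borel_compact compact_inner_exhaustion)
  have restr: "integrable lborel (\<lambda>x. pn n x * q x)" if "integrable lborel (\<lambda>x. p x * q x)" for n q
  proof -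
    have "integrable lborel (\<lambda>x. indicator (K n) x *\<^sub>R (p x * q x))"
      using that by (intro integrable_mult_indicator) auto
    then show ?thesis by (simp add: pn_def mult.assoc)
  qed
  have fin: "(\<integral>x. pn n x \<partial>lborel) * (\<integral>x. pn n x * (f x)\<^sup>2 \<partial>lborel) - (\<integral>x. pn n x * f x \<partial>lborel)\<^sup>2
     \<le> 1 / \<rho> * ((\<integral>x. pn n x \<partial>lborel) * (\<integral>x. pn n x * (norm (g x))\<^sup>2 \<partial>lborel))" for n
  proof -
    have K: "compact (K n)" "K n \<subseteq> \<Omega>" "convex (K n)"
      using compact_inner_exhaustion[of \<Omega> n] inner_exhaustion_subset[of \<Omega> n]
        convex_inner_exhaustion[OF convex, of n]
      by (simp_all add: K_def)
    have "compact (U ` K n)" using K U_cont by (intro compact_continuous_image) (auto intro: continuous_on_subset)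
    then have "bounded (U ` K n)" by (rule compact_imp_bounded)
    then obtain b where b: "\<And>x. x \<in> K n \<Longrightarrow> \<bar>U x\<bar> \<le> b" by (auto simp: bounded_iff)
    show ?thesis
    proof (rule poincare_compact[OF rho _ _ _ _ K(1,2) \<Omega> wg g2_loc restr[OF f2]])
      show "strongly_log_concave \<rho> (pn n)"
        unfolding pn_def[abs_def] by (rule strongly_log_concave_restrict[OF slc K(3)])
      show "integrable lborel (pn n)" using restr[of "\<lambda>_. 1" n] p_int by simp
      show "pn n x \<le> exp b" for x
        using b[of x] by (auto simp: pn_def p_def indicator_def)
      show "pn n x \<noteq> 0 \<Longrightarrow> x \<in> K n" for x by (simp add: pn_def indicator_def split: if_splits)
    qed
  qed
  have lim: "(\<lambda>n. \<integral>x. pn n x * q x \<partial>lborel) \<longlonglongrightarrow> (\<integral>x. p x * q x \<partial>lborel)"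
    if q: "integrable lborel (\<lambda>x. p x * q x)" for q
  proof (rule integral_dominated_convergence[where w="\<lambda>x. \<bar>p x * q x\<bar>"])
    show "AE x in lborel. (\<lambda>n. pn n x * q x) \<longlonglongrightarrow> p x * q x"
    proof (rule AE_I2)
      fix x
      show "(\<lambda>n. pn n x * q x) \<longlonglongrightarrow> p x * q x"
      proof (cases "x \<in> \<Omega>")
        case True
        have "eventually (\<lambda>n. p x * q x = pn n x * q x) sequentially"
          using eventually_in_inner_exhaustion[OF \<Omega> True]
          by eventually_elim (simp add: pn_def K_def)
        then show ?thesis by (rule Lim_transform_eventually[OF tendsto_const])
      qed (simp add: pn_def p_def)
    qed
    show "AE x in lborel. norm (pn n x * q x) \<le> \<bar>p x * q x\<bar>" for n
      by (auto simp: pn_def indicator_def)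
    show "(\<lambda>x. pn n x * q x) \<in> borel_measurable lborel" for n
      using borel_measurable_integrable[OF restr[OF q]] .
  qed (use q borel_measurable_integrable[OF q] in auto)
  have pf: "integrable lborel (\<lambda>x. p x * f x)"
  proof (rule Bochner_Integration.integrable_bound[OF Bochner_Integration.integrable_add[OF p_int f2]])
    show "AE x in lborel. norm (p x * f x) \<le> norm (p x + p x * (f x)\<^sup>2)"
    proof (rule AE_I2)
      fix x
      have "0 \<le> (\<bar>f x\<bar> - 1)\<^sup>2" by simp
      then have "2 * \<bar>f x\<bar> \<le> 1 + (f x)\<^sup>2" by (simp add: power2_eq_square algebra_simps)
      then have "\<bar>f x\<bar> \<le> 1 + (f x)\<^sup>2" by simp
      then have "p x * \<bar>f x\<bar> \<le> p x * (1 + (f x)\<^sup>2)" using p0 by (rule mult_left_mono)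
      then show "norm (p x * f x) \<le> norm (p x + p x * (f x)\<^sup>2)"
        using p0[of x] by (simp add: abs_mult distrib_left)
    qed
  qed measurable
  have p1: "(\<lambda>n. \<integral>x. pn n x \<partial>lborel) \<longlonglongrightarrow> (\<integral>x. p x \<partial>lborel)"
    using lim[of "\<lambda>_. 1"] p_int by simp
  show ?thesis
    by (rule LIMSEQ_le[OF tendsto_diff[OF tendsto_mult[OF p1 lim[OF f2]] tendsto_power[OF lim[OF pf]]]
          tendsto_mult[OF tendsto_const tendsto_mult[OF p1 lim[OF g2]]]]) (use fin in blast)
qed

text \<open>
  The inequality for the unnormalised density \<open>p\<close>, divided by \<open>Z\<^sup>2\<close>. The mass \<open>Z\<close> is positive because \<open>p\<close>
  is positive on a nonempty open set.
\<close>

theorem poincare_gibbs: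
  fixes E :: "'a::euclidean_space \<Rightarrow> ereal" and U f :: "'a \<Rightarrow> real" and g :: "'a \<Rightarrow> 'a"
  assumes rho: "\<rho> > 0" and \<Omega>: "open \<Omega>" "\<Omega> \<noteq> {}"
    and conv: "convex_on \<Omega> (\<lambda>x. U x - \<rho> / 2 * (norm x)\<^sup>2)"
    and E: "\<And>x. exp_neg (E x) = indicator \<Omega> x * exp (- U x)"
    and fin: "partition_fun E < \<infinity>"
    and f: "f \<in> L2 (gibbs E)" and g: "g \<in> L2 (gibbs E)"
    and wg: "has_weak_gradient \<Omega> f g"
  shows "var (gibbs E) f \<le> 1 / \<rho> * (LINT x|gibbs E. (norm (g x))\<^sup>2)"
proof -
  define p where "p x = indicator \<Omega> x * exp (- U x)" for x
  define Z where "Z = (\<integral>x. p x \<partial>lborel)"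
  have p0: "0 \<le> p x" for x by (simp add: p_def)
  have "continuous_on \<Omega> (\<lambda>x. exp (- U x))"
    by (intro continuous_intros continuous_on_of_strongly_convex[OF \<Omega>(1) conv])
  from borel_measurable_continuous_on_indicator[OF _ this]
  have pm[measurable]: "p \<in> borel_measurable borel" using \<Omega> by (simp add: p_def[abs_def])
  have pf: "partition_fun E = (\<integral>\<^sup>+x. ennreal (p x) \<partial>lborel)"
    by (simp add: partition_fun_def E p_def)
  have p_int: "integrable lborel p"
    using fin p0 by (intro integrableI_nonneg) (auto simp: pf)
  have ZE: "partition_fun E = ennreal Z"
    unfolding pf Z_def by (rule nn_integral_eq_integral) (auto simp: p_int p0)
  have "Z \<noteq> 0"
  proof
    assume "Z = 0"
    then have "AE x in lborel. p x = 0"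
      unfolding Z_def by (subst (asm) integral_nonneg_eq_0_iff_AE[OF p_int]) (auto simp: p0)
    then have "AE x in lborel. x \<notin> \<Omega>" by eventually_elim (auto simp: p_def)
    then show False using open_not_null \<Omega> by blast
  qed
  then have Z: "Z > 0" using p0 by (simp add: Z_def less_le)
  have gibbs: "gibbs E = density lborel (\<lambda>x. ennreal (p x / Z))"
    unfolding gibbs_def ZE E p_def[symmetric] using Z p0 by (simp add: divide_ennreal)
  have [measurable]: "f \<in> borel_measurable borel" "g \<in> borel_measurable borel"
    using f g by (auto simp: L2_def gibbs)
  have int: "(LINT x|gibbs E. q x) = (\<integral>x. p x * q x \<partial>lborel) / Z"
    if [measurable]: "q \<in> borel_measurable borel" for q :: "'a \<Rightarrow> real"
    unfolding gibbs using Z p0 by (subst integral_density) auto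
  have intb: "integrable lborel (\<lambda>x. p x * q x)"
    if "integrable (gibbs E) q" and [measurable]: "q \<in> borel_measurable borel" for q :: "'a \<Rightarrow> real"
  proof -
    have "integrable lborel (\<lambda>x. p x / Z * q x)"
      using that(1) Z p0 unfolding gibbs by (subst (asm) integrable_density) auto
    then have "integrable lborel (\<lambda>x. Z * (p x / Z * q x))" by (rule integrable_mult_right)
    moreover have "(\<lambda>x. Z * (p x / Z * q x)) = (\<lambda>x. p x * q x)" using Z by (simp add: fun_eq_iff)
    ultimately show ?thesis by (simp only:)
  qed
  have f2: "integrable lborel (\<lambda>x. p x * (f x)\<^sup>2)"
    using f by (intro intb) (auto simp: L2_def)
  have g2: "integrable lborel (\<lambda>x. p x * (norm (g x))\<^sup>2)"
    using g by (intro intb) (auto simp: L2_def)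
  have "Z * (\<integral>x. p x * (f x)\<^sup>2 \<partial>lborel) - (\<integral>x. p x * f x \<partial>lborel)\<^sup>2
     \<le> 1 / \<rho> * (Z * (\<integral>x. p x * (norm (g x))\<^sup>2 \<partial>lborel))"
    unfolding Z_def
    by (rule poincare_log_concave[OF rho \<Omega>(1) conv _ p_int _ _ f2 g2 wg]) (auto simp: p_def[abs_def])
  then have "(Z * (\<integral>x. p x * (f x)\<^sup>2 \<partial>lborel) - (\<integral>x. p x * f x \<partial>lborel)\<^sup>2) / Z\<^sup>2
     \<le> (1 / \<rho> * (Z * (\<integral>x. p x * (norm (g x))\<^sup>2 \<partial>lborel))) / Z\<^sup>2"
    by (rule divide_right_mono) simp
  then show ?thesis
    unfolding var_def using Z by (simp add: int diff_divide_distrib power2_eq_square)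
qed

section \<open>Gibbs measures on the chamber\<close>

lemma open_chamber: "open (chamber :: (real ^ 'n::{finite,linorder}) set)"
proof -
  have eq: "(chamber :: (real ^ 'n::{finite,linorder}) set) = (\<Inter>i. \<Inter>j. {x. i < j \<longrightarrow> x $ j < x $ i})"
    by (auto simp: chamber_def)
  have "open {x :: real ^ 'n::{finite,linorder}. i < j \<longrightarrow> x $ j < x $ i}" for i j
    by (cases "i < j") (auto intro!: open_Collect_less continuous_intros)
  then show ?thesis unfolding eq by (intro open_INT ballI finite)
qed

lemma convex_chamber: "convex (chamber :: (real ^ 'n::{finite,linorder}) set)"
proof (rule convexI)
  fix x y :: "real ^ 'n::{finite,linorder}" and u v :: real
  assume "x \<in> chamber" "y \<in> chamber" and uv: "0 \<le> u" "0 \<le> v" "u + v = 1"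
  then show "u *\<^sub>R x + v *\<^sub>R y \<in> chamber"
    unfolding chamber_def
  proof (clarsimp)
    fix i j :: 'n
    assume "\<forall>i j. i < j \<longrightarrow> x $ j < x $ i" "\<forall>i j. i < j \<longrightarrow> y $ j < y $ i" "i < j"
    then have "x $ i - x $ j > 0" "y $ i - y $ j > 0" by auto
    then have "u * (x $ i - x $ j) + v * (y $ i - y $ j) > 0"
      using uv by (cases "u = 0") (auto intro: add_pos_nonneg)
    then show "u * x $ j + v * y $ j < u * x $ i + v * y $ i" by (simp add: algebra_simps)
  qed
qed

lemma chamber_nonempty: "(chamber :: (real ^ 'n::{finite,linorder}) set) \<noteq> {}"
proof -
  have "card {k. k < i} < card {k. k < j}" if "i < j" for i j :: 'n
    using that by (intro psubset_card_mono) auto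
  then have "(\<chi> i. - real (card {k. k < i})) \<in> (chamber :: (real ^ 'n::{finite,linorder}) set)"
    by (simp add: chamber_def)
  then show ?thesis by blast
qed

lemma exp_neg_energy:
  fixes V :: "real ^ 'n::{finite,linorder} \<Rightarrow> real"
  assumes W: "\<forall>u>0. \<bar>W u\<bar> \<noteq> \<infinity>" "\<forall>u\<le>0. W u = \<infinity>"
  shows "exp_neg (energy V W x) = indicator chamber x *
    exp (- (V x + (\<Sum>(i, j)\<in>{(i, j). i < j}. real_of_ereal (W (x $ i - x $ j)))))"
proof (cases "x \<in> chamber")
  case True
  have "(\<Sum>(i, j)\<in>{(i, j). i < j}. W (x $ i - x $ j))
      = (\<Sum>q\<in>{(i, j). i < j}. ereal (case q of (i, j) \<Rightarrow> real_of_ereal (W (x $ i - x $ j))))"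
    using True W(1) by (intro sum.cong) (auto simp: chamber_def ereal_real)
  then show ?thesis using True by (simp add: energy_def exp_neg_def)
next
  case False
  then obtain i j :: 'n where ij: "i < j" "x $ i - x $ j \<le> 0" by (force simp: chamber_def)
  then have "W (x $ i - x $ j) = \<infinity>" using W(2) by blast
  with ij(1) have "(\<Sum>(i, j)\<in>{(i, j). i < j}. W (x $ i - x $ j)) = \<infinity>"
    by (subst sum_Pinfty) (auto intro!: bexI[of _ "(i, j)"])
  then show ?thesis using False by (simp add: energy_def exp_neg_def)
qed

lemma convex_on_sum_family:
  assumes "finite I" "convex S" "\<And>i. i \<in> I \<Longrightarrow> convex_on S (f i)"
  shows "convex_on S (\<lambda>x. \<Sum>i\<in>I. f i x)"
  using assms(1,3)
proof (induction I rule: finite_induct)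
  case empty
  show ?case using assms(2) by (simp add: convex_on_def)
next
  case (insert i I)
  then show ?case by (simp add: convex_on_add)
qed

lemma convex_on_energy:
  fixes V :: "real ^ 'n::{finite,linorder} \<Rightarrow> real"
  assumes V: "rho_convex \<rho> (\<lambda>x. ereal (V x))"
    and W: "convex_ext W" "\<forall>u>0. \<bar>W u\<bar> \<noteq> \<infinity>"
  shows "convex_on chamber (\<lambda>x. (V x + (\<Sum>(i, j)\<in>{(i, j). i < j}. real_of_ereal (W (x $ i - x $ j))))
    - \<rho> / 2 * (norm x)\<^sup>2)"
proof -
  have "convex_on UNIV (\<lambda>x. V x - \<rho> * (norm x)\<^sup>2 / 2)"
    using V by (simp add: rho_convex_def flip: convex_ext_real_iff)
  then have cV: "convex_on chamber (\<lambda>x. V x - \<rho> * (norm x)\<^sup>2 / 2)"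
    by (rule convex_on_subset) (auto simp: convex_chamber)
  have cW: "convex_on chamber (\<lambda>x :: real ^ 'n::{finite,linorder}. case q of (i, j) \<Rightarrow> real_of_ereal (W (x $ i - x $ j)))"
    if q: "q \<in> {(i, j). i < j}" for q
  proof -
    obtain i j where ij: "q = (i, j)" "i < j" using q by auto
    have "convex_on chamber (\<lambda>x :: real ^ 'n::{finite,linorder}. real_of_ereal (W (x $ i - x $ j)))"
    proof (rule convex_onI[OF _ convex_chamber])
      fix t :: real and x y :: "real ^ 'n::{finite,linorder}"
      assume t: "0 < t" "t < 1" and xy: "x \<in> chamber" "y \<in> chamber"
      let ?d = "\<lambda>x :: real ^ 'n::{finite,linorder}. x $ i - x $ j"
      have d: "?d x > 0" "?d y > 0" using xy ij(2) by (auto simp: chamber_def)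
      have eq: "?d ((1 - t) *\<^sub>R x + t *\<^sub>R y) = (1 - t) *\<^sub>R ?d x + t *\<^sub>R ?d y"
        by (simp add: algebra_simps)
      have d': "(1 - t) *\<^sub>R ?d x + t *\<^sub>R ?d y > 0" using d t by (simp add: add_pos_pos)
      have W_real: "\<exists>a. W u = ereal a" if "u > 0" for u
        using W(2)[rule_format, OF that] by (cases "W u") auto
      obtain a b c where a: "W (?d x) = ereal a" and b: "W (?d y) = ereal b"
        and c: "W ((1 - t) *\<^sub>R ?d x + t *\<^sub>R ?d y) = ereal c"
        using W_real[OF d(1)] W_real[OF d(2)] W_real[OF d'] by blast
      have "W ((1 - t) *\<^sub>R ?d x + t *\<^sub>R ?d y) \<le> ereal (1 - t) * W (?d x) + ereal t * W (?d y)"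
        using W(1) t unfolding convex_ext_def by simp
      then have "c \<le> (1 - t) * a + t * b" unfolding a b c by simp
      then show "real_of_ereal (W (?d ((1 - t) *\<^sub>R x + t *\<^sub>R y)))
          \<le> (1 - t) * real_of_ereal (W (?d x)) + t * real_of_ereal (W (?d y))"
        unfolding eq a b c by simp
    qed
    then show ?thesis by (simp add: ij)
  qed
  have "convex_on chamber (\<lambda>x. (V x - \<rho> * (norm x)\<^sup>2 / 2)
      + (\<Sum>q\<in>{(i, j). i < j}. case q of (i, j) \<Rightarrow> real_of_ereal (W (x $ i - x $ j))))"
    by (intro convex_on_add cV convex_on_sum_family convex_chamber cW) simp_all
  then show ?thesis by (simp add: algebra_simps)
qed

section \<open>The beta Hermite ensemble\<close>

lemma rho_convex_hermite_V: "rho_convex (real CARD('n)) (\<lambda>x :: real ^ 'n::{finite,linorder}. ereal (hermite_V x))"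
  by (simp add: rho_convex_def hermite_V_def convex_ext_def zero_ereal_def[symmetric])

lemma convex_ext_hermite_W:
  assumes "\<beta> > 0"
  shows "convex_ext (hermite_W \<beta>)"
  unfolding convex_ext_def
proof (intro conjI allI ballI)
  show "hermite_W \<beta> x \<noteq> -\<infinity>" for x by (simp add: hermite_W_def)
  fix x y t :: real assume t: "t \<in> {0..1}"
  show "hermite_W \<beta> ((1 - t) *\<^sub>R x + t *\<^sub>R y) \<le> ereal (1 - t) * hermite_W \<beta> x + ereal t * hermite_W \<beta> y"
  proof (cases "t = 0 \<or> t = 1")
    case True
    then show ?thesis by (auto simp: zero_ereal_def[symmetric] one_ereal_def[symmetric])
  next
    case False
    then have t: "0 < t" "t < 1" using t by auto
    show ?thesis
    proof (cases "x > 0 \<and> y > 0")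
      case True
      have "- ln ((1 - t) *\<^sub>R x + t *\<^sub>R y) \<le> (1 - t) * (- ln x) + t * (- ln y)"
        using ln_concave t True unfolding concave_on_def by (intro convex_onD[of "{0<..}"]) auto
      then have "\<beta> * (- ln ((1 - t) *\<^sub>R x + t *\<^sub>R y)) \<le> \<beta> * ((1 - t) * (- ln x) + t * (- ln y))"
        using assms by (intro mult_left_mono) auto
      moreover have "(1 - t) * x + t * y > 0" using t True by (simp add: add_pos_pos)
      ultimately show ?thesis using True by (simp add: hermite_W_def algebra_simps)
    next
      case False
      then show ?thesis using t by (auto simp: hermite_W_def)
    qed
  qed
qed

text \<open>
  The integrand is a product over the coordinates, each factor being a multiple of a normal density.
\<close>

lemma gaussian_nn_integral_finite:
  assumes "a > 0"
  shows "(\<integral>\<^sup>+x. ennreal (exp (- a * (norm x)\<^sup>2)) \<partial>(lborel :: 'a::euclidean_space measure)) < \<infinity>"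
proof -
  define \<sigma> where "\<sigma> = 1 / sqrt (2 * a)"
  have \<sigma>: "\<sigma> > 0" "\<sigma>\<^sup>2 = 1 / (2 * a)" using assms by (auto simp: \<sigma>_def power_divide)
  have "exp (- a * t\<^sup>2) = sqrt (2 * pi * \<sigma>\<^sup>2) * normal_density 0 \<sigma> t" for t
    using assms \<sigma> by (simp add: normal_density_def field_simps)
  then have "integrable lborel (\<lambda>t. exp (- a * t\<^sup>2))"
    using integrable_normal_density[OF \<sigma>(1), of 0] by simp
  then have fin: "(\<integral>\<^sup>+t. ennreal (exp (- a * t\<^sup>2)) \<partial>lborel) < \<infinity>"
    by (subst nn_integral_eq_integral) auto
  have "ennreal (exp (- a * (norm x)\<^sup>2)) = (\<Prod>b\<in>Basis. ennreal (exp (- a * (x \<bullet> b)\<^sup>2)))" for x :: 'a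
  proof -
    have "exp (- a * (norm x)\<^sup>2) = exp (\<Sum>b\<in>Basis. - a * (x \<bullet> b)\<^sup>2)"
      unfolding power2_norm_eq_inner euclidean_inner[of x x]
      by (simp add: sum_distrib_left power2_eq_square sum_negf)
    then show ?thesis by (simp add: exp_sum prod_ennreal)
  qed
  then have "(\<integral>\<^sup>+x. ennreal (exp (- a * (norm x)\<^sup>2)) \<partial>(lborel :: 'a measure))
      = (\<integral>\<^sup>+x. (\<Prod>b\<in>Basis. ennreal (exp (- a * (x \<bullet> b)\<^sup>2))) \<partial>(lborel :: 'a measure))"
    by (simp only:)
  also have "\<dots> = (\<Prod>b\<in>(Basis::'a set). \<integral>\<^sup>+t. ennreal (exp (- a * t\<^sup>2)) \<partial>lborel)"
    by (rule nn_integral_lborel_prod) auto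
  also have "\<dots> < \<infinity>" using fin by (simp add: power_less_top_ennreal)
  finally show ?thesis .
qed

text \<open>
  As \<open>ln u \<le> u\<close>, each factor \<open>(x\<^sub>i - x\<^sub>j) powr \<beta>\<close> is at most \<open>exp (2 * \<beta> * |x|)\<close>, so the interaction grows at
  most like \<open>exp (c * |x|)\<close>. Half of the Gaussian exponent absorbs this and the other half is integrable.
\<close>

lemma partition_fun_hermite_finite:
  assumes \<beta>: "\<beta> > 0"
  shows "partition_fun (energy hermite_V (hermite_W \<beta>) :: real ^ 'n::{finite,linorder} \<Rightarrow> ereal) < \<infinity>"
proof -
  define N where "N = real (card {(i, j). i < (j::'n)})"
  define n where "n = real CARD('n)"
  have n: "n > 0" by (simp add: n_def)
  define c where "c = 2 * \<beta> * N"
  have le: "exp_neg (energy hermite_V (hermite_W \<beta>) x) \<le> exp (c\<^sup>2 / n) * exp (- (n / 4) * (norm x)\<^sup>2)"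
    for x :: "real ^ 'n::{finite,linorder}"
  proof -
    have fac: "(x $ i - x $ j) powr \<beta> \<le> exp (2 * \<beta> * norm x)" if "x $ i - x $ j > 0" for i j
    proof -
      have "\<beta> * ln (x $ i - x $ j) \<le> \<beta> * (2 * norm x)"
      proof (rule mult_left_mono)
        have "ln (x $ i - x $ j) \<le> x $ i - x $ j" using that by (rule ln_bound)
        also have "\<dots> \<le> 2 * norm x"
          using component_le_norm_cart[of x i] component_le_norm_cart[of x j] by linarith
        finally show "ln (x $ i - x $ j) \<le> 2 * norm x" .
      qed (use \<beta> in simp)
      then show ?thesis using that by (simp add: powr_def)
    qed
    have "(\<Prod>(i, j)\<in>{(i, j). i < j}. (x $ i - x $ j) powr \<beta>) * indicator chamber x
        \<le> (\<Prod>q\<in>{(i, j). i < (j::'n)}. exp (2 * \<beta> * norm x))"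
    proof (cases "x \<in> chamber")
      case True
      have "(\<Prod>(i, j)\<in>{(i, j). i < j}. (x $ i - x $ j) powr \<beta>)
          \<le> (\<Prod>q\<in>{(i, j). i < (j::'n)}. exp (2 * \<beta> * norm x))"
        by (rule prod_mono) (use True in \<open>auto simp: chamber_def intro!: fac\<close>)
      then show ?thesis using True by (simp del: prod_constant)
    qed (simp add: prod_nonneg)
    also have "\<dots> = exp (c * norm x)"
      by (simp add: exp_of_nat_mult[symmetric] c_def N_def mult_ac)
    finally have P: "(\<Prod>(i, j)\<in>{(i, j). i < j}. (x $ i - x $ j) powr \<beta>) * indicator chamber x
        \<le> exp (c * norm x)" .
    have "0 \<le> n * (norm x / 2 - c / n)\<^sup>2" using n by simp
    also have "\<dots> = n / 4 * (norm x)\<^sup>2 - c * norm x + c\<^sup>2 / n"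
      using n by (simp add: power2_eq_square field_simps)
    finally have Q: "- (n / 2 * (norm x)\<^sup>2) + c * norm x \<le> c\<^sup>2 / n + - (n / 4) * (norm x)\<^sup>2"
      by simp
    have "exp_neg (energy hermite_V (hermite_W \<beta>) x)
        \<le> exp (- (n / 2 * (norm x)\<^sup>2)) * exp (c * norm x)"
      unfolding exp_neg_energy_hermite n_def[symmetric] mult.assoc
      using P by (intro mult_left_mono) auto
    also have "\<dots> \<le> exp (c\<^sup>2 / n) * exp (- (n / 4) * (norm x)\<^sup>2)"
      unfolding exp_add[symmetric] using Q by (simp only: exp_le_cancel_iff)
    finally show ?thesis .
  qed
  have "partition_fun (energy hermite_V (hermite_W \<beta>) :: real ^ 'n::{finite,linorder} \<Rightarrow> ereal)
      \<le> (\<integral>\<^sup>+x. ennreal (exp (c\<^sup>2 / n)) * ennreal (exp (- (n / 4) * (norm (x :: real ^ 'n::{finite,linorder}))\<^sup>2)) \<partial>lborel)"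
    unfolding partition_fun_def
    by (intro nn_integral_mono) (use le in \<open>simp add: ennreal_mult[symmetric] ennreal_leI\<close>)
  also have "\<dots> = ennreal (exp (c\<^sup>2 / n)) * (\<integral>\<^sup>+x. ennreal (exp (- (n / 4) * (norm (x :: real ^ 'n::{finite,linorder}))\<^sup>2)) \<partial>lborel)"
    by (rule nn_integral_cmult) measurable
  also have "\<dots> < \<infinity>"
    using gaussian_nn_integral_finite[of "n / 4", where ?'a="real ^ 'n::{finite,linorder}"] n
    by (simp add: ennreal_mult_less_top)
  finally show ?thesis .
qed

section \<open>The Poincare inequality on the chamber\<close>

lemma poincare_energy:
  fixes V :: "real ^ 'n::{finite,linorder} \<Rightarrow> real"
  assumes "\<rho> > 0" "rho_convex \<rho> (\<lambda>x. ereal (V x))" "convex_ext W"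
    "\<forall>u>0. \<bar>W u\<bar> \<noteq> \<infinity>" "\<forall>u\<le>0. W u = \<infinity>" "partition_fun (energy V W) < \<infinity>"
    "f \<in> H1 (gibbs (energy V W)) chamber" "g \<in> L2 (gibbs (energy V W))" "has_weak_gradient chamber f g"
  shows "var (gibbs (energy V W)) f \<le> 1 / \<rho> * (LINT x|gibbs (energy V W). (norm (g x))\<^sup>2)"
  using assms(7)
  by (intro poincare_gibbs[OF assms(1) open_chamber chamber_nonempty convex_on_energy[OF assms(2-4)]
        exp_neg_energy[OF assms(4,5)] assms(6) _ assms(8,9)]) (simp add: H1_def)

theorem theorem1p1:
  shows
    "(\<forall>(V :: real ^ 'n::{finite,linorder} \<Rightarrow> real) (W :: real \<Rightarrow> ereal) (\<rho> :: real).
        \<rho> > 0 \<and> rho_convex \<rho> (\<lambda>x. ereal (V x)) \<and>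
        convex_ext W \<and> (\<forall>u>0. \<bar>W u\<bar> \<noteq> \<infinity>) \<and> (\<forall>u\<le>0. W u = \<infinity>) \<and>
        partition_fun (energy V W) < \<infinity> \<longrightarrow>
        (\<forall>f \<in> H1 (gibbs (energy V W)) chamber. \<forall>g \<in> L2 (gibbs (energy V W)).
           has_weak_gradient chamber f g \<longrightarrow>
           var (gibbs (energy V W)) f \<le> 1 / \<rho> * (LINT x|gibbs (energy V W). (norm (g x))\<^sup>2))) \<and>
     (\<forall>\<beta>>0. \<forall>f \<in> H1 (beta_hermite \<beta> :: (real ^ 'n::{finite,linorder}) measure) chamber.
        \<forall>g \<in> L2 (beta_hermite \<beta>).
           has_weak_gradient chamber f g \<longrightarrow>
           var (beta_hermite \<beta>) f \<le> 1 / real CARD('n) * (LINT x|beta_hermite \<beta>. (norm (g x))\<^sup>2))"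
proof (intro conjI allI impI ballI)
  fix V :: "real ^ 'n::{finite,linorder} \<Rightarrow> real" and W \<rho> f g
  assume "\<rho> > 0 \<and> rho_convex \<rho> (\<lambda>x. ereal (V x)) \<and>
        convex_ext W \<and> (\<forall>u>0. \<bar>W u\<bar> \<noteq> \<infinity>) \<and> (\<forall>u\<le>0. W u = \<infinity>) \<and>
        partition_fun (energy V W) < \<infinity>"
    and "f \<in> H1 (gibbs (energy V W)) chamber" "g \<in> L2 (gibbs (energy V W))" "has_weak_gradient chamber f g"
  then show "var (gibbs (energy V W)) f \<le> 1 / \<rho> * (LINT x|gibbs (energy V W). (norm (g x))\<^sup>2)"
    by (intro poincare_energy) auto
next
  fix \<beta> :: real and f :: "real ^ 'n::{finite,linorder} \<Rightarrow> real" and g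
  assume \<beta>: "\<beta> > 0" and "f \<in> H1 (beta_hermite \<beta>) chamber" "g \<in> L2 (beta_hermite \<beta>)"
    "has_weak_gradient chamber f g"
  then show "var (beta_hermite \<beta>) f \<le> 1 / real CARD('n) * (LINT x|beta_hermite \<beta>. (norm (g x))\<^sup>2)"
    unfolding beta_hermite_def
    by (intro poincare_energy rho_convex_hermite_V convex_ext_hermite_W partition_fun_hermite_finite)
       (auto simp: hermite_W_def)
qed

end
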